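(* Let $n,k$ be coprime positive integers with $1\le k<n$, let $\frac n{n-k}=n_1'-\frac1{n_2'-\ldots-\frac1{n_{p'}'}}$ with all $n_j'\ge2$, and let $\eta\in\mathbb C$. Put $$\mu=n\eta,\qquad \mu_j=d(n_1',\dots,n_{j-1}')\,\eta,\qquad \gamma_j=-d(n_{j+1}',\dots,n_{p'}')\qquad(1\le j\le p').$$ Then there is an algebra homomorphism $$\Psi\colon Y_{p'}(\Gamma,\mu;\mu_1,\dots,\mu_{p'})\to Z_{n,k}(\Gamma,\eta)$$ defined on the generators by $$\Psi(e(nu,u_1,\dots,u_{p'}))=\sum_{\alpha\in\mathbb Z/n\mathbb Z}x_{1-\alpha}(u)\,w_\alpha(u_1+\gamma_1u,\dots,u_{p'}+\gamma_{p'}u),\qquad u,u_1,\dots,u_{p'}\in\mathbb C,$$ where $w_\alpha=w_\alpha^{n/n-k}\in\Theta_{n/n-k}(\Gamma)$.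
   Context: Lattice and theta functions. Fix $\tau\in\mathbb C$ with $\mathrm{Im}\,\tau>0$ and $\Gamma=\mathbb Z+\mathbb Z\tau$. Put $\theta(z)=\sum_{a\in\mathbb Z}(-1)^a e^{2\pi i(az+\frac{a(a-1)}2\tau)}$, and for $\alpha\in\mathbb Z$ $$\theta_\alpha(z)=\theta\left(z+\tfrac{\alpha}{n}\tau\right)\theta\left(z+\tfrac{\alpha}{n}\tau+\tfrac1n\right)\cdots\theta\left(z+\tfrac{\alpha}{n}\tau+\tfrac{n-1}n\right)e^{2\pi i\left(\alpha z+\frac{\alpha(\alpha-n)}{2n}\tau+\frac\alpha{2n}\right)};$$ this depends only on $\alpha$ modulo $n$. Determinants. $d(m_1,\dots,m_q)$ is the determinant of the $q\times q$ tridiagonal matrix with diagonal entries $m_1,\dots,m_q$ and all entries immediately above and below the diagonal equal to $-1$; $d(\varnothing)=1$. Thus $n=d(n'_1,\dots,n'_{p'})$, $n-k=d(n'_2,\dots,n'_{p'})$. The space $\Theta_{n/n-k}(\Gamma)$ consists of the entire functions $f$ of $p'$ variables such that for $1\le\alpha\le p'$ (with $z_0=z_{p'+1}=0$) $f$ is invariant under $z_\alpha\mapsto z_\alpha+1$ and $$f(z_1,\dots,z_\alpha+\tau,\dots,z_{p'})=(-1)^{n'_\alpha}e^{-2\pi i(n'_\alpha z_\alpha-z_{\alpha-1}-z_{\alpha+1}-(\delta_{1,\alpha}-1)\tau)}f(z_1,\dots,z_{p'}).$$ It has dimension $n$. With $r_\alpha=d(n'_{\alpha+1},\dots,n'_{p'})/n$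 put $T_{\frac1n}f(z_1,\dots,z_{p'})=f(z_1+r_1,\dots,z_{p'}+r_{p'})$ and $T_{\frac1n\tau}f(z_1,\dots,z_{p'})=e^{2\pi i(z_1+\varphi)}f(z_1+r_1\tau,\dots,z_{p'}+r_{p'}\tau)$, where the constant $\varphi\in\mathbb C$ is chosen so that $T_{\frac1n\tau}^n=1$ on $\Theta_{n/n-k}(\Gamma)$. Then $\{w_\alpha=w_\alpha^{n/n-k};\ \alpha\in\mathbb Z/n\mathbb Z\}$ denotes the basis of $\Theta_{n/n-k}(\Gamma)$ (unique up to a common constant factor) with $T_{\frac1n}w_\alpha=e^{2\pi i\frac{n-k}n\alpha}w_\alpha$, $T_{\frac1n\tau}w_\alpha=w_{\alpha+1}$. The algebra $Z_{n,k}(\Gamma,\eta)$ is the associative algebra with generators $\{x_\alpha(u);\ \alpha\in\mathbb Z/n\mathbb Z,\ u\in\mathbb C\}$ and relations $$\frac{\theta_1(0)\cdots\theta_{n-1}(0)\,\theta_0(v-u+\eta)\cdots\theta_{n-1}(v-u+\eta)}{\theta_0(\eta)\cdots\theta_{n-1}(\eta)\,\theta_0(v-u)\cdots\theta_{n-1}(v-u)}x_\alpha(u)x_\beta(v)=\sum_{r\in\mathbb Z/n\mathbb Z}\frac{\theta_{\beta-\alpha+r(k-1)}(v-u+\eta)}{\theta_{kr}(\eta)\,\theta_{\beta-\alpha-r}(v-u)}x_{\beta-r}(v)x_{\alpha+r}(u)$$ for all $\alpha,\beta$ and all $u,v$ with $n(v-u)\notin\Gamma$. If $n\eta\in\Gamma$,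 the relation is understood after multiplying both sides by $\theta_0(\eta)\cdots\theta_{n-1}(\eta)$. The algebra $Y_{p'}(\Gamma,\mu;\mu_1,\dots,\mu_{p'})$ (for $\mu,\mu_1,\dots,\mu_{p'}\in\mathbb C$) is the associative algebra with generators $\{e(u,u_1,\dots,u_{p'});\ u,u_1,\dots,u_{p'}\in\mathbb C\}$ and defining relations $$\frac{\theta(v-u+\mu)}{\theta(v-u)}e(u,u_1,\dots,u_{p'})e(v,v_1+\mu_1,\dots,v_{p'}+\mu_{p'})$$ $$=\frac{\theta(\mu)\theta(v-u+u_1-v_1)}{\theta(v-u)\theta(u_1-v_1)}e(v,u_1,\dots,u_{p'})e(u,v_1+\mu_1,\dots,v_{p'}+\mu_{p'})$$ $$+\sum_{1\le t<p'}\frac{\theta(\mu)\theta(v_t-u_t+u_{t+1}-v_{t+1})}{\theta(v_t-u_t)\theta(u_{t+1}-v_{t+1})}e(v,v_1,\dots,v_t,u_{t+1},\dots,u_{p'})\,e(u,u_1+\mu_1,\dots,u_t+\mu_t,v_{t+1}+\mu_{t+1},\dots,v_{p'}+\mu_{p'})$$ $$+\frac{\theta(v_{p'}-u_{p'}+\mu)}{\theta(v_{p'}-u_{p'})}e(v,v_1,\dots,v_{p'})e(u,u_1+\mu_1,\dots,u_{p'}+\mu_{p'})$$ for all values of the parameters for which the coefficients are defined ($v-u\notin\Gamma$, $u_j-v_j\notin\Gamma$). *)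

theory Defs
  imports
    "HOL-Complex_Analysis.Complex_Analysis"
    "HOL-Library.Poly_Mapping"
    "HOL-Algebra.QuotRing"
    "HOL-Algebra.Module"
    "Jordan_Normal_Form.Determinant"
begin

section \<open>Algebras given by generators and relations\<close>

datatype 'g free_mon = Word (letters: "'g list")

instantiation free_mon :: (type) monoid_add
begin

definition "0 = Word []"
definition "a + b = Word (letters a @ letters b)"

instance
  by standard (simp_all add: zero_free_mon_def plus_free_mon_def)

end

text \<open>
  The type below carries the convolution product of \<^theory>\<open>HOL-Library.Poly_Mapping\<close>, so it is the ring of
  noncommutative polynomials over the complex numbers with letters of type \<open>'g\<close>.
\<close>

type_synonym 'g nc_poly = "'g free_mon \<Rightarrow>\<^sub>0 complex"

definition nc_var :: "'g \<Rightarrow> 'g nc_poly" where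
  "nc_var g = Poly_Mapping.single (Word [g]) 1"

definition nc_scale :: "complex \<Rightarrow> 'g nc_poly \<Rightarrow> 'g nc_poly" (infixr \<open>\<bullet>\<^sub>n\<^sub>c\<close> 75) where
  "c \<bullet>\<^sub>n\<^sub>c p = Poly_Mapping.map ((*) c) p"

text \<open>
  Noncommutative unital algebras are represented by the record type \<open>module\<close> of
  \<^theory>\<open>HOL-Algebra.Module\<close>; the locale \<open>algebra\<close> there requires commutativity and is not used.
\<close>

definition free_algebra :: "'g set \<Rightarrow> (complex, 'g nc_poly) module" where
  "free_algebra G =
    \<lparr>carrier = {p. \<forall>m\<in>Poly_Mapping.keys p. set (letters m) \<subseteq> G}, mult = (*), one = 1, zero = 0, add = (+),
     smult = (\<bullet>\<^sub>n\<^sub>c)\<rparr>"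

definition rel_ideal :: "'g set \<Rightarrow> 'g nc_poly set \<Rightarrow> 'g nc_poly set" where
  "rel_ideal G R = genideal (free_algebra G) R"

definition rel_class :: "'g set \<Rightarrow> 'g nc_poly set \<Rightarrow> 'g nc_poly \<Rightarrow> 'g nc_poly set" where
  "rel_class G R p = rel_ideal G R +>\<^bsub>free_algebra G\<^esub> p"

text \<open>An element of \<open>R\<close> stands for the relation that sets it to zero.\<close>

definition presented_algebra ::
  "'g set \<Rightarrow> 'g nc_poly set \<Rightarrow> (complex, 'g nc_poly set) module" where
  "presented_algebra G R =
    ring.extend (free_algebra G Quot rel_ideal G R)
      (module.fields (\<lambda>c X. \<Union>p\<in>X. rel_class G R (c \<bullet>\<^sub>n\<^sub>c p)))"

definition algebra_hom ::
  "(complex, 'a, 'm) module_scheme \<Rightarrow> (complex, 'b, 'n) module_scheme \<Rightarrow> ('a \<Rightarrow> 'b) set" where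
  "algebra_hom A B =
    {h \<in> Ring.ring_hom A B. \<forall>c. \<forall>x\<in>carrier A. h (c \<odot>\<^bsub>A\<^esub> x) = c \<odot>\<^bsub>B\<^esub> h x}"


section \<open>Theta functions in one variable\<close>

definition e2pi :: "complex \<Rightarrow> complex" where
  "e2pi z = exp (2 * of_real pi * \<i> * z)"

definition period_lattice :: "complex \<Rightarrow> complex set" where
  "period_lattice \<tau> = {of_int a + of_int b * \<tau> |a b :: int. True}"

definition theta :: "complex \<Rightarrow> complex \<Rightarrow> complex" where
  "theta \<tau> z =
    (\<Sum>\<^sub>\<infinity>a::int. (-1) powi a * e2pi (of_int a * z + of_int (a * (a - 1)) / 2 * \<tau>))"

definition theta_idx :: "complex \<Rightarrow> nat \<Rightarrow> int \<Rightarrow> complex \<Rightarrow> complex" where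
  "theta_idx \<tau> n \<alpha> z =
    (\<Prod>m<n. theta \<tau> (z + of_int \<alpha> / of_nat n * \<tau> + of_nat m / of_nat n)) *
    e2pi (of_int \<alpha> * z + of_int (\<alpha> * (\<alpha> - int n)) / (2 * of_nat n) * \<tau>
          + of_int \<alpha> / (2 * of_nat n))"


section \<open>Continued fractions\<close>

definition tridiag_det :: "int list \<Rightarrow> int" where
  "tridiag_det ms =
    Determinant.det (Matrix.mat (length ms) (length ms)
      (\<lambda>(i, j). if i = j then ms ! i else if i = Suc j \<or> j = Suc i then -1 else 0))"

text \<open>Minus continued fraction \<open>m - 1 / (m' - 1 / (\<dots>))\<close>; only nonempty lists are meaningful.\<close>

fun minus_cf :: "int list \<Rightarrow> real" where
  "minus_cf [] = 0"
| "minus_cf [m] = of_int m"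
| "minus_cf (m # ms) = of_int m - 1 / minus_cf ms"


section \<open>Theta functions in several variables\<close>

text \<open>
  Points of complex \<open>p\<close>-space are functions on \<open>nat\<close> of which only the values at \<open>1, \<dots>, p\<close> matter.
  Entire means jointly continuous and holomorphic in each variable separately;
  on functions that depend on finitely many coordinates only, continuity with
  respect to the product topology is ordinary continuity.
\<close>

definition entire_in :: "nat \<Rightarrow> ((nat \<Rightarrow> complex) \<Rightarrow> complex) \<Rightarrow> bool" where
  "entire_in p f \<longleftrightarrow>
    (\<forall>z z'. (\<forall>j\<in>{1..p}. z j = z' j) \<longrightarrow> f z = f z') \<and>
    continuous_on UNIV f \<and>
    (\<forall>z. \<forall>j\<in>{1..p}. (\<lambda>t. f (z(j := t))) holomorphic_on UNIV)"

definition coord0 :: "nat \<Rightarrow> (nat \<Rightarrow> complex) \<Rightarrow> nat \<Rightarrow> complex" where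
  "coord0 p z j = (if j \<in> {1..p} then z j else 0)"

text \<open>Lists are indexed from 0, so the entry with number \<open>\<alpha>\<close> is \<open>ns ! (\<alpha> - 1)\<close>.\<close>

definition theta_space :: "complex \<Rightarrow> int list \<Rightarrow> ((nat \<Rightarrow> complex) \<Rightarrow> complex) set" where
  "theta_space \<tau> ns =
    {f. entire_in (length ns) f \<and>
      (\<forall>\<alpha>\<in>{1..length ns}. \<forall>z.
        f (z(\<alpha> := z \<alpha> + 1)) = f z \<and>
        f (z(\<alpha> := z \<alpha> + \<tau>)) =
          (-1) powi (ns ! (\<alpha> - 1)) *
          e2pi (- (of_int (ns ! (\<alpha> - 1)) * z \<alpha>
                   - coord0 (length ns) z (\<alpha> - 1) - coord0 (length ns) z (\<alpha> + 1)
                   - ((if \<alpha> = 1 then 1 else 0) - 1) * \<tau>)) * f z)}"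

definition r_shift :: "nat \<Rightarrow> int list \<Rightarrow> nat \<Rightarrow> complex" where
  "r_shift n ns \<alpha> = of_int (tridiag_det (drop \<alpha> ns)) / of_nat n"

definition T_one ::
  "nat \<Rightarrow> int list \<Rightarrow> ((nat \<Rightarrow> complex) \<Rightarrow> complex) \<Rightarrow> (nat \<Rightarrow> complex) \<Rightarrow> complex" where
  "T_one n ns f = (\<lambda>z. f (\<lambda>j. z j + r_shift n ns j))"

definition T_tau ::
  "complex \<Rightarrow> nat \<Rightarrow> int list \<Rightarrow> complex \<Rightarrow> ((nat \<Rightarrow> complex) \<Rightarrow> complex) \<Rightarrow> (nat \<Rightarrow> complex) \<Rightarrow> complex"
  where
  "T_tau \<tau> n ns \<phi> f = (\<lambda>z. e2pi (z 1 + \<phi>) * f (\<lambda>j. z j + r_shift n ns j * \<tau>))"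

definition theta_phase :: "complex \<Rightarrow> nat \<Rightarrow> int list \<Rightarrow> complex \<Rightarrow> bool" where
  "theta_phase \<tau> n ns \<phi> \<longleftrightarrow> (\<forall>f\<in>theta_space \<tau> ns. (T_tau \<tau> n ns \<phi> ^^ n) f = f)"

text \<open>The index set of integers modulo \<open>n\<close> is rendered by \<open>n\<close>-periodic families over \<open>int\<close>.\<close>

definition theta_basis ::
  "complex \<Rightarrow> nat \<Rightarrow> nat \<Rightarrow> int list \<Rightarrow> complex \<Rightarrow> (int \<Rightarrow> (nat \<Rightarrow> complex) \<Rightarrow> complex) \<Rightarrow> bool" where
  "theta_basis \<tau> n k ns \<phi> w \<longleftrightarrow>
    (\<forall>\<alpha>. w (\<alpha> + int n) = w \<alpha>) \<and>
    (\<forall>\<alpha>. w \<alpha> \<in> theta_space \<tau> ns) \<and>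
    (\<forall>c. (\<forall>z. (\<Sum>\<alpha>\<in>{0..<int n}. c \<alpha> * w \<alpha> z) = 0) \<longrightarrow> (\<forall>\<alpha>\<in>{0..<int n}. c \<alpha> = 0)) \<and>
    (\<forall>f\<in>theta_space \<tau> ns. \<exists>c. \<forall>z. f z = (\<Sum>\<alpha>\<in>{0..<int n}. c \<alpha> * w \<alpha> z)) \<and>
    (\<forall>\<alpha>. T_one n ns (w \<alpha>) =
      (\<lambda>z. e2pi ((of_nat n - of_nat k) / of_nat n * of_int \<alpha>) * w \<alpha> z)) \<and>
    (\<forall>\<alpha>. T_tau \<tau> n ns \<phi> (w \<alpha>) = w (\<alpha> + 1))"


section \<open>The algebra Z\<close>

definition Z_gens :: "nat \<Rightarrow> (int \<times> complex) set" where
  "Z_gens n = {0..<int n} \<times> UNIV"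

definition Z_x :: "nat \<Rightarrow> int \<Rightarrow> complex \<Rightarrow> (int \<times> complex) nc_poly" where
  "Z_x n \<alpha> u = nc_var (\<alpha> mod int n, u)"

text \<open>
  The second branches, for \<open>n\<eta>\<close> in the lattice, are the coefficients of the relation after
  multiplication by the product of all \<open>theta_idx \<tau> n i \<eta>\<close>; this cancels the
  factor \<open>theta_idx \<tau> n (k * r) \<eta>\<close>, which may be zero, from the denominator.
\<close>

definition Z_lhs_coeff :: "complex \<Rightarrow> nat \<Rightarrow> complex \<Rightarrow> complex \<Rightarrow> complex" where
  "Z_lhs_coeff \<tau> n \<eta> t =
    (if of_nat n * \<eta> \<notin> period_lattice \<tau> then
       ((\<Prod>i\<in>{1..<int n}. theta_idx \<tau> n i 0) * (\<Prod>i\<in>{0..<int n}. theta_idx \<tau> n i (t + \<eta>))) /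
       ((\<Prod>i\<in>{0..<int n}. theta_idx \<tau> n i \<eta>) * (\<Prod>i\<in>{0..<int n}. theta_idx \<tau> n i t))
     else
       ((\<Prod>i\<in>{1..<int n}. theta_idx \<tau> n i 0) * (\<Prod>i\<in>{0..<int n}. theta_idx \<tau> n i (t + \<eta>))) /
       (\<Prod>i\<in>{0..<int n}. theta_idx \<tau> n i t))"

definition Z_rhs_coeff ::
  "complex \<Rightarrow> nat \<Rightarrow> nat \<Rightarrow> complex \<Rightarrow> int \<Rightarrow> int \<Rightarrow> complex \<Rightarrow> complex" where
  "Z_rhs_coeff \<tau> n k \<eta> \<delta> r t =
    (if of_nat n * \<eta> \<notin> period_lattice \<tau> then
       theta_idx \<tau> n (\<delta> + r * (int k - 1)) (t + \<eta>) /
       (theta_idx \<tau> n (int k * r) \<eta> * theta_idx \<tau> n (\<delta> - r) t)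
     else
       (\<Prod>i\<in>{0..<int n} - {(int k * r) mod int n}. theta_idx \<tau> n i \<eta>) *
       theta_idx \<tau> n (\<delta> + r * (int k - 1)) (t + \<eta>) / theta_idx \<tau> n (\<delta> - r) t)"

definition Z_rel ::
  "complex \<Rightarrow> nat \<Rightarrow> nat \<Rightarrow> complex \<Rightarrow> int \<Rightarrow> int \<Rightarrow> complex \<Rightarrow> complex \<Rightarrow> (int \<times> complex) nc_poly" where
  "Z_rel \<tau> n k \<eta> \<alpha> \<beta> u v =
    Z_lhs_coeff \<tau> n \<eta> (v - u) \<bullet>\<^sub>n\<^sub>c (Z_x n \<alpha> u * Z_x n \<beta> v) -
    (\<Sum>r\<in>{0..<int n}.
      Z_rhs_coeff \<tau> n k \<eta> (\<beta> - \<alpha>) r (v - u) \<bullet>\<^sub>n\<^sub>c (Z_x n (\<beta> - r) v * Z_x n (\<alpha> + r) u))"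

definition Z_rels :: "complex \<Rightarrow> nat \<Rightarrow> nat \<Rightarrow> complex \<Rightarrow> (int \<times> complex) nc_poly set" where
  "Z_rels \<tau> n k \<eta> =
    {Z_rel \<tau> n k \<eta> \<alpha> \<beta> u v |\<alpha> \<beta> u v. of_nat n * (v - u) \<notin> period_lattice \<tau>}"

definition Z_alg ::
  "complex \<Rightarrow> nat \<Rightarrow> nat \<Rightarrow> complex \<Rightarrow> (complex, (int \<times> complex) nc_poly set) module" where
  "Z_alg \<tau> n k \<eta> = presented_algebra (Z_gens n) (Z_rels \<tau> n k \<eta>)"

definition Z_gen ::
  "complex \<Rightarrow> nat \<Rightarrow> nat \<Rightarrow> complex \<Rightarrow> int \<Rightarrow> complex \<Rightarrow> (int \<times> complex) nc_poly set" where
  "Z_gen \<tau> n k \<eta> \<alpha> u = rel_class (Z_gens n) (Z_rels \<tau> n k \<eta>) (Z_x n \<alpha> u)"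


section \<open>The algebra Y\<close>

definition Y_gens :: "nat \<Rightarrow> (complex \<times> (nat \<Rightarrow> complex)) set" where
  "Y_gens p = UNIV \<times> ({1..p} \<rightarrow>\<^sub>E UNIV)"

definition Y_e ::
  "nat \<Rightarrow> complex \<Rightarrow> (nat \<Rightarrow> complex) \<Rightarrow> (complex \<times> (nat \<Rightarrow> complex)) nc_poly" where
  "Y_e p u us = nc_var (u, restrict us {1..p})"

definition Y_rel ::
  "complex \<Rightarrow> nat \<Rightarrow> complex \<Rightarrow> (nat \<Rightarrow> complex) \<Rightarrow> complex \<Rightarrow> complex \<Rightarrow>
    (nat \<Rightarrow> complex) \<Rightarrow> (nat \<Rightarrow> complex) \<Rightarrow> (complex \<times> (nat \<Rightarrow> complex)) nc_poly" where
  "Y_rel \<tau> p \<mu> \<mu>s u v us vs =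
    (theta \<tau> (v - u + \<mu>) / theta \<tau> (v - u)) \<bullet>\<^sub>n\<^sub>c
      (Y_e p u us * Y_e p v (\<lambda>j. vs j + \<mu>s j)) -
    ((theta \<tau> \<mu> * theta \<tau> (v - u + us 1 - vs 1)) / (theta \<tau> (v - u) * theta \<tau> (us 1 - vs 1))) \<bullet>\<^sub>n\<^sub>c
      (Y_e p v us * Y_e p u (\<lambda>j. vs j + \<mu>s j)) -
    (\<Sum>t\<in>{1..<p}.
      ((theta \<tau> \<mu> * theta \<tau> (vs t - us t + us (t + 1) - vs (t + 1))) /
       (theta \<tau> (vs t - us t) * theta \<tau> (us (t + 1) - vs (t + 1)))) \<bullet>\<^sub>n\<^sub>c
      (Y_e p v (\<lambda>j. if j \<le> t then vs j else us j) *
       Y_e p u (\<lambda>j. (if j \<le> t then us j else vs j) + \<mu>s j))) -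
    (theta \<tau> (vs p - us p + \<mu>) / theta \<tau> (vs p - us p)) \<bullet>\<^sub>n\<^sub>c
      (Y_e p v vs * Y_e p u (\<lambda>j. us j + \<mu>s j))"

definition Y_rels ::
  "complex \<Rightarrow> nat \<Rightarrow> complex \<Rightarrow> (nat \<Rightarrow> complex) \<Rightarrow> (complex \<times> (nat \<Rightarrow> complex)) nc_poly set" where
  "Y_rels \<tau> p \<mu> \<mu>s =
    {Y_rel \<tau> p \<mu> \<mu>s u v us vs |u v us vs.
      v - u \<notin> period_lattice \<tau> \<and> (\<forall>j\<in>{1..p}. us j - vs j \<notin> period_lattice \<tau>)}"

definition Y_alg ::
  "complex \<Rightarrow> nat \<Rightarrow> complex \<Rightarrow> (nat \<Rightarrow> complex) \<Rightarrow>
    (complex, (complex \<times> (nat \<Rightarrow> complex)) nc_poly set) module" where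
  "Y_alg \<tau> p \<mu> \<mu>s = presented_algebra (Y_gens p) (Y_rels \<tau> p \<mu> \<mu>s)"

definition Y_gen ::
  "complex \<Rightarrow> nat \<Rightarrow> complex \<Rightarrow> (nat \<Rightarrow> complex) \<Rightarrow> complex \<Rightarrow> (nat \<Rightarrow> complex) \<Rightarrow>
    (complex \<times> (nat \<Rightarrow> complex)) nc_poly set" where
  "Y_gen \<tau> p \<mu> \<mu>s u us = rel_class (Y_gens p) (Y_rels \<tau> p \<mu> \<mu>s) (Y_e p u us)"

end

theory Submission
  imports Defs
begin

text \<open>
  Write \<open>e(x)\<close> for \<open>e2pi x\<close>, \<open>p\<close> for the number of partial quotients, \<open>\<kappa>(a, b)\<close> for the Kronecker quotient
  \<open>\<theta>(a + b) / (\<theta>(a) \<theta>(b))\<close>, and \<open>\<mu>\<^sub>j, \<gamma>\<^sub>j\<close> for the integers of the theorem, so that the shifts in the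
  relation of \<open>Y\<close> are \<open>\<mu>\<^sub>j \<eta>\<close>. Set
  \<open>\<gamma>\<^sub>0 = -n\<close>, \<open>\<gamma>\<^sub>p\<^sub>+\<^sub>1 = 0\<close>, \<open>\<mu>\<^sub>0 = 0\<close>, \<open>\<mu>\<^sub>p\<^sub>+\<^sub>1 = n\<close>. Then both sequences satisfy the continuant recurrence
  \<open>c\<^sub>j\<^sub>-\<^sub>1 + c\<^sub>j\<^sub>+\<^sub>1 = n\<^sub>j c\<^sub>j\<close> for all \<open>j\<close> from \<open>1\<close> to \<open>p\<close>, which is exactly what the quasi-periods of
  \<open>\<Theta>\<^sub>n\<^sub>/\<^sub>n\<^sub>-\<^sub>k\<close> require.

  A map from a presented algebra is a substitution of generators that sends every relation into the
  ideal of relations of the target (\<open>presented_algebra_hom\<close>). So take a relation of \<open>Y\<close> with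
  parameters \<open>nu, nv, u\<^sub>j, v\<^sub>j\<close> and substitute. With \<open>z = v - u\<close>, \<open>y\<^sub>j = u\<^sub>j + \<gamma>\<^sub>j u\<close>,
  \<open>Y\<^sub>j = v\<^sub>j + \<mu>\<^sub>j \<eta> + \<gamma>\<^sub>j v\<close> and
  \<open>s\<^sub>j = y\<^sub>j - Y\<^sub>j + \<gamma>\<^sub>j z + \<mu>\<^sub>j \<eta>\<close>, with \<open>y\<^sub>j = Y\<^sub>j = 0\<close> for \<open>j = 0, p + 1\<close>, one has \<open>s\<^sub>j = u\<^sub>j - v\<^sub>j\<close> for
  \<open>1 \<le> j \<le> p\<close>, \<open>s\<^sub>0 = -n z\<close> and \<open>s\<^sub>p\<^sub>+\<^sub>1 = n \<eta>\<close>, and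
  the coefficients on the right of the relation become \<open>\<theta>(n \<eta>) \<kappa>(- s\<^sub>t, s\<^sub>t\<^sub>+\<^sub>1)\<close> for \<open>t = 0, \<dots>, p\<close>, all of one shape.
  The product on the left contains the monomials \<open>x\<^sub>1\<^sub>-\<^sub>\<alpha>(u) x\<^sub>1\<^sub>-\<^sub>\<beta>(v)\<close> with coefficients
  \<open>w\<^sub>\<alpha>(y) w\<^sub>\<beta>(Y)\<close>; rewriting each of them by a relation of \<open>Z\<close> leaves only monomials
  \<open>x\<^sub>1\<^sub>-\<^sub>a(v) x\<^sub>1\<^sub>-\<^sub>b(u)\<close>. Comparing their coefficients reduces everything to
  the identity between theta functions \<open>exchange_identity\<close>: after
  clearing denominators, the sum over \<open>t\<close> of \<open>\<kappa>(- s\<^sub>t, s\<^sub>t\<^sub>+\<^sub>1)\<close> times a product of values of \<open>w\<^sub>a\<close> and \<open>w\<^sub>b\<close> is a combination of the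
  products \<open>w\<^sub>b\<^sub>+\<^sub>r(y) w\<^sub>a\<^sub>-\<^sub>r(Y)\<close> whose coefficients are the structure constants of \<open>Z\<close>.

  The exchange identity holds for the following reason. The cleared left side \<open>numer\<close> vanishes
  whenever \<open>s\<^sub>j\<close> lies in the lattice, because the terms \<open>t = j - 1\<close> and \<open>t = j\<close> have opposite residues there; hence it is
  \<open>\<theta>(s\<^sub>1) \<dots> \<theta>(s\<^sub>p)\<close> times an entire function \<open>quot\<close>. For fixed \<open>Y\<close> and \<open>z\<close>, the quotient belongs to
  \<open>\<Theta>\<^sub>n\<^sub>/\<^sub>n\<^sub>-\<^sub>k\<close> as a function of \<open>y\<close>. Subtracting the claimed value and expanding in the basis gives
  a function \<open>\<Sum> d\<^sub>\<alpha>(z) w\<^sub>\<alpha>(y)\<close> with entire coefficients \<open>d\<^sub>\<alpha>\<close>. Moving \<open>z\<close> by \<open>1/n\<close> or \<open>\<tau>/n\<close> and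
  simultaneously \<open>y\<close> by the corresponding torsion translation leaves \<open>s\<^sub>1, \<dots>, s\<^sub>p\<close> alone, so the action of
  the two translations on the basis yields quasi-periodicity of the \<open>d\<^sub>\<alpha>\<close>. At \<open>z = 0\<close> the identity is evident, hence
  \<open>d\<^sub>\<alpha>\<close> vanishes on \<open>1/n \<Gamma>\<close> and is divisible by \<open>\<theta>(n z)\<close>. The quotient \<open>E\<close>, as a function of \<open>n z\<close>, satisfies
  \<open>E(x + n) = E(x)\<close> and \<open>E(x + n \<tau>) = e(- n \<tau> - n \<eta>) E(x)\<close>, and by Liouville this forces
  \<open>E = 0\<close> unless \<open>n \<eta>\<close> is in the lattice (\<open>coefficient_zero\<close>). The excluded values of \<open>\<eta>\<close> follow by
  analytic continuation, both sides being entire in \<open>\<eta>\<close>.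

  The function theory behind this is: the zeros of \<open>\<theta>\<close> are the lattice points and are simple (\<open>theta_zeros\<close>, by
  comparison with the Jacobi product); a jointly continuous, separately entire
  function vanishing on \<open>z\<^sub>j \<in> \<Gamma>\<close> is divisible by \<open>\<theta>(z\<^sub>j)\<close> (\<open>sep_entire_divide_theta\<close>); and the product of all
  \<open>\<theta>\<^sub>\<alpha>(z)\<close> is \<open>\<theta>(n z)\<close> up to an elementary factor (\<open>theta_Omega_eq\<close>).
\<close>

section \<open>The theta function\<close>

lemma e2pi_add: "e2pi (x + y) = e2pi x * e2pi y"
  by (simp add: e2pi_def distrib_left exp_add)

lemma e2pi_diff: "e2pi (x - y) = e2pi x / e2pi y"
  by (simp add: e2pi_def right_diff_distrib exp_diff)

lemma e2pi_minus: "e2pi (- x) = inverse (e2pi x)"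
  by (simp add: e2pi_def exp_minus)

lemma e2pi_nonzero [simp]: "e2pi x \<noteq> 0"
  by (simp add: e2pi_def)

lemma e2pi_0 [simp]: "e2pi 0 = 1"
  by (simp add: e2pi_def)

lemma e2pi_of_int [simp]: "e2pi (of_int m) = 1"
  by (simp add: e2pi_def exp_eq_1)

lemma e2pi_1 [simp]: "e2pi 1 = 1"
  using e2pi_of_int[of 1] by (simp del: e2pi_of_int)

lemma e2pi_half [simp]: "e2pi (1/2) = -1"
  by (simp add: e2pi_def)

lemma e2pi_eq_1_iff: "e2pi x = 1 \<longleftrightarrow> x \<in> \<int>"
proof
  assume "e2pi x = 1"
  then obtain m :: int where "Re (2 * of_real pi * \<i> * x) = 0" "Im (2 * of_real pi * \<i> * x) = of_int (2 * m) * pi"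
    by (auto simp: e2pi_def exp_eq_1)
  then have "Im x = 0" "Re x = of_int m" by auto
  then show "x \<in> \<int>"
    by (metis Ints_of_int complex_eq_iff Re_complex_of_real Im_complex_of_real of_real_of_int_eq)
next
  assume "x \<in> \<int>"
  then show "e2pi x = 1" by (auto elim: Ints_cases)
qed

lemma e2pi_eq_iff: "e2pi x = e2pi y \<longleftrightarrow> x - y \<in> \<int>"
  by (metis e2pi_diff e2pi_eq_1_iff e2pi_nonzero eq_iff_diff_eq_0 nonzero_divide_eq_eq mult_1)

lemma e2pi_power: "e2pi x ^ m = e2pi (of_nat m * x)"
  by (induction m) (simp_all add: e2pi_add distrib_right)

lemma norm_e2pi: "norm (e2pi z) = exp (- 2 * pi * Im z)"
  by (simp add: e2pi_def)

lemma e2pi_surj: assumes "X \<noteq> 0" shows "\<exists>z. e2pi z = X"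
proof
  show "e2pi (Ln X / (2 * of_real pi * \<i>)) = X"
    using assms by (simp add: e2pi_def)
qed

lemma e2pi_holomorphic [holomorphic_intros]:
  "f holomorphic_on A \<Longrightarrow> (\<lambda>z. e2pi (f z)) holomorphic_on A"
  unfolding e2pi_def by (intro holomorphic_intros)

lemma entire_isCont: "f holomorphic_on UNIV \<Longrightarrow> isCont f z"
  for f :: "complex \<Rightarrow> complex"
  using continuous_on_eq_continuous_at[OF open_UNIV] holomorphic_on_imp_continuous_on by blast

lemma theta_plus_1: "theta \<tau> (z + 1) = theta \<tau> z"
  unfolding theta_def by (simp add: e2pi_add distrib_left)

lemma theta_plus_tau: "theta \<tau> (z + \<tau>) = - e2pi (- z) * theta \<tau> z"
proof -
  define g where "g z a = (-1) powi a * e2pi (of_int a * z + of_int (a * (a - 1)) / 2 * \<tau>)" for z and a :: int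
  have *: "g (z + \<tau>) a = - e2pi (- z) * g z (a + 1)" for a
  proof -
    have e: "of_int a * (z + \<tau>) + of_int (a * (a - 1)) / 2 * \<tau>
      = - z + (of_int (a + 1) * z + of_int ((a + 1) * (a + 1 - 1)) / 2 * \<tau>)"
      by (simp add: field_simps)
    show ?thesis
      unfolding g_def e e2pi_add[of "- z"] by (simp add: power_int_add)
  qed
  have bij: "bij_betw (\<lambda>a::int. a + 1) UNIV UNIV"
    by (rule bij_betwI[of _ _ _ "\<lambda>a. a - 1"]) auto
  have "theta \<tau> (z + \<tau>) = (\<Sum>\<^sub>\<infinity>a. g (z + \<tau>) a)"
    by (simp add: theta_def g_def)
  also have "\<dots> = - e2pi (- z) * (\<Sum>\<^sub>\<infinity>a. g z (a + 1))"
    unfolding * by (rule infsum_cmult_right')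
  also have "(\<Sum>\<^sub>\<infinity>a. g z (a + 1)) = (\<Sum>\<^sub>\<infinity>a. g z a)"
    by (rule infsum_reindex_bij_betw[OF bij])
  finally show ?thesis
    by (simp add: theta_def g_def)
qed

lemma theta_uminus: "theta \<tau> (- z) = - e2pi (- z) * theta \<tau> z"
proof -
  define g where "g z a = (-1) powi a * e2pi (of_int a * z + of_int (a * (a - 1)) / 2 * \<tau>)" for z and a :: int
  have *: "g (- z) a = - e2pi (- z) * g z (1 - a)" for a
  proof -
    have e: "of_int a * (- z) + of_int (a * (a - 1)) / 2 * \<tau>
      = - z + (of_int (1 - a) * z + of_int ((1 - a) * (1 - a - 1)) / 2 * \<tau>)"
      by (simp add: field_simps)
    show ?thesis
      unfolding g_def e e2pi_add[of "- z"] by (simp add: power_int_diff power_int_minus_left)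
  qed
  have bij: "bij_betw (\<lambda>a::int. 1 - a) UNIV UNIV"
    by (rule bij_betwI[of _ _ _ "\<lambda>a. 1 - a"]) auto
  have "theta \<tau> (- z) = (\<Sum>\<^sub>\<infinity>a. g (- z) a)"
    by (simp add: theta_def g_def)
  also have "\<dots> = - e2pi (- z) * (\<Sum>\<^sub>\<infinity>a. g z (1 - a))"
    unfolding * by (rule infsum_cmult_right')
  also have "(\<Sum>\<^sub>\<infinity>a. g z (1 - a)) = (\<Sum>\<^sub>\<infinity>a. g z a)"
    by (rule infsum_reindex_bij_betw[OF bij])
  finally show ?thesis
    by (simp add: theta_def g_def)
qed

lemma theta_0 [simp]: "theta \<tau> 0 = 0"
  using theta_uminus[of \<tau> 0] by simp

text \<open>The ratio of consecutive terms is \<open>q\<^sup>a X\<close>, which tends to \<open>0\<close>.\<close>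

lemma summable_quadratic_exponent:
  fixes q :: complex
  assumes q: "norm q < 1"
  shows "summable (\<lambda>a. norm (c * q ^ (a * (a - 1) div 2) * (X::complex) ^ a))"
proof -
  have "(\<lambda>a. norm q ^ a * norm X) \<longlonglongrightarrow> 0 * norm X"
    by (intro tendsto_intros LIMSEQ_power_zero) (use q in auto)
  then have "eventually (\<lambda>a. norm q ^ a * norm X < 1/2) sequentially"
    by (intro order_tendstoD(2)) auto
  then obtain N where N: "\<And>a. a \<ge> N \<Longrightarrow> norm q ^ a * norm X < 1/2"
    by (auto simp: eventually_sequentially)
  show ?thesis
  proof (rule summable_ratio_test[of "1/2" N])
    fix a assume "a \<ge> N"
    have e: "Suc a * (Suc a - 1) div 2 = a * (a - 1) div 2 + a"
    proof -
      have "Suc a * (Suc a - 1) = a * (a - 1) + 2 * a"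
        by (cases a) (simp_all add: algebra_simps)
      then show ?thesis by simp
    qed
    have "norm (norm (c * q ^ (Suc a * (Suc a - 1) div 2) * X ^ Suc a))
      = (norm q ^ a * norm X) * norm (c * q ^ (a * (a - 1) div 2) * X ^ a)"
      unfolding e by (simp add: norm_mult norm_power power_add mult_ac)
    also have "\<dots> \<le> 1/2 * norm (c * q ^ (a * (a - 1) div 2) * X ^ a)"
      using N[OF \<open>a \<ge> N\<close>] by (intro mult_right_mono) auto
    finally show "norm (norm (c * q ^ (Suc a * (Suc a - 1) div 2) * X ^ Suc a))
       \<le> 1/2 * norm (norm (c * q ^ (a * (a - 1) div 2) * X ^ a))" by simp
  qed simp
qed

definition theta_series :: "complex \<Rightarrow> complex \<Rightarrow> complex" where
  "theta_series q X = suminf (\<lambda>a. (-1) ^ a * q ^ (a * (a - 1) div 2) * X ^ a)"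

lemma summable_theta_series:
  fixes q X :: complex
  assumes "norm q < 1"
  shows "summable (\<lambda>a. norm ((-1) ^ a * q ^ (a * (a - 1) div 2) * X ^ a))"
  using summable_quadratic_exponent[OF assms, of 1 X] by (simp add: norm_mult norm_power)

lemma theta_series_holomorphic:
  assumes "norm q < 1"
  shows "theta_series q holomorphic_on UNIV"
proof -
  have "theta_series q holomorphic_on ball 0 r" for r
  proof (rule power_series_holomorphic[where a = "\<lambda>a. (-1) ^ a * q ^ (a * (a - 1) div 2)"])
    fix w
    show "(\<lambda>n. (- 1) ^ n * q ^ (n * (n - 1) div 2) * (w - 0) ^ n) sums theta_series q w"
      unfolding theta_series_def using summable_theta_series[OF assms, of w]
      by (simp add: summable_norm_cancel summable_sums)
  qed
  then have "theta_series q holomorphic_on (\<Union>r. ball 0 r)"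
    by (intro holomorphic_on_UN_open) auto
  moreover have "(\<Union>r. ball (0::complex) r) = UNIV"
  proof -
    have "x \<in> (\<Union>r. ball (0::complex) r)" for x
      by (intro UN_I[of "norm x + 1"]) auto
    then show ?thesis by blast
  qed
  ultimately show ?thesis by simp
qed

text \<open>Splitting the sum at zero gives one power series in \<open>X = e2pi z\<close> and one in \<open>q / X\<close>; both contain the
  term for \<open>a = 0\<close>. This is how convergence and holomorphy of theta are obtained.\<close>

lemma theta_eq_series:
  assumes "Im \<tau> > 0"
  shows "theta \<tau> z = theta_series (e2pi \<tau>) (e2pi z) + theta_series (e2pi \<tau>) (e2pi (\<tau> - z)) - 1"
proof -
  define q where "q = e2pi \<tau>"
  have q: "norm q < 1" using assms by (simp add: q_def norm_e2pi)
  define g where "g a = (-1) powi a * e2pi (of_int a * z + of_int (a * (a - 1)) / 2 * \<tau>)" for a :: int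
  have half: "(of_nat (a * (a - 1) div 2) :: complex) = of_nat a * (of_nat a - 1) / 2" for a
  proof -
    have "2 * (a * (a - 1) div 2) = a * (a - 1)"
      by (rule dvd_mult_div_cancel) (cases a, auto)
    then have "(2::complex) * of_nat (a * (a - 1) div 2) = of_nat (a * (a - 1))"
      by (metis of_nat_mult of_nat_numeral)
    then show ?thesis by (cases a) (simp_all add: field_simps)
  qed
  have g1: "g (int a) = (-1) ^ a * q ^ (a * (a - 1) div 2) * e2pi z ^ a" for a
    unfolding g_def q_def e2pi_power half by (simp add: e2pi_add mult_ac)
  have g2: "g (- int a) = (-1) ^ a * q ^ (a * (a - 1) div 2) * e2pi (\<tau> - z) ^ a" for a
    unfolding g_def q_def e2pi_power half
    by (simp add: power_int_minus power_int_of_nat mult.assoc flip: e2pi_add)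
       (simp add: field_simps flip: power_inverse)
  have s1: "(\<lambda>a. g (int a)) summable_on UNIV" "(\<lambda>a. g (- int a)) summable_on UNIV"
    unfolding g1 g2 using summable_theta_series[OF q] by (auto intro!: norm_summable_imp_summable_on)
  have i1: "(\<Sum>\<^sub>\<infinity>a. g (int a)) = theta_series q (e2pi z)"
       "(\<Sum>\<^sub>\<infinity>a. g (- int a)) = theta_series q (e2pi (\<tau> - z))"
    unfolding theta_series_def g1 g2
    by (intro infsumI norm_summable_imp_has_sum summable_theta_series[OF q] summable_sums
        summable_norm_cancel[OF summable_theta_series[OF q]])+

  have r1: "g summable_on range int" "infsum g (range int) = theta_series q (e2pi z)"
    using s1(1) i1(1) summable_on_reindex[of int UNIV g] infsum_reindex[of int UNIV g]
    by (simp_all add: o_def)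
  have r2: "g summable_on range (\<lambda>a. - int a)"
      "infsum g (range (\<lambda>a. - int a)) = theta_series q (e2pi (\<tau> - z))"
    using s1(2) i1(2) summable_on_reindex[of "\<lambda>a. - int a" UNIV g] infsum_reindex[of "\<lambda>a. - int a" UNIV g]
    by (simp_all add: o_def inj_on_def)
  have U: "range int \<union> range (\<lambda>a. - int a) = UNIV"
  proof -
    have "x \<in> range int \<union> range (\<lambda>a. - int a)" for x
      by (cases x rule: int_cases2) auto
    then show ?thesis by blast
  qed
  have I: "range int \<inter> range (\<lambda>a. - int a) = {0}"
    by (force simp: image_iff)
  have "infsum g UNIV = infsum g (range int) + infsum g (range (\<lambda>a. - int a)) - infsum g {0}"
    using infsum_Un_Int[of g "range int" "range (\<lambda>a. - int a)"] r1(1) r2(1)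
      summable_on_subset_banach[OF r1(1)] summable_on_subset_banach[OF r2(1)]
    by (simp add: U I Diff_subset)
  then show ?thesis
    unfolding theta_def g_def[symmetric] using r1(2) r2(2) by (simp add: g_def[of 0] q_def)
qed

lemma theta_holomorphic:
  assumes "Im \<tau> > 0" shows "theta \<tau> holomorphic_on UNIV"
proof -
  have "norm (e2pi \<tau>) < 1" using assms by (simp add: norm_e2pi)
  note hol = theta_series_holomorphic[OF this]
  have c: "(\<lambda>z. theta_series (e2pi \<tau>) (e2pi (f z))) holomorphic_on UNIV"
    if "f holomorphic_on UNIV" for f
    using holomorphic_on_compose_gen[OF e2pi_holomorphic[OF that] hol] by (simp add: o_def)
  have "theta \<tau> = (\<lambda>z. theta_series (e2pi \<tau>) (e2pi z) + theta_series (e2pi \<tau>) (e2pi (\<tau> - z)) - 1)"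
    using theta_eq_series[OF assms] by blast
  then show ?thesis
    by (auto intro!: holomorphic_intros c)
qed

lemma theta_holomorphic' [holomorphic_intros]:
  assumes "Im \<tau> > 0" "f holomorphic_on A" shows "(\<lambda>z. theta \<tau> (f z)) holomorphic_on A"
  using holomorphic_on_compose_gen[OF assms(2) theta_holomorphic[OF assms(1)]] by (simp add: o_def)

text \<open>Otherwise \<open>A(X) + A(q/X) = 1\<close> for an entire \<open>A\<close> with \<open>A(0) = 1\<close>: then \<open>A\<close> tends to
  \<open>0\<close> at infinity, against Liouville.\<close>

lemma theta_not_identically_zero:
  assumes "Im \<tau> > 0" shows "\<exists>z. theta \<tau> z \<noteq> 0"
proof (rule ccontr)
  assume *: "\<nexists>z. theta \<tau> z \<noteq> 0"
  define q where "q = e2pi \<tau>"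
  define A where "A = theta_series q"
  have q: "norm q < 1" using assms by (simp add: norm_e2pi q_def)
  have hol: "A holomorphic_on UNIV"
    unfolding A_def by (rule theta_series_holomorphic[OF q])
  have A0: "A 0 = 1"
    unfolding A_def theta_series_def
    by (subst suminf_finite[of "{0}"]) auto
  have eq: "A X + A (q / X) = 1" if "X \<noteq> 0" for X
  proof -
    obtain z where "e2pi z = X" using e2pi_surj \<open>X \<noteq> 0\<close> by blast
    then show ?thesis
      using theta_eq_series[OF assms, of z] *
      by (simp add: A_def q_def e2pi_diff algebra_simps)
  qed
  have "isCont A 0"
    by (rule entire_isCont[OF hol])
  moreover have "((\<lambda>X. q / X) \<longlongrightarrow> 0) at_infinity"
    by (rule tendsto_divide_0[OF tendsto_const filterlim_ident])
  ultimately have "((\<lambda>X. A (q / X)) \<longlongrightarrow> A 0) at_infinity"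
    by (rule isCont_tendsto_compose)
  then have "((\<lambda>X. 1 - A (q / X)) \<longlongrightarrow> 1 - A 0) at_infinity"
    by (intro tendsto_intros)
  moreover have "eventually (\<lambda>X. 1 - A (q / X) = A X) at_infinity"
    unfolding eventually_at_infinity
  proof (intro exI allI impI)
    fix X :: complex assume "1 \<le> norm X"
    then have "X \<noteq> 0" by auto
    from eq[OF this] show "1 - A (q / X) = A X" by (simp add: algebra_simps)
  qed
  ultimately have "(A \<longlongrightarrow> 0) at_infinity"
    using A0 by (simp add: tendsto_cong)
  from Liouville_weak_0[OF hol this] A0 show False by simp
qed

section \<open>Zeros of the theta function\<close>

lemma period_lattice_0 [simp]: "0 \<in> period_lattice \<tau>"
  unfolding period_lattice_def by (auto intro!: exI[of _ 0])

lemma period_lattice_eqI: "z = of_int a + of_int b * \<tau> \<Longrightarrow> z \<in> period_lattice \<tau>"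
  unfolding period_lattice_def by blast

text \<open>The function is the product \<open>(1 - X) (1 - q X) (1 - q\<^sup>2 X) \<dots>\<close>, one half of the Jacobi product for theta. Its
  functional equation and the value \<open>f 0 = 1\<close> determine its zeros: at any other point the equation
  propagates a zero along \<open>q\<^sup>m X\<close> to \<open>0\<close>.\<close>

lemma q_product_exists:
  fixes q :: complex
  assumes q: "norm q < 1"
  obtains f where "f holomorphic_on UNIV" "\<And>X. f X = (1 - X) * f (q * X)"
    "\<And>X. f X = 0 \<Longrightarrow> \<exists>m. q ^ m * X = 1"
proof -
  define P where "P N X = (\<Prod>m<N. 1 - q ^ m * X)" for N :: nat and X
  define f where "f X = lim (\<lambda>N. P N X)" for X
  have uc: "uniformly_convergent_on (cball 0 r) P" for r
    unfolding P_def
  proof (rule uniformly_convergent_on_prod')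
    show "uniformly_convergent_on (cball 0 r) (\<lambda>N x. \<Sum>n<N. norm (1 - q ^ n * x - 1))"
    proof (rule Weierstrass_m_test'[where M = "\<lambda>n. norm q ^ n * \<bar>r\<bar>"])
      show "norm (norm (1 - q ^ n * x - 1)) \<le> norm q ^ n * \<bar>r\<bar>" if "x \<in> cball 0 r" for n x
        using that by (auto simp: norm_mult norm_power intro!: mult_left_mono)
      show "summable (\<lambda>n. norm q ^ n * \<bar>r\<bar>)"
        using q by (intro summable_mult2 summable_geometric) auto
    qed
  qed (auto intro!: continuous_intros)
  have ul: "uniform_limit (cball 0 r) P f sequentially" for r
    using uc[of r] unfolding uniformly_convergent_uniform_limit_iff f_def .
  have lim: "(\<lambda>N. P N X) \<longlonglongrightarrow> f X" for X
    using tendsto_uniform_limitI[OF ul[of "norm X"], of X] by simp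
  have hol: "f holomorphic_on UNIV"
  proof (rule holomorphic_uniform_sequence)
    show "P n holomorphic_on UNIV" for n
      unfolding P_def by (intro holomorphic_intros)
    show "\<exists>d>0. cball x d \<subseteq> UNIV \<and> uniform_limit (cball x d) P f sequentially" for x
    proof (intro exI[of _ 1] conjI)
      have "cball x 1 \<subseteq> cball 0 (norm x + 1)"
        by (simp add: cball_subset_cball_iff)
      then show "uniform_limit (cball x 1) P f sequentially"
        by (rule uniform_limit_on_subset[OF ul])
    qed auto
  qed auto
  have fe: "f X = (1 - X) * f (q * X)" for X
  proof -
    have "P (Suc N) X = (1 - X) * P N (q * X)" for N
      unfolding P_def by (subst prod.lessThan_Suc_shift) (simp add: mult_ac)
    then have "(\<lambda>N. P (Suc N) X) \<longlonglongrightarrow> (1 - X) * f (q * X)"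
      by (simp add: tendsto_mult_left lim)
    with LIMSEQ_Suc[OF lim[of X]] show ?thesis
      using LIMSEQ_unique by blast
  qed
  have f0: "f 0 = 1"
    using LIMSEQ_unique[OF lim[of 0]] by (simp add: P_def)
  have z: "\<exists>m. q ^ m * X = 1" if "f X = 0" for X
  proof (rule ccontr)
    assume no: "\<nexists>m. q ^ m * X = 1"
    have "f (q ^ m * X) = 0" for m
    proof (induction m)
      case (Suc m)
      with fe[of "q ^ m * X"] no show ?case by (simp add: mult_ac)
    qed (use that in simp)
    moreover have "(\<lambda>m. q ^ m * X) \<longlonglongrightarrow> 0"
      using tendsto_mult_right[OF LIMSEQ_power_zero[OF q], of X] by (simp add: mult.commute)
    then have "(\<lambda>m. f (q ^ m * X)) \<longlonglongrightarrow> f 0"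
      by (rule isCont_tendsto_compose[OF entire_isCont[OF hol]])
    ultimately show False
      using f0 by (simp add: LIMSEQ_const_iff)
  qed
  show thesis
    by (rule that[OF hol]) (use fe z in blast)+
qed

lemma lattice_shift_invariant:
  assumes "\<And>z. F (z + 1) = F z" "\<And>z. F (z + \<tau>) = F z"
  shows "F (z + (of_int a + of_int b * \<tau>)) = F (z :: complex)"
proof -
  have nat1: "F (z + of_nat m) = F z" for z m
    by (induction m) (use assms(1) in \<open>simp_all add: add.assoc[symmetric] add.commute[of 1]\<close>)
  have nat2: "F (z + of_nat m * \<tau>) = F z" for z m
  proof (induction m)
    case (Suc m)
    have "F (z + of_nat (Suc m) * \<tau>) = F ((z + of_nat m * \<tau>) + \<tau>)"
      by (simp add: algebra_simps)
    with Suc assms(2) show ?case by simp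
  qed simp
  have int1: "F (z + of_int m) = F z" for z m
  proof (cases m rule: int_cases2)
    case (nonpos k)
    then show ?thesis using nat1[of "z + of_int m" k] by simp
  qed (use nat1 in simp)
  have int2: "F (z + of_int m * \<tau>) = F z" for z m
  proof (cases m rule: int_cases2)
    case (nonpos k)
    then show ?thesis using nat2[of "z + of_int m * \<tau>" k] by simp
  qed (use nat2 in simp)
  show ?thesis
    using int1[of z a] int2[of "z + of_int a" b] by (simp add: add.assoc)
qed

text \<open>A property invariant under the two generating translations in both directions holds on the whole
  lattice once it holds at \<open>0\<close>; zeros of quasi-periodic functions are propagated with this rule.\<close>

lemma lattice_induct [consumes 1, case_names zero one tau]:
  assumes "z \<in> period_lattice \<tau>" "Q 0" "\<And>z. Q (z + 1) \<longleftrightarrow> Q z" "\<And>z. Q (z + \<tau>) \<longleftrightarrow> Q z"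
  shows "Q (z :: complex)"
proof -
  obtain a b :: int where "z = of_int a + of_int b * \<tau>"
    using assms(1) by (auto simp: period_lattice_def)
  then show ?thesis
    using lattice_shift_invariant[of Q \<tau> 0 a b] assms(2-4) by auto
qed

lemma theta_lattice: "z \<in> period_lattice \<tau> \<Longrightarrow> theta \<tau> z = 0"
  by (induction rule: lattice_induct) (simp_all add: theta_plus_1 theta_plus_tau)

text \<open>Liouville: multiplying by \<open>e2pi (- l z)\<close> with a suitable real \<open>l\<close> makes the absolute
  value doubly periodic, hence bounded.\<close>

lemma entire_quasi_periodic:
  assumes \<tau>: "Im \<tau> > 0" and E: "E holomorphic_on UNIV"
    and 1: "\<And>z. E (z + 1) = E z" and 2: "\<And>z. E (z + \<tau>) = \<kappa> * E z"
  obtains c and m :: int where "\<And>z. E z = c * e2pi (of_int m * z)" "c = 0 \<or> \<kappa> = e2pi (of_int m * \<tau>)"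
proof (cases "\<exists>z. E z \<noteq> 0")
  case False
  then show ?thesis using that[of 0 0] by auto
next
  case True
  then have \<kappa>: "\<kappa> \<noteq> 0"
    using 2[of "z - \<tau>" for z] by fastforce
  define l where "l = - ln (norm \<kappa>) / (2 * pi * Im \<tau>)"
  define G where "G z = E z * e2pi (- of_real l * z)" for z
  have G1: "norm (G (z + 1)) = norm (G z)" for z
    by (simp add: G_def 1 norm_mult norm_e2pi)
  have "norm (e2pi (- of_real l * \<tau>)) = inverse (norm \<kappa>)"
  proof -
    have "- 2 * pi * Im (- of_real l * \<tau>) = - ln (norm \<kappa>)"
      using \<tau> by (simp add: l_def field_simps)
    then show ?thesis
      unfolding norm_e2pi using \<kappa> by (simp add: exp_minus)
  qed
  then have G2: "norm (G (z + \<tau>)) = norm (G z)" for z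
    using \<kappa> by (simp add: G_def 2 distrib_left e2pi_diff norm_mult norm_divide e2pi_minus norm_inverse)
  have hol: "G holomorphic_on UNIV"
    unfolding G_def by (intro holomorphic_intros E)
  define K where "K = cbox 0 (Complex 1 (Im \<tau>))"
  have "compact (G ` K)"
    unfolding K_def by (intro compact_continuous_image compact_cbox)
      (use hol holomorphic_on_imp_continuous_on holomorphic_on_subset in blast)
  then obtain B where B: "\<And>z. z \<in> K \<Longrightarrow> norm (G z) \<le> B"
    using compact_imp_bounded[of "G ` K"] by (auto simp: bounded_iff)
  have "norm (G z) \<le> B" for z
  proof -
    define b where "b = \<lfloor>Im z / Im \<tau>\<rfloor>"
    define a where "a = \<lfloor>Re (z - of_int b * \<tau>)\<rfloor>"
    define z' where "z' = z - of_int a - of_int b * \<tau>"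
    have b: "of_int b * Im \<tau> \<le> Im z" "Im z \<le> (of_int b + 1) * Im \<tau>"
      using \<tau> floor_correct[of "Im z / Im \<tau>"] unfolding b_def[symmetric]
      by (simp_all add: field_simps)
    have a: "of_int a \<le> Re (z - of_int b * \<tau>)" "Re (z - of_int b * \<tau>) \<le> of_int a + 1"
      unfolding a_def by linarith+
    have "z' \<in> K"
      using a b by (auto simp: z'_def K_def in_cbox_complex_iff algebra_simps)
    moreover have "norm (G z) = norm (G z')"
      using lattice_shift_invariant[of "\<lambda>z. norm (G z)" \<tau> z' a b, OF G1 G2]
      by (simp add: z'_def)
    ultimately show ?thesis using B by simp
  qed
  then have "bounded (range G)" by (auto simp: bounded_iff)
  with hol obtain c where c: "\<And>z. G z = c"
    using Liouville_theorem[of G] by (auto simp: constant_on_def)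
  have Ec: "E z = c * e2pi (of_real l * z)" for z
    using c[of z] by (simp add: G_def e2pi_minus field_simps)
  with True have c0: "c \<noteq> 0" by auto
  have "e2pi (of_real l) = 1"
    using 1[of 0] c0 by (simp add: Ec)
  then obtain m :: int where m: "of_real l = (of_int m :: complex)"
    by (auto simp: e2pi_eq_1_iff elim: Ints_cases)
  have "\<kappa> = e2pi (of_int m * \<tau>)"
    using 2[of 0] c0 by (simp add: Ec m)
  with Ec m show ?thesis using that by auto
qed

text \<open>The singularities of the quotient at the simple zeros of \<open>D\<close> are removable by the rule of de l'Hospital.\<close>

lemma entire_divide:
  fixes d D :: "complex \<Rightarrow> complex"
  assumes d: "d holomorphic_on UNIV" and D: "D holomorphic_on UNIV"
    and z: "\<And>z. D z = 0 \<Longrightarrow> d z = 0" "\<And>z. D z = 0 \<Longrightarrow> deriv D z \<noteq> 0"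
  obtains E where "E holomorphic_on UNIV" "\<And>z. d z = D z * E z"
proof -
  define E where "E z = (if D z = 0 then deriv d z / deriv D z else d z / D z)" for z
  have "E field_differentiable at a" for a
  proof (cases "D a = 0")
    case False
    have o: "open {z. D z \<noteq> 0}"
      using D by (intro open_Collect_neq holomorphic_on_imp_continuous_on) auto
    have "(\<lambda>z. d z / D z) holomorphic_on {z. D z \<noteq> 0}"
      by (intro holomorphic_intros holomorphic_on_subset[OF d] holomorphic_on_subset[OF D]) auto
    then have "E holomorphic_on {z. D z \<noteq> 0}"
      by (rule holomorphic_transform) (simp add: E_def)
    then show ?thesis
      using o False holomorphic_on_imp_differentiable_at by blast
  next
    case True
    have "\<exists>b. D b \<noteq> 0"
    proof (rule ccontr)
      assume "\<nexists>b. D b \<noteq> 0"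
      then have "D = (\<lambda>_. 0)" by auto
      with z(2)[OF True] show False by simp
    qed
    then obtain b where "D b \<noteq> 0" by blast
    with isolated_zeros[OF D open_UNIV connected_UNIV, of a b] True
    obtain r where r: "r > 0" "\<And>z. z \<in> ball a r - {a} \<Longrightarrow> D z \<noteq> 0"
      by auto
    have "(\<lambda>z. d z / D z) holomorphic_on ball a r - {a}"
      by (intro holomorphic_intros holomorphic_on_subset[OF d] holomorphic_on_subset[OF D]) (use r in auto)
    then have h: "E holomorphic_on ball a r - {a}"
      by (rule holomorphic_transform) (use r in \<open>simp add: E_def\<close>)
    have dd: "(d has_field_derivative deriv d a) (at a)" "(D has_field_derivative deriv D a) (at a)"
      using d D by (auto intro: holomorphic_derivI)
    have "((\<lambda>z. d z / D z) \<longlongrightarrow> deriv d a / deriv D a) (at a)"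
      by (rule lhopital_complex_simple[OF dd]) (use True z in auto)
    moreover have ev: "\<forall>\<^sub>F x in at a. d x / D x = E x"
      using r by (auto simp: eventually_at dist_commute E_def intro!: exI[of _ r])
    moreover have "deriv d a / deriv D a = E a"
      by (simp add: E_def True)
    ultimately have lim: "(E \<longlongrightarrow> E a) (at a)"
      using Lim_transform_eventually[OF _ ev, of "E a"] by simp
    have "E holomorphic_on ball a r"
      by (rule no_isolated_singularity'[OF _ h]) (use tendsto_within_subset[OF lim] in auto)
    then show ?thesis
      using r(1) holomorphic_on_imp_differentiable_at by (metis centre_in_ball open_ball)
  qed
  then have "E holomorphic_on UNIV"
    by (simp add: holomorphic_on_def field_differentiable_at_within)
  moreover have "d z = D z * E z" for z
    using z(1) by (simp add: E_def)
  ultimately show ?thesis using that by blast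
qed

lemma entire_mult_cancel:
  fixes D g :: "complex \<Rightarrow> complex"
  assumes "D holomorphic_on UNIV" "g holomorphic_on UNIV" "D a \<noteq> 0" "\<And>z. D z * g z = 0"
  shows "g z = 0"
proof -
  have "isCont D a" by (rule entire_isCont[OF assms(1)])
  then obtain e where e: "e > 0" "\<And>y. y \<in> ball a e \<Longrightarrow> D y \<noteq> 0"
    using continuous_at_avoid[of a D 0] assms(3) by (auto simp: dist_commute)
  have "g holomorphic_on UNIV" "a \<in> UNIV" by (use assms in auto)
  show ?thesis
  proof (rule analytic_continuation_open[of "ball a e" UNIV g "\<lambda>_. 0"])
    show "g w = 0" if "w \<in> ball a e" for w
      using e(2)[OF that] assms(4)[of w] by simp
  qed (use e assms in auto)
qed

text \<open>The Jacobi product \<open>P\<close> has the same quasi-periods as theta and simple zeros exactly on the lattice, while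
  theta vanishes there by quasi-periodicity. So theta is \<open>P\<close> times an entire function with period lattice
  \<open>\<Gamma>\<close>, which is an exponential by \<open>entire_quasi_periodic\<close> and nonzero because theta is.\<close>

theorem theta_zeros:
  assumes \<tau>: "Im \<tau> > 0"
  shows theta_eq_0_iff: "theta \<tau> z = 0 \<longleftrightarrow> z \<in> period_lattice \<tau>"
    and deriv_theta_nonzero: "z \<in> period_lattice \<tau> \<Longrightarrow> deriv (theta \<tau>) z \<noteq> 0"
proof -
  define q where "q = e2pi \<tau>"
  have q: "norm q < 1" "q \<noteq> 0" using \<tau> by (simp_all add: norm_e2pi q_def)
  obtain f where f: "f holomorphic_on UNIV" "\<And>X. f X = (1 - X) * f (q * X)"
      "\<And>X. f X = 0 \<Longrightarrow> \<exists>m. q ^ m * X = 1"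
    using q_product_exists[OF q(1)] by blast
  have f_hol [holomorphic_intros]: "(\<lambda>z. f (g z)) holomorphic_on UNIV" if "g holomorphic_on UNIV" for g
    using holomorphic_on_compose_gen[OF that f(1)] by (simp add: o_def)
  define P where "P z = f (e2pi z) * f (q / e2pi z)" for z
  have P_hol: "P holomorphic_on UNIV"
    unfolding P_def by (intro holomorphic_intros) auto
  have P1: "P (z + 1) = P z" for z
    by (simp add: P_def e2pi_add)
  have P2: "P (z + \<tau>) = - e2pi (- z) * P z" for z
  proof -
    have "P (z + \<tau>) = f (q * e2pi z) * f (1 / e2pi z)"
      using q by (simp add: P_def e2pi_add q_def mult.commute)
    also have "f (1 / e2pi z) = (1 - 1 / e2pi z) * f (q / e2pi z)"
      using f(2)[of "1 / e2pi z"] by simp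
    also have "1 - 1 / e2pi z = - e2pi (- z) * (1 - e2pi z)"
      by (simp add: e2pi_minus field_simps)
    finally show ?thesis
      using f(2)[of "e2pi z"] by (simp add: P_def)
  qed
  have P_zero: "z \<in> period_lattice \<tau>" if Pz: "P z = 0" for z
  proof -
    consider "f (e2pi z) = 0" | "f (q / e2pi z) = 0"
      using Pz by (auto simp: P_def)
    then show ?thesis
    proof cases
      case 1
      then obtain m where "q ^ m * e2pi z = 1" using f(3) by blast
      then have "e2pi (of_nat m * \<tau> + z) = 1"
        by (simp add: q_def e2pi_power e2pi_add)
      then obtain a :: int where "of_nat m * \<tau> + z = of_int a"
        by (auto simp: e2pi_eq_1_iff elim: Ints_cases)
      then show ?thesis
        by (intro period_lattice_eqI[of _ a "- int m"]) (simp add: algebra_simps)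
    next
      case 2
      then obtain m where "q ^ m * (q / e2pi z) = 1" using f(3) by blast
      then have "e2pi (of_nat m * \<tau> + \<tau> - z) = 1"
        by (simp add: q_def e2pi_power e2pi_add e2pi_diff)
      then obtain a :: int where "of_nat m * \<tau> + \<tau> - z = of_int a"
        by (auto simp: e2pi_eq_1_iff elim: Ints_cases)
      then show ?thesis
        by (intro period_lattice_eqI[of _ "- a" "int m + 1"]) (simp add: algebra_simps)
    qed
  qed
  have fq: "f q \<noteq> 0"
  proof
    assume "f q = 0"
    then obtain m where "q ^ m * q = 1" using f(3) by blast
    then have "q ^ Suc m = 1" by (simp add: mult.commute)
    then have "norm q ^ Suc m = 1" by (metis norm_one norm_power)
    moreover have "norm q ^ Suc m < 1"
      using q by (intro power_Suc_less_one) auto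
    ultimately show False by simp
  qed
  have P_deriv: "(P has_field_derivative deriv P z) (at z)" for z
    using P_hol by (auto intro: holomorphic_derivI)
  \<comment> \<open>At \<open>0\<close> the factor \<open>1 - e2pi z\<close> carries the zero; quasi-periodicity transports it to the lattice.\<close>
  have dP: "P z = 0 \<and> deriv P z \<noteq> 0" if "z \<in> period_lattice \<tau>" for z
    using that
  proof (induction rule: lattice_induct)
    case zero
    have "P = (\<lambda>z. (1 - e2pi z) * (f (q * e2pi z) * f (q / e2pi z)))"
    proof
      fix z
      show "P z = (1 - e2pi z) * (f (q * e2pi z) * f (q / e2pi z))"
        using f(2)[of "e2pi z"] by (simp add: P_def mult.assoc)
    qed
    moreover define g where "g z = f (q * e2pi z) * f (q / e2pi z)" for z
    ultimately have Pg: "P = (\<lambda>z. (1 - e2pi z) * g z)" by simp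
    have "g holomorphic_on UNIV"
      unfolding g_def by (intro holomorphic_intros) auto
    then have "(g has_field_derivative deriv g 0) (at 0)"
      by (auto intro: holomorphic_derivI)
    then have "((\<lambda>z. (1 - e2pi z) * g z) has_field_derivative - (2 * of_real pi * \<i>) * g 0) (at 0)"
      unfolding e2pi_def by (auto intro!: derivative_eq_intros)
    then have "deriv P 0 = - (2 * of_real pi * \<i>) * g 0"
      unfolding Pg by (rule DERIV_imp_deriv)
    moreover have "g 0 \<noteq> 0" using fq by (simp add: g_def)
    ultimately show ?case by (simp add: Pg)
  next
    case (one z)
    have "((\<lambda>z. P (z + 1)) has_field_derivative deriv P (z + 1)) (at z)"
      using DERIV_shift[of P "deriv P (z + 1)" z 1] P_deriv by simp
    then have "deriv P (z + 1) = deriv P z"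
      unfolding P1 using DERIV_unique[OF _ P_deriv] by auto
    then show ?case by (simp add: P1)
  next
    case (tau z)
    have "((\<lambda>z. P (z + \<tau>)) has_field_derivative deriv P (z + \<tau>)) (at z)"
      using DERIV_shift[of P "deriv P (z + \<tau>)" z \<tau>] P_deriv by simp
    moreover have "((\<lambda>z. - e2pi (- z) * P z) has_field_derivative - e2pi (- z) * deriv P z) (at z)"
      if "P z = 0"
      unfolding e2pi_def using P_deriv[of z] that by (auto intro!: derivative_eq_intros)
    ultimately have "P z = 0 \<Longrightarrow> deriv P (z + \<tau>) = - e2pi (- z) * deriv P z"
      unfolding P2 by (rule DERIV_unique)
    then show ?case by (auto simp: P2)
  qed
  obtain E where E: "E holomorphic_on UNIV" "\<And>z. theta \<tau> z = P z * E z"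
    using entire_divide[OF theta_holomorphic[OF \<tau>] P_hol] dP P_zero theta_lattice by blast
  have gen: "\<exists>z0. P z0 \<noteq> 0"
    using theta_not_identically_zero[OF \<tau>] E(2) by auto
  have zero_cancel: "g = (\<lambda>_. 0)" if "g holomorphic_on UNIV" "\<And>z. P z * g z = 0" for g
    using entire_mult_cancel[OF P_hol that(1) _ that(2)] gen by blast
  have E1: "E (z + 1) = E z" for z
  proof -
    have "(\<lambda>z. E (z + 1) - E z) = (\<lambda>_. 0)"
    proof (rule zero_cancel)
      show "(\<lambda>z. E (z + 1) - E z) holomorphic_on UNIV"
        by (intro holomorphic_intros E holomorphic_on_compose_gen[OF _ E(1), unfolded o_def]) auto
      have "P z * E (z + 1) = P z * E z" for z
        using E(2)[of z] E(2)[of "z + 1"] unfolding P1 theta_plus_1 by metis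
      then show "P z * (E (z + 1) - E z) = 0" for z
        by (simp add: right_diff_distrib)
    qed
    then show ?thesis by (simp add: fun_eq_iff)
  qed
  have E2: "E (z + \<tau>) = 1 * E z" for z
  proof -
    have "(\<lambda>z. E (z + \<tau>) - E z) = (\<lambda>_. 0)"
    proof (rule zero_cancel)
      show "(\<lambda>z. E (z + \<tau>) - E z) holomorphic_on UNIV"
        by (intro holomorphic_intros E holomorphic_on_compose_gen[OF _ E(1), unfolded o_def]) auto
      have "- e2pi (- z) * (P z * E (z + \<tau>)) = - e2pi (- z) * (P z * E z)" for z
        using E(2)[of z] E(2)[of "z + \<tau>"] unfolding P2 theta_plus_tau by (metis mult.assoc)
      then show "P z * (E (z + \<tau>) - E z) = 0" for z
        by (simp add: right_diff_distrib)
    qed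
    then show ?thesis by (simp add: fun_eq_iff)
  qed
  obtain c and m :: int where c: "\<And>z. E z = c * e2pi (of_int m * z)"
    using entire_quasi_periodic[OF \<tau> E(1) E1 E2] by metis
  have c0: "c \<noteq> 0"
    using theta_not_identically_zero[OF \<tau>] by (auto simp: E(2) c)
  have En: "E z \<noteq> 0" for z using c c0 by simp
  show "theta \<tau> z = 0 \<longleftrightarrow> z \<in> period_lattice \<tau>"
    using En P_zero dP by (auto simp: E(2))
  show "deriv (theta \<tau>) z \<noteq> 0" if "z \<in> period_lattice \<tau>"
  proof -
    have "(E has_field_derivative deriv E z) (at z)"
      using E(1) by (auto intro: holomorphic_derivI)
    then have "((\<lambda>z. P z * E z) has_field_derivative deriv P z * E z) (at z)"
      using DERIV_mult[OF P_deriv[of z], of E "deriv E z"] dP[OF that] by simp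
    moreover have "theta \<tau> = (\<lambda>z. P z * E z)" using E(2) by auto
    ultimately have "deriv (theta \<tau>) z = deriv P z * E z"
      by (auto intro: DERIV_imp_deriv)
    then show ?thesis using dP[OF that] En by simp
  qed
qed

lemma entire_divide_theta:
  assumes "Im \<tau> > 0" "d holomorphic_on UNIV" "\<And>z. z \<in> period_lattice \<tau> \<Longrightarrow> d z = 0"
  obtains E where "E holomorphic_on UNIV" "\<And>z. d z = theta \<tau> z * E z"
  using entire_divide[OF assms(2) theta_holomorphic[OF assms(1)]] assms(1,3) theta_zeros[OF assms(1)] by blast

lemma theta_mult_cancel:
  assumes "Im \<tau> > 0" "E holomorphic_on UNIV" "F holomorphic_on UNIV"
    and "\<And>z. theta \<tau> z * E z = theta \<tau> z * F z"
  shows "E z = F z"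
proof -
  obtain a where a: "theta \<tau> a \<noteq> 0" using theta_not_identically_zero[OF assms(1)] by blast
  have "E z - F z = 0"
    by (rule entire_mult_cancel[OF theta_holomorphic[OF assms(1)] _ a])
      (auto intro!: holomorphic_on_diff assms(2,3) simp: right_diff_distrib assms(4))
  then show ?thesis by simp
qed

section \<open>Entire functions of several variables\<close>

lemma punctured_nonzero:
  fixes D :: "complex \<Rightarrow> complex"
  assumes D: "D holomorphic_on UNIV" "D a \<noteq> 0"
  obtains r where "r > 0" "\<And>z. z \<in> cball s r - {s} \<Longrightarrow> D z \<noteq> 0"
proof -
  obtain r where r: "r > 0" "\<And>z. z \<in> ball s r - {s} \<Longrightarrow> D z \<noteq> 0"
  proof (cases "D s = 0")
    case True
    then show ?thesis
      using isolated_zeros[OF D(1) open_UNIV connected_UNIV, of s a] D(2) that by auto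
  next
    case False
    have "isCont D s" by (rule entire_isCont[OF D(1)])
    then show ?thesis
      using continuous_at_avoid[of s D 0] False that by (metis Diff_iff dist_commute mem_ball)
  qed
  show ?thesis
    by (rule that[of "r / 2"]) (use r in auto)
qed

text \<open>Joint continuity is lost by pointwise division at the zeros of \<open>D\<close>. It is recovered from the maximum
  principle: \<open>q(s, x) - q(s, x\<^sub>0)\<close> is bounded on a disc by its values on the bounding circle, and the circle can
  be chosen to avoid the zeros of \<open>D\<close>.\<close>

lemma quotient_jointly_continuous:
  fixes q :: "complex \<Rightarrow> 'a :: topological_space \<Rightarrow> complex"
  assumes D: "D holomorphic_on UNIV" "D a \<noteq> 0"
    and q: "\<And>x. (\<lambda>s. q s x) holomorphic_on UNIV"
    and cont: "continuous_on UNIV (\<lambda>(s, x). D s * q s x)"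
  shows "continuous_on UNIV (\<lambda>(s, x). q s x)"
  unfolding continuous_on_topological
proof (intro ballI allI impI)
  fix p :: "complex \<times> 'a" and B
  assume B: "open B" "(case p of (s, x) \<Rightarrow> q s x) \<in> B"
  obtain s0 x0 where p: "p = (s0, x0)" by fastforce
  obtain e where e: "e > 0" "\<And>w. dist w (q s0 x0) < e \<Longrightarrow> w \<in> B"
    using B by (auto simp: p open_dist)
  obtain r where r: "r > 0" "\<And>z. z \<in> cball s0 r - {s0} \<Longrightarrow> D z \<noteq> 0"
    using punctured_nonzero[OF D] by blast
  have Dnz: "D t \<noteq> 0" if "t \<in> sphere s0 r" for t
    using that r by auto
  have "\<exists>c>0. \<forall>t\<in>sphere s0 r. c \<le> norm (D t)"
  proof -
    have "continuous_on (sphere s0 r) (\<lambda>t. norm (D t))"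
      by (intro continuous_intros holomorphic_on_imp_continuous_on holomorphic_on_subset[OF D(1)]) auto
    moreover have "sphere s0 r \<noteq> {}" using r(1) by simp
    ultimately obtain t0 where "t0 \<in> sphere s0 r" "\<forall>t\<in>sphere s0 r. norm (D t0) \<le> norm (D t)"
      using continuous_attains_inf[OF compact_sphere] by blast
    with Dnz show ?thesis by (intro exI[of _ "norm (D t0)"]) auto
  qed
  then obtain c where c: "c > 0" "\<And>t. t \<in> sphere s0 r \<Longrightarrow> c \<le> norm (D t)" by blast
  have cont': "continuous_on (UNIV \<times> sphere s0 r) (\<lambda>y. D (snd y) * q (snd y) (fst y))"
  proof -
    have "continuous_on (UNIV \<times> sphere s0 r) (\<lambda>y. (\<lambda>(s, x). D s * q s x) (snd y, fst y))"
      by (rule continuous_on_compose2[OF cont]) (auto intro!: continuous_intros)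
    then show ?thesis by simp
  qed
  have ce: "c * (e / 2) > 0" using c e by simp
  obtain X0 where X0: "x0 \<in> X0" "open X0"
      "\<forall>x\<in>X0 \<inter> UNIV. \<forall>t\<in>sphere s0 r. dist (D t * q t x) (D t * q t x0) \<le> c * (e / 2)"
    using continuous_on_prod_compactE[OF cont' compact_sphere _ ce, of x0] by auto
  have circ: "norm (q t x - q t x0) \<le> e / 2" if "x \<in> X0" "t \<in> sphere s0 r" for x t
  proof -
    have "c * norm (q t x - q t x0) \<le> norm (D t) * norm (q t x - q t x0)"
      using c(2)[OF that(2)] by (intro mult_right_mono) auto
    also have "\<dots> = dist (D t * q t x) (D t * q t x0)"
      by (simp add: dist_norm norm_mult flip: right_diff_distrib)
    also have "\<dots> \<le> c * (e / 2)" using X0(3) that by blast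
    finally show ?thesis using c(1) mult_left_le_imp_le by blast
  qed
  have disc: "norm (q s x - q s x0) \<le> e / 2" if "x \<in> X0" "s \<in> ball s0 r" for x s
  proof (rule maximum_modulus_frontier[of "\<lambda>s. q s x - q s x0" "ball s0 r"])
    show "(\<lambda>s. q s x - q s x0) holomorphic_on interior (ball s0 r)"
      by (intro holomorphic_intros holomorphic_on_subset[OF q]) auto
    show "continuous_on (closure (ball s0 r)) (\<lambda>s. q s x - q s x0)"
      by (intro continuous_intros holomorphic_on_imp_continuous_on holomorphic_on_subset[OF q]) auto
    show "\<And>z. z \<in> frontier (ball s0 r) \<Longrightarrow> norm (q z x - q z x0) \<le> e / 2"
      using circ[OF that(1)] r(1) by simp
  qed (use that in auto)
  have "isCont (\<lambda>s. q s x0) s0" by (rule entire_isCont[OF q])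
  then obtain d where d: "d > 0" "\<And>s. dist s s0 < d \<Longrightarrow> dist (q s x0) (q s0 x0) < e / 2"
    using e(1) unfolding continuous_at_eps_delta by (meson half_gt_zero)
  show "\<exists>A. open A \<and> p \<in> A \<and> (\<forall>y\<in>UNIV. y \<in> A \<longrightarrow> (case y of (s, x) \<Rightarrow> q s x) \<in> B)"
  proof (intro exI[of _ "ball s0 (min r d) \<times> X0"] conjI ballI impI)
    fix y assume "y \<in> ball s0 (min r d) \<times> X0"
    then obtain s x where y: "y = (s, x)" "s \<in> ball s0 r" "dist s s0 < d" "x \<in> X0"
      by (auto simp: dist_commute)
    have "dist (q s x) (q s0 x0) \<le> dist (q s x) (q s x0) + dist (q s x0) (q s0 x0)"
      by (rule dist_triangle)
    also have "\<dots> < e"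
      using disc[OF y(4,2)] d(2)[OF y(3)] by (simp add: dist_norm)
    finally show "(case y of (s, x) \<Rightarrow> q s x) \<in> B"
      using e(2) y(1) by simp
  qed (use X0 r d in \<open>auto simp: p intro: open_Times\<close>)
qed

text \<open>Joint continuity makes \<open>G s\<^sub>0\<close> a locally uniform limit of holomorphic functions \<open>G s\<close>.\<close>

lemma holomorphic_of_punctured:
  fixes G :: "complex \<Rightarrow> complex \<Rightarrow> complex"
  assumes cont: "continuous_on UNIV (\<lambda>(s, t). G s t)"
    and r: "r > 0" and hol: "\<And>s. s \<in> cball s0 r - {s0} \<Longrightarrow> G s holomorphic_on UNIV"
  shows "G s0 holomorphic_on UNIV"
proof (rule holomorphic_uniform_sequence)
  define \<delta> :: "nat \<Rightarrow> complex" where "\<delta> n = of_real (r / (real n + 1))" for n :: nat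
  define f where "f n = G (s0 + \<delta> n)" for n
  show "f n holomorphic_on UNIV" for n
  proof -
    have "norm (\<delta> n) = r / (real n + 1)"
      unfolding \<delta>_def norm_of_real using r by simp
    moreover have "r / (real n + 1) \<le> r / 1"
      by (rule divide_left_mono) (use r in auto)
    ultimately have "norm (\<delta> n) \<le> r" "norm (\<delta> n) \<noteq> 0"
      using r by (simp_all add: add_nonneg_eq_0_iff)
    then show ?thesis
      unfolding f_def by (intro hol) (auto simp: dist_norm)
  qed
  show "\<exists>d>0. cball x d \<subseteq> UNIV \<and> uniform_limit (cball x d) f (G s0) sequentially" for x
  proof (intro exI[of _ 1] conjI)
    show "uniform_limit (cball x 1) f (G s0) sequentially"
    proof (rule uniform_limitI)
      fix e :: real assume e: "e > 0"
      have cont': "continuous_on (UNIV \<times> cball x 1) (\<lambda>(s, t). G s t)"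
        by (rule continuous_on_subset[OF cont]) auto
      have e2: "e / 2 > 0" using e by simp
      obtain X0 where X0: "s0 \<in> X0" "open X0"
          "\<forall>s\<in>X0 \<inter> UNIV. \<forall>t\<in>cball x 1. dist (G s t) (G s0 t) \<le> e / 2"
        using continuous_on_prod_compactE[OF cont' compact_cball _ e2, of s0] by auto
      have "(\<lambda>n. r / (real n + 1)) \<longlonglongrightarrow> 0"
        using tendsto_mult_right[OF LIMSEQ_inverse_real_of_nat, of r] by (simp add: field_simps)
      then have "(\<lambda>n. s0 + \<delta> n) \<longlonglongrightarrow> s0 + of_real 0"
        unfolding \<delta>_def by (intro tendsto_intros)
      then have "\<forall>\<^sub>F n in sequentially. s0 + \<delta> n \<in> X0"
        using X0 by (auto intro: topological_tendstoD)
      then show "\<forall>\<^sub>F n in sequentially. \<forall>t\<in>cball x 1. dist (f n t) (G s0 t) < e"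
      proof eventually_elim
        case (elim n)
        show ?case
        proof
          fix t assume "t \<in> cball x 1"
          then have "dist (f n t) (G s0 t) \<le> e / 2" using X0(3) elim by (auto simp: f_def)
          then show "dist (f n t) (G s0 t) < e" using e by linarith
        qed
      qed
    qed
  qed auto
qed auto

text \<open>A form of Osgood's lemma. The increment of \<open>g t t\<close> splits into one increment in each variable; the difference
  quotient in the first variable extends to a jointly continuous function \<open>E\<close> by \<open>quotient_jointly_continuous\<close>,
  so that the limit can be taken along the diagonal.\<close>

lemma holomorphic_diagonal:
  fixes g :: "complex \<Rightarrow> complex \<Rightarrow> complex"
  assumes cont: "continuous_on UNIV (\<lambda>(s, t). g s t)"
    and 1: "\<And>t. (\<lambda>s. g s t) holomorphic_on UNIV" and 2: "\<And>s. g s holomorphic_on UNIV"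
  shows "(\<lambda>t. g t t) holomorphic_on UNIV"
proof -
  have "(\<lambda>t. g t t) field_differentiable at t0" for t0
  proof -
    have "\<exists>E. E holomorphic_on UNIV \<and> (\<forall>h. g (t0 + h) s - g t0 s = h * E h)" for s
    proof -
      have "(\<lambda>h. g (t0 + h) s - g t0 s) holomorphic_on UNIV"
        by (intro holomorphic_intros holomorphic_on_compose_gen[OF _ 1, unfolded o_def]) auto
      from entire_divide[OF this holomorphic_on_ident] show ?thesis by auto
    qed
    then obtain E where E: "\<And>s. E s holomorphic_on UNIV" "\<And>s h. g (t0 + h) s - g t0 s = h * E s h"
      by metis
    have "continuous_on UNIV (\<lambda>(h, s). E s h)"
    proof (rule quotient_jointly_continuous[where D = "\<lambda>h. h" and a = 1])
      have "continuous_on UNIV (\<lambda>y. (\<lambda>(s, t). g s t) (t0 + fst y, snd y) - (\<lambda>(s, t). g s t) (t0, snd y))"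
        by (intro continuous_intros continuous_on_compose2[OF cont]) auto
      then show "continuous_on UNIV (\<lambda>(h, s). h * E s h)"
        by (simp add: E(2) case_prod_unfold)
    qed (auto intro: E)
    then have cE: "isCont (\<lambda>(h, s). E s h) (0, t0)"
      by (simp add: continuous_on_eq_continuous_at)
    have "((\<lambda>h. (h, t0 + h)) \<longlongrightarrow> (0, t0 + 0)) (at 0)"
      by (intro tendsto_intros)
    from isCont_tendsto_compose[OF cE, of "\<lambda>h. (h, t0 + h)"] this
    have l1: "((\<lambda>h. E (t0 + h) h) \<longlongrightarrow> E t0 0) (at 0)" by simp
    have "(g t0 has_field_derivative deriv (g t0) t0) (at t0)"
      using 2 by (auto intro: holomorphic_derivI)
    then have l2: "((\<lambda>h. (g t0 (t0 + h) - g t0 t0) / h) \<longlongrightarrow> deriv (g t0) t0) (at 0)"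
      by (simp add: DERIV_def)
    have "((\<lambda>h. E (t0 + h) h + (g t0 (t0 + h) - g t0 t0) / h) \<longlongrightarrow> E t0 0 + deriv (g t0) t0) (at 0)"
      by (intro tendsto_intros l1 l2)
    moreover have "\<forall>\<^sub>F h in at 0. E (t0 + h) h + (g t0 (t0 + h) - g t0 t0) / h
        = (g (t0 + h) (t0 + h) - g t0 t0) / h"
    proof -
      have "E (t0 + h) h + (g t0 (t0 + h) - g t0 t0) / h
        = (g (t0 + h) (t0 + h) - g t0 t0) / h" if "h \<noteq> 0" for h
        using E(2)[of h "t0 + h"] that by (simp add: field_simps)
      then show ?thesis by (auto simp: eventually_at intro: exI[of _ 1])
    qed
    ultimately have "((\<lambda>h. (g (t0 + h) (t0 + h) - g t0 t0) / h) \<longlongrightarrow> E t0 0 + deriv (g t0) t0) (at 0)"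
      by (rule Lim_transform_eventually)
    then have "((\<lambda>t. g t t) has_field_derivative E t0 0 + deriv (g t0) t0) (at t0)"
      by (simp add: DERIV_def)
    then show ?thesis by (auto simp: field_differentiable_def)
  qed
  then show ?thesis
    by (simp add: holomorphic_on_def field_differentiable_at_within)
qed

text \<open>All coordinates are allowed to vary here, in contrast to \<open>entire_in\<close>, so that the coordinate \<open>0\<close> can
  carry the spectral parameter.\<close>

definition sep_entire :: "((nat \<Rightarrow> complex) \<Rightarrow> complex) \<Rightarrow> bool" where
  "sep_entire f \<longleftrightarrow> continuous_on UNIV f \<and> (\<forall>z j. (\<lambda>t. f (z(j := t))) holomorphic_on UNIV)"

lemma sep_entire_cont: "sep_entire f \<Longrightarrow> continuous_on UNIV f"
  by (simp add: sep_entire_def)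

lemma sep_entire_hol: "sep_entire f \<Longrightarrow> (\<lambda>t. f (z(j := t))) holomorphic_on UNIV"
  by (simp add: sep_entire_def)

lemma sep_entire_const [intro, simp]: "sep_entire (\<lambda>_. c)"
  by (simp add: sep_entire_def)

lemma sep_entire_coord [intro, simp]: "sep_entire (\<lambda>z. z i)"
  unfolding sep_entire_def
proof (intro conjI allI)
  show "(\<lambda>t. (z(j := t)) i) holomorphic_on UNIV" for z j
    by (cases "i = j") (auto intro: holomorphic_intros)
qed (rule continuous_on_product_coordinates)

lemma sep_entire_add: "sep_entire f \<Longrightarrow> sep_entire g \<Longrightarrow> sep_entire (\<lambda>z. f z + g z)"
  unfolding sep_entire_def by (auto intro: continuous_on_add holomorphic_on_add)

lemma sep_entire_diff: "sep_entire f \<Longrightarrow> sep_entire g \<Longrightarrow> sep_entire (\<lambda>z. f z - g z)"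
  unfolding sep_entire_def by (auto intro: continuous_on_diff holomorphic_on_diff)

lemma sep_entire_mult: "sep_entire f \<Longrightarrow> sep_entire g \<Longrightarrow> sep_entire (\<lambda>z. f z * g z)"
  unfolding sep_entire_def by (auto intro: continuous_on_mult holomorphic_on_mult)

lemma sep_entire_minus: "sep_entire f \<Longrightarrow> sep_entire (\<lambda>z. - f z)"
  unfolding sep_entire_def by (auto intro: continuous_on_minus holomorphic_on_minus)

lemma sep_entire_sum: "(\<And>i. i \<in> I \<Longrightarrow> sep_entire (f i)) \<Longrightarrow> sep_entire (\<lambda>z. \<Sum>i\<in>I. f i z)"
  unfolding sep_entire_def by (auto intro: continuous_on_sum holomorphic_on_sum)

lemma sep_entire_prod: "(\<And>i. i \<in> I \<Longrightarrow> sep_entire (f i)) \<Longrightarrow> sep_entire (\<lambda>z. \<Prod>i\<in>I. f i z)"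
  unfolding sep_entire_def by (auto intro: continuous_on_prod holomorphic_on_prod)

lemma sep_entire_compose1:
  assumes h: "h holomorphic_on UNIV" and f: "sep_entire f"
  shows "sep_entire (\<lambda>z. h (f z))"
  unfolding sep_entire_def
proof (intro conjI allI)
  show "continuous_on UNIV (\<lambda>z. h (f z))"
    by (rule continuous_on_compose2[OF holomorphic_on_imp_continuous_on[OF h] sep_entire_cont[OF f]]) auto
  show "(\<lambda>t. h (f (z(j := t)))) holomorphic_on UNIV" for z j
    using holomorphic_on_compose_gen[OF sep_entire_hol[OF f] h, of z j] by (simp add: o_def)
qed

lemma continuous_on_funI:
  "(\<And>i. continuous_on S (\<lambda>x. f x i)) \<Longrightarrow> continuous_on S (f :: _ \<Rightarrow> nat \<Rightarrow> complex)"
  by (rule continuous_on_coordinatewise_then_product)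

text \<open>The coordinates are replaced by \<open>a j t\<close> one at a time; each replacement is an instance of
  \<open>holomorphic_diagonal\<close> for the parameter used so far and the new one.\<close>

lemma sep_entire_along:
  assumes f: "sep_entire f" and J: "finite J" "\<And>z z'. (\<forall>j\<in>J. z j = z' j) \<Longrightarrow> f z = f z'"
    and a: "\<And>j. a j holomorphic_on UNIV"
  shows "(\<lambda>t. f (\<lambda>j. a j t)) holomorphic_on UNIV"
proof -
  have *: "(\<lambda>t. f (\<lambda>j. if j \<in> F then a j t else c j)) holomorphic_on UNIV" if "finite F" for F c
    using that
  proof (induction F arbitrary: c)
    case empty
    show ?case by simp
  next
    case (insert i F)
    define g where "g s t = f (\<lambda>j. if j \<in> F then a j s else if j = i then a i t else c j)" for s t
    have ca: "continuous_on UNIV (a j)" for j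
      by (rule holomorphic_on_imp_continuous_on[OF a])
    have "(\<lambda>t. g t t) holomorphic_on UNIV"
    proof (rule holomorphic_diagonal[of g])
      have "continuous_on UNIV (\<lambda>y. f (\<lambda>j. if j \<in> F then a j (fst y) else if j = i then a i (snd y) else c j))"
      proof (rule continuous_on_compose2[OF sep_entire_cont[OF f]])
        show "continuous_on UNIV (\<lambda>y j. if j \<in> F then a j (fst y) else if j = i then a i (snd y) else c j)"
        proof (rule continuous_on_funI)
          fix j
          show "continuous_on UNIV (\<lambda>y. if j \<in> F then a j (fst y) else if j = i then a i (snd y) else c j)"
            by (cases "j \<in> F"; cases "j = i") (auto intro!: continuous_intros continuous_on_compose2[OF ca])
        qed
      qed auto
      then show "continuous_on UNIV (\<lambda>(s, t). g s t)" by (simp add: g_def case_prod_unfold)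
      show "(\<lambda>s. g s t) holomorphic_on UNIV" for t
      proof -
        have "(\<lambda>j. if j \<in> F then a j s else if j = i then a i t else c j)
          = (\<lambda>j. if j \<in> F then a j s else (c(i := a i t)) j)" for s by auto
        then show ?thesis unfolding g_def using insert.IH[of "c(i := a i t)"] by simp
      qed
      show "g s holomorphic_on UNIV" for s
      proof -
        have "(\<lambda>j. if j \<in> F then a j s else if j = i then a i t else c j)
          = (\<lambda>j. if j \<in> F then a j s else c j)(i := a i t)" for t using insert.hyps by auto
        then have "g s = (\<lambda>t. f ((\<lambda>j. if j \<in> F then a j s else c j)(i := a i t)))"
          unfolding g_def by simp
        then show ?thesis
          using holomorphic_on_compose_gen[OF a sep_entire_hol[OF f], of i "\<lambda>j. if j \<in> F then a j s else c j" i]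
          by (simp add: o_def)
      qed
    qed
    moreover have "g t t = f (\<lambda>j. if j \<in> insert i F then a j t else c j)" for t
      unfolding g_def by (rule arg_cong[of _ _ f]) auto
    ultimately show ?case by simp
  qed
  have "f (\<lambda>j. a j t) = f (\<lambda>j. if j \<in> J then a j t else 0)" for t
    by (rule J(2)) auto
  then show ?thesis using *[OF J(1), of "\<lambda>_. 0"] by simp
qed

lemma sep_entire_compose:
  assumes f: "sep_entire f" and J: "finite J" "\<And>z z'. (\<forall>j\<in>J. z j = z' j) \<Longrightarrow> f z = f z'"
    and A: "\<And>j. sep_entire (A j)"
  shows "sep_entire (\<lambda>x. f (\<lambda>j. A j x))"
  unfolding sep_entire_def
proof (intro conjI allI)
  show "continuous_on UNIV (\<lambda>x. f (\<lambda>j. A j x))"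
    by (rule continuous_on_compose2[OF sep_entire_cont[OF f]])
      (auto intro!: continuous_on_funI sep_entire_cont A)
  show "(\<lambda>t. f (\<lambda>i. A i (z(j := t)))) holomorphic_on UNIV" for z j
    by (rule sep_entire_along[OF f J]) (use sep_entire_hol[OF A] in auto)
qed

lemma sep_entire_shift:
  assumes "sep_entire f" shows "sep_entire (\<lambda>x. f (x(j := x j + c)))"
  unfolding sep_entire_def
proof (intro conjI allI)
  show "continuous_on UNIV (\<lambda>x. f (x(j := x j + c)))"
  proof (rule continuous_on_compose2[OF sep_entire_cont[OF assms]])
    show "continuous_on UNIV (\<lambda>x::nat \<Rightarrow> complex. x(j := x j + c))"
    proof (rule continuous_on_funI)
      show "continuous_on UNIV (\<lambda>x::nat \<Rightarrow> complex. (x(j := x j + c)) i)" for i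
        by (cases "i = j") (simp_all add: continuous_on_add)
    qed
  qed auto
  show "(\<lambda>t. f ((x(i := t))(j := (x(i := t)) j + c))) holomorphic_on UNIV" for x i
  proof (cases "i = j")
    case True
    then show ?thesis
      using holomorphic_on_compose_gen[OF _ sep_entire_hol[OF assms, of x j], of "\<lambda>t. t + c" UNIV]
      by (simp add: o_def holomorphic_on_add holomorphic_on_ident)
  next
    case False
    then have "(x(i := t))(j := (x(i := t)) j + c) = (x(j := x j + c))(i := t)" for t
      by auto
    then show ?thesis using sep_entire_hol[OF assms] by simp
  qed
qed

lemma sep_entire_restrict:
  assumes "sep_entire f" shows "sep_entire (\<lambda>x. f (\<lambda>i. if i \<in> J then x i else 0))"
  unfolding sep_entire_def
proof (intro conjI allI)
  show "continuous_on UNIV (\<lambda>x. f (\<lambda>i. if i \<in> J then x i else 0))"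
  proof (rule continuous_on_compose2[OF sep_entire_cont[OF assms]])
    show "continuous_on UNIV (\<lambda>x::nat \<Rightarrow> complex. (\<lambda>i. if i \<in> J then x i else 0))"
    proof (rule continuous_on_funI)
      show "continuous_on UNIV (\<lambda>x::nat \<Rightarrow> complex. if i \<in> J then x i else 0)" for i
        by (cases "i \<in> J") simp_all
    qed
  qed auto
  show "(\<lambda>t. f (\<lambda>l. if l \<in> J then (x(i := t)) l else 0)) holomorphic_on UNIV" for x i
  proof (cases "i \<in> J")
    case True
    then have "(\<lambda>l. if l \<in> J then (x(i := t)) l else 0) = (\<lambda>l. if l \<in> J then x l else 0)(i := t)" for t
      by auto
    then show ?thesis using sep_entire_hol[OF assms] by simp
  next
    case False
    then have "(\<lambda>l. if l \<in> J then (x(i := t)) l else 0) = (\<lambda>l. if l \<in> J then x l else 0)" for t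
      by auto
    then show ?thesis by simp
  qed
qed

lemma entire_in_sep_entire:
  assumes "entire_in p f"
  shows "sep_entire f"
  unfolding sep_entire_def
proof (intro conjI allI)
  show "continuous_on UNIV f" using assms by (simp add: entire_in_def)
  show "(\<lambda>t. f (z(j := t))) holomorphic_on UNIV" for z j
  proof (cases "j \<in> {1..p}")
    case False
    have "\<And>z z'. (\<forall>j\<in>{1..p}. z j = z' j) \<Longrightarrow> f z = f z'"
      using assms unfolding entire_in_def by blast
    then have "f (z(j := t)) = f z" for t
      using False by (metis fun_upd_apply)
    then show ?thesis by simp
  qed (use assms in \<open>auto simp: entire_in_def\<close>)
qed

lemma entire_inI:
  assumes "sep_entire f" "\<And>z z'. (\<And>j. j \<in> {1..p} \<Longrightarrow> z j = z' j) \<Longrightarrow> f z = f z'"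
  shows "entire_in p f"
  using assms unfolding entire_in_def sep_entire_def by blast

text \<open>Division in the coordinate \<open>j\<close> with the others frozen gives \<open>Q s z\<close>, jointly continuous by
  \<open>quotient_jointly_continuous\<close>. In another coordinate it is visibly holomorphic off the zeros of theta, and at a
  zero by \<open>holomorphic_of_punctured\<close>.\<close>

lemma sep_entire_divide_theta:
  assumes \<tau>: "Im \<tau> > 0" and f: "sep_entire f" and v: "\<And>z. z j \<in> period_lattice \<tau> \<Longrightarrow> f z = 0"
  obtains q where "sep_entire q" "\<And>z. f z = theta \<tau> (z j) * q z"
proof -
  have th: "theta \<tau> holomorphic_on UNIV" by (rule theta_holomorphic[OF \<tau>])
  obtain a where a: "theta \<tau> a \<noteq> 0" using theta_not_identically_zero[OF \<tau>] by blast
  have "\<exists>E. E holomorphic_on UNIV \<and> (\<forall>t. f (z(j := t)) = theta \<tau> t * E t)" for z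
    using entire_divide_theta[OF \<tau> sep_entire_hol[OF f, of z j]] v by (metis fun_upd_same)
  then obtain E where E: "\<And>z. E z holomorphic_on UNIV" "\<And>z t. f (z(j := t)) = theta \<tau> t * E z t"
    by metis
  define Q where "Q s z = E (z(j := 0)) s" for s z
  have Q: "f (z(j := t)) = theta \<tau> t * Q t z" for z t
    using E(2)[of "z(j := 0)"] by (simp add: Q_def)
  have cQ: "continuous_on UNIV (\<lambda>(s, z). Q s z)"
  proof (rule quotient_jointly_continuous[OF th a])
    show "(\<lambda>s. Q s x) holomorphic_on UNIV" for x using E(1) by (simp add: Q_def)
    have "continuous_on UNIV (\<lambda>y. f ((snd y)(j := fst y)))"
    proof (rule continuous_on_compose2[OF sep_entire_cont[OF f]])
      show "continuous_on UNIV (\<lambda>y :: complex \<times> (nat \<Rightarrow> complex). (snd y)(j := fst y))"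
      proof (rule continuous_on_funI)
        fix i
        have "continuous_on UNIV (\<lambda>y :: complex \<times> (nat \<Rightarrow> complex). snd y i)"
          by (rule continuous_on_compose2[OF continuous_on_product_coordinates[of i]
                continuous_on_snd[OF continuous_on_id]]) auto
        moreover have "continuous_on UNIV (\<lambda>y :: complex \<times> (nat \<Rightarrow> complex). fst y)"
          by (intro continuous_on_fst continuous_on_id)
        ultimately show "continuous_on UNIV (\<lambda>y :: complex \<times> (nat \<Rightarrow> complex). ((snd y)(j := fst y)) i)"
          by (cases "i = j") simp_all
      qed
    qed auto
    then show "continuous_on UNIV (\<lambda>(s, x). theta \<tau> s * Q s x)"
      by (simp add: Q case_prod_unfold)
  qed
  define q where "q z = Q (z j) z" for z
  have "sep_entire q"
    unfolding sep_entire_def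
  proof (intro conjI allI)
    have "continuous_on UNIV (\<lambda>z. (\<lambda>(s, z). Q s z) (z j, z))"
      by (rule continuous_on_compose2[OF cQ])
        (auto intro: continuous_on_Pair continuous_on_product_coordinates continuous_on_id)
    then show "continuous_on UNIV q" by (simp add: q_def[abs_def])
    show "(\<lambda>t. q (z(i := t))) holomorphic_on UNIV" for z i
    proof (cases "i = j")
      case True
      then show ?thesis using E(1) by (simp add: q_def Q_def)
    next
      case False
      define G where "G s t = Q s (z(i := t))" for s t
      have cG: "continuous_on UNIV (\<lambda>(s, t). G s t)"
      proof -
        have "continuous_on UNIV (\<lambda>y. (\<lambda>(s, z). Q s z) (fst y, z(i := snd y)))"
        proof (rule continuous_on_compose2[OF cQ])
          have "continuous_on UNIV (\<lambda>y :: complex \<times> complex. z(i := snd y))"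
          proof (rule continuous_on_funI)
            show "continuous_on UNIV (\<lambda>y :: complex \<times> complex. (z(i := snd y)) k)" for k
              by (cases "k = i") (auto intro!: continuous_intros)
          qed
          then show "continuous_on UNIV (\<lambda>y :: complex \<times> complex. (fst y, z(i := snd y)))"
            by (intro continuous_on_Pair continuous_on_fst continuous_on_id)
        qed auto
        then show ?thesis by (simp add: G_def case_prod_unfold)
      qed
      obtain r where r: "r > 0" "\<And>s. s \<in> cball (z j) r - {z j} \<Longrightarrow> theta \<tau> s \<noteq> 0"
        using punctured_nonzero[OF th a] by blast
      have "G (z j) holomorphic_on UNIV"
      proof (rule holomorphic_of_punctured[OF cG r(1)])
        fix s assume "s \<in> cball (z j) r - {z j}"
        then have nz: "theta \<tau> s \<noteq> 0" by (rule r(2))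
        have "G s = (\<lambda>t. f ((z(j := s))(i := t)) / theta \<tau> s)"
        proof
          fix t
          have "f ((z(i := t))(j := s)) = theta \<tau> s * G s t"
            by (simp add: Q G_def)
          then show "G s t = f ((z(j := s))(i := t)) / theta \<tau> s"
            using nz False by (simp add: fun_upd_twist)
        qed
        then show "G s holomorphic_on UNIV"
          using nz by (auto intro!: holomorphic_intros sep_entire_hol[OF f])
      qed
      then show ?thesis using False by (simp add: q_def G_def[abs_def])
    qed
  qed
  moreover have "f z = theta \<tau> (z j) * q z" for z
    using Q[of z "z j"] by (simp add: q_def)
  ultimately show ?thesis using that by blast
qed

text \<open>Stated at one point \<open>z0\<close>, with the vanishing assumed on the points that differ from \<open>z0\<close> only in \<open>J\<close>,
  because it is applied on a slice where one coordinate outside \<open>J\<close> is a zero of theta.\<close>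

lemma sep_entire_theta_cancel:
  assumes \<tau>: "Im \<tau> > 0" and g: "sep_entire g" and J: "finite J"
    and 0: "\<And>z. (\<And>i. i \<notin> J \<Longrightarrow> z i = z0 i) \<Longrightarrow> (\<Prod>j\<in>J. theta \<tau> (z j)) * g z = 0"
  shows "g z0 = 0"
  using J 0
proof (induction J arbitrary: z0)
  case empty
  from empty[of z0] show ?case by simp
next
  case (insert i J)
  obtain a where a: "theta \<tau> a \<noteq> 0" using theta_not_identically_zero[OF \<tau>] by blast
  have "theta \<tau> t * g (z0(i := t)) = 0" for t
  proof (cases "theta \<tau> t = 0")
    case False
    have "g (z0(i := t)) = 0"
    proof (rule insert.IH)
      fix z assume z: "\<And>k. k \<notin> J \<Longrightarrow> z k = (z0(i := t)) k"
      have "(\<Prod>j\<in>insert i J. theta \<tau> (z j)) * g z = 0"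
      proof (rule insert.prems)
        show "z k = z0 k" if "k \<notin> insert i J" for k using z[of k] that by auto
      qed
      moreover have "z i = t" using z[of i] insert.hyps by simp
      ultimately show "(\<Prod>j\<in>J. theta \<tau> (z j)) * g z = 0"
        using insert.hyps False by auto
    qed
    then show ?thesis by simp
  qed simp
  from entire_mult_cancel[OF theta_holomorphic[OF \<tau>] sep_entire_hol[OF g, of z0 i] a this, of "z0 i"]
  show ?case by simp
qed

text \<open>One theta factor is divided out after the other; \<open>sep_entire_theta_cancel\<close> shows that the partial
  quotient still vanishes where the next factor does.\<close>

lemma sep_entire_divide_thetas:
  assumes \<tau>: "Im \<tau> > 0" and f: "sep_entire f" and J: "finite J"
    and v: "\<And>z j. j \<in> J \<Longrightarrow> z j \<in> period_lattice \<tau> \<Longrightarrow> f z = 0"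
  obtains q where "sep_entire q" "\<And>z. f z = (\<Prod>j\<in>J. theta \<tau> (z j)) * q z"
proof -
  have "\<exists>q. sep_entire q \<and> (\<forall>z. f z = (\<Prod>j\<in>J. theta \<tau> (z j)) * q z)"
    using J v
  proof (induction J)
    case empty
    show ?case using f by auto
  next
    case (insert i J)
    then obtain q where q: "sep_entire q" "\<And>z. f z = (\<Prod>j\<in>J. theta \<tau> (z j)) * q z"
      by auto
    have "q z = 0" if zi: "z i \<in> period_lattice \<tau>" for z
    proof (rule sep_entire_theta_cancel[OF \<tau> q(1) insert.hyps(1)])
      fix z' assume "\<And>k. k \<notin> J \<Longrightarrow> z' k = z k"
      then have "z' i = z i" using insert.hyps by blast
      then have "f z' = 0" using insert.prems[of i z'] zi by simp
      then show "(\<Prod>j\<in>J. theta \<tau> (z' j)) * q z' = 0" by (simp add: q(2))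
    qed
    then obtain q' where q': "sep_entire q'" "\<And>z. q z = theta \<tau> (z i) * q' z"
      using sep_entire_divide_theta[OF \<tau> q(1), of i] by blast
    show ?case
      using q' q(2) insert.hyps by (intro exI[of _ q']) (auto simp: mult_ac)
  qed
  then show ?thesis using that by blast
qed

section \<open>Continuants\<close>

lemma tridiag_det_Nil [simp]: "tridiag_det [] = 1"
  by (simp add: tridiag_det_def)

lemma tridiag_det_single [simp]: "tridiag_det [m] = m"
  by (simp add: tridiag_det_def det_single)

definition tridiag_mat :: "int list \<Rightarrow> int mat" where
  "tridiag_mat ms = Matrix.mat (length ms) (length ms)
      (\<lambda>(i, j). if i = j then ms ! i else if i = Suc j \<or> j = Suc i then -1 else 0)"

lemma tridiag_mat_carrier: "tridiag_mat ms \<in> carrier_mat (length ms) (length ms)"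
  by (simp add: tridiag_mat_def)

text \<open>Expansion along the first column; the minor of the entry \<open>-1\<close> has a first row with the single nonzero
  entry \<open>-1\<close>.\<close>

lemma tridiag_det_Cons2: "tridiag_det (m # m' # ms) = m * tridiag_det (m' # ms) - tridiag_det ms"
proof -
  define A where "A = tridiag_mat (m # m' # ms)"
  define N where "N = length ms"
  have A: "A \<in> carrier_mat (Suc (Suc N)) (Suc (Suc N))"
    using tridiag_mat_carrier[of "m # m' # ms"] by (simp add: A_def N_def)
  define B where "B = mat_delete A 1 0"
  have B: "B \<in> carrier_mat (Suc N) (Suc N)"
    using mat_delete_carrier[OF A, of 1 0] by (simp add: B_def)
  have A0: "mat_delete A 0 0 = tridiag_mat (m' # ms)"
    using A by (intro eq_matI) (auto simp: A_def tridiag_mat_def mat_delete_def N_def)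
  have B0: "mat_delete B 0 0 = tridiag_mat ms"
    using A B by (intro eq_matI) (auto simp: B_def A_def tridiag_mat_def mat_delete_def N_def)
  have "Determinant.det B = (\<Sum>j<Suc N. B $$ (0, j) * cofactor B 0 j)"
    by (rule laplace_expansion_row[OF B]) simp
  also have "\<dots> = (\<Sum>j\<in>{0}. B $$ (0, j) * cofactor B 0 j)"
    by (rule sum.mono_neutral_right) (auto simp: B_def A_def tridiag_mat_def mat_delete_def N_def)
  also have "\<dots> = - tridiag_det ms"
    using B0 by (simp add: cofactor_def tridiag_det_def tridiag_mat_def)
      (simp add: B_def A_def tridiag_mat_def mat_delete_def)
  finally have detB: "Determinant.det B = - tridiag_det ms" .
  have "Determinant.det A = (\<Sum>i<Suc (Suc N). A $$ (i, 0) * cofactor A i 0)"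
    by (rule laplace_expansion_column[OF A]) simp
  also have "\<dots> = (\<Sum>i\<in>{0,1}. A $$ (i, 0) * cofactor A i 0)"
    by (rule sum.mono_neutral_right) (auto simp: A_def tridiag_mat_def N_def)
  also have "\<dots> = A $$ (0, 0) * Determinant.det (mat_delete A 0 0) - A $$ (1, 0) * Determinant.det B"
    by (simp add: cofactor_def B_def)
  also have "\<dots> = m * tridiag_det (m' # ms) - tridiag_det ms"
    unfolding A0 detB by (simp add: A_def tridiag_mat_def tridiag_det_def)
  finally show ?thesis by (simp add: A_def tridiag_mat_def tridiag_det_def)
qed

lemma tridiag_det_snoc2:
  "tridiag_det (ms @ [a, b]) = b * tridiag_det (ms @ [a]) - tridiag_det ms"
proof (induction ms rule: induct_list012)
  case 1
  show ?case by (simp add: tridiag_det_Cons2)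
next
  case (2 x)
  show ?case by (simp add: tridiag_det_Cons2 algebra_simps)
next
  case (3 x y zs)
  have "tridiag_det ((x # y # zs) @ [a, b]) = x * tridiag_det ((y # zs) @ [a, b]) - tridiag_det (zs @ [a, b])"
    by (simp add: tridiag_det_Cons2)
  also have "\<dots> = b * tridiag_det ((x # y # zs) @ [a]) - tridiag_det (x # y # zs)"
    unfolding 3 by (simp add: tridiag_det_Cons2 algebra_simps)
  finally show ?case .
qed

text \<open>Taking the continuants of the tails with a minus sign yields the sequence \<open>\<gamma>\<close>, those of the initial
  segments (\<open>tridiag_det_take\<close>) the sequence \<open>\<mu>\<close>; both obey the same recurrence.\<close>

lemma tridiag_det_drop:
  assumes "1 \<le> j" "j < length ns"
  shows "tridiag_det (drop (j - 1) ns) + tridiag_det (drop (j + 1) ns) = ns ! (j - 1) * tridiag_det (drop j ns)"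
proof -
  have "drop (j - 1) ns = ns ! (j - 1) # ns ! j # drop (j + 1) ns" "drop j ns = ns ! j # drop (j + 1) ns"
    using assms Cons_nth_drop_Suc[of "j - 1" ns] Cons_nth_drop_Suc[of j ns] by simp_all
  then show ?thesis by (simp add: tridiag_det_Cons2)
qed

lemma tridiag_det_take:
  assumes "2 \<le> j" "j \<le> length ns"
  shows "tridiag_det (take j ns) + tridiag_det (take (j - 2) ns) = ns ! (j - 1) * tridiag_det (take (j - 1) ns)"
proof -
  obtain i where j: "j = Suc (Suc i)" using assms(1) by (metis add_2_eq_Suc le_Suc_ex)
  have "take (Suc i) ns = take i ns @ [ns ! i]" "take (Suc (Suc i)) ns = take i ns @ [ns ! i, ns ! Suc i]"
    using assms(2) j by (simp_all add: take_Suc_conv_app_nth)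
  then show ?thesis using j by (simp add: tridiag_det_snoc2)
qed

text \<open>Positivity and monotonicity of the continuants keep the denominators of the continued fraction away from
  zero; coprimality makes the fraction reduced, so that the determinants can be read off from its value.\<close>

lemma minus_cf_tridiag_det:
  assumes "ns \<noteq> []" "\<forall>m\<in>set ns. m \<ge> 2"
  shows "0 < tridiag_det (tl ns) \<and> tridiag_det (tl ns) < tridiag_det ns
    \<and> minus_cf ns = of_int (tridiag_det ns) / of_int (tridiag_det (tl ns))
    \<and> coprime (tridiag_det ns) (tridiag_det (tl ns))"
  using assms
proof (induction ns rule: minus_cf.induct)
  case (3 m m' ms)
  let ?a = "tridiag_det (m' # ms)" and ?b = "tridiag_det ms"
  from 3 have IH: "0 < ?b" "?b < ?a" "minus_cf (m' # ms) = of_int ?a / of_int ?b" "coprime ?a ?b"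
    by simp_all
  have d: "tridiag_det (m # m' # ms) = m * ?a - ?b" by (rule tridiag_det_Cons2)
  have "m * ?a \<ge> 2 * ?a" using 3 IH by (intro mult_right_mono) auto
  moreover have "coprime (m * ?a - ?b) ?a"
  proof -
    have "gcd (m * ?a - ?b) ?a = gcd (- ?b) ?a"
      using gcd_add_mult[of ?a m "- ?b"] by (simp add: gcd.commute algebra_simps)
    then show ?thesis using IH(4) by (simp add: coprime_iff_gcd_eq_1 gcd.commute)
  qed
  moreover have "minus_cf (m # m' # ms) = of_int (m * ?a - ?b) / of_int ?a"
    using IH(1,2) by (simp add: IH(3) field_simps del: minus_cf.simps(3)) (simp add: IH(3) field_simps)
  moreover have "?a < m * ?a - ?b" if "m * ?a \<ge> 2 * ?a"
    using that IH(2) by linarith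
  ultimately show ?case
    unfolding d using IH(1,2) by simp
qed auto

lemma tridiag_det_of_minus_cf:
  assumes "ns \<noteq> []" "\<forall>m\<in>set ns. m \<ge> 2" "k < n" "coprime n k"
    "real n / real (n - k) = minus_cf ns"
  shows "tridiag_det ns = int n"
proof -
  from minus_cf_tridiag_det[OF assms(1,2)] have *: "0 < tridiag_det (tl ns)" "0 < tridiag_det ns"
    "minus_cf ns = of_int (tridiag_det ns) / of_int (tridiag_det (tl ns))"
    "coprime (tridiag_det ns) (tridiag_det (tl ns))" by auto
  let ?a = "int n" and ?b = "int (n - k)"
  have "real_of_int ?a * real_of_int (tridiag_det (tl ns)) = real_of_int (tridiag_det ns) * real_of_int ?b"
    using assms(3,5) *(1,3) by (simp add: field_simps)
  then have e: "?a * tridiag_det (tl ns) = tridiag_det ns * ?b"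
    by (metis of_int_eq_iff of_int_mult)
  have "gcd (n - k) n = gcd k n"
    using assms(3) by (intro gcd_diff2_nat) simp
  then have c: "coprime ?a ?b"
    using assms(4) unfolding coprime_int_iff by (simp add: coprime_iff_gcd_eq_1 gcd.commute)
  show "tridiag_det ns = ?a"
  proof (rule zdvd_antisym_nonneg)
    show "?a dvd tridiag_det ns"
      using e c by (metis coprime_dvd_mult_left_iff dvd_triv_left)
    show "tridiag_det ns dvd ?a"
      using e *(4) by (metis coprime_dvd_mult_left_iff dvd_triv_left)
  qed (use * in auto)
qed

section \<open>Homomorphisms out of presented algebras\<close>

text \<open>Scalar multiples are written as products with constants, so that the ring laws apply to them.\<close>

definition scalar :: "complex \<Rightarrow> 'g nc_poly" where
  "scalar c = Poly_Mapping.single 0 c"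

lemma letters_0 [simp]: "letters 0 = []"
  by (simp add: zero_free_mon_def)

lemma nc_scale_scalar: "c \<bullet>\<^sub>n\<^sub>c p = scalar c * p"
  by (simp add: nc_scale_def scalar_def mult_map_scale_conv_mult)

lemma scalar_mult: "scalar (c * d) = scalar c * scalar d"
  by (simp add: scalar_def mult_single)

lemma scalar_add: "scalar (c + d) = scalar c + scalar d"
  by (simp add: scalar_def single_add)

lemma scalar_uminus: "scalar (- c) = - scalar c"
  by (simp add: scalar_def single_uminus)

lemma scalar_1 [simp]: "scalar 1 = 1"
  by (simp add: scalar_def)

lemma scalar_0 [simp]: "scalar 0 = 0"
  by (simp add: scalar_def)

lemma scalar_sum: "scalar (\<Sum>i\<in>I. c i) = (\<Sum>i\<in>I. scalar (c i))"
  by (induction I rule: infinite_finite_induct) (simp_all add: scalar_add)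

lemma nc_poly_eq_sum:
  "(\<Sum>m\<in>Poly_Mapping.keys p. Poly_Mapping.single m (Poly_Mapping.lookup p m)) = p"
  by (rule poly_mapping_eqI) (simp add: lookup_sum lookup_single when_def in_keys_iff sum.delta)

lemma scalar_commute:
  fixes p :: "'g nc_poly"
  shows "scalar c * p = p * scalar c"
proof -
  have "scalar c * Poly_Mapping.single m d = Poly_Mapping.single m d * scalar c" for m :: "'g free_mon" and d
    by (simp add: scalar_def mult_single mult.commute)
  then have "scalar c * (\<Sum>m\<in>Poly_Mapping.keys p. Poly_Mapping.single m (Poly_Mapping.lookup p m))
    = (\<Sum>m\<in>Poly_Mapping.keys p. Poly_Mapping.single m (Poly_Mapping.lookup p m)) * scalar c"
    by (simp add: sum_distrib_left sum_distrib_right)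
  then show ?thesis by (simp add: nc_poly_eq_sum)
qed

definition nc_subst :: "('g \<Rightarrow> 'h nc_poly) \<Rightarrow> 'g nc_poly \<Rightarrow> 'h nc_poly" where
  "nc_subst \<sigma> p = (\<Sum>m\<in>Poly_Mapping.keys p. scalar (Poly_Mapping.lookup p m) * prod_list (map \<sigma> (letters m)))"

lemma nc_subst_superset:
  assumes "finite S" "Poly_Mapping.keys p \<subseteq> S"
  shows "nc_subst \<sigma> p = (\<Sum>m\<in>S. scalar (Poly_Mapping.lookup p m) * prod_list (map \<sigma> (letters m)))"
  unfolding nc_subst_def
  by (rule sum.mono_neutral_left) (use assms in \<open>auto simp: in_keys_iff\<close>)

lemma nc_subst_add: "nc_subst \<sigma> (p + q) = nc_subst \<sigma> p + nc_subst \<sigma> q"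
proof -
  let ?S = "Poly_Mapping.keys p \<union> Poly_Mapping.keys q"
  have "Poly_Mapping.keys (p + q) \<subseteq> ?S" by (rule keys_add)
  then show ?thesis
    using nc_subst_superset[of ?S p \<sigma>] nc_subst_superset[of ?S q \<sigma>] nc_subst_superset[of ?S "p + q" \<sigma>]
    by (simp add: lookup_add scalar_add distrib_right sum.distrib)
qed

lemma nc_subst_0 [simp]: "nc_subst \<sigma> 0 = 0"
  by (simp add: nc_subst_def)

lemma nc_subst_sum: "nc_subst \<sigma> (\<Sum>i\<in>I. p i) = (\<Sum>i\<in>I. nc_subst \<sigma> (p i))"
  by (induction I rule: infinite_finite_induct) (simp_all add: nc_subst_add)

lemma nc_subst_minus: "nc_subst \<sigma> (- p) = - nc_subst \<sigma> p"
  using nc_subst_add[of \<sigma> p "- p"] by (simp add: eq_neg_iff_add_eq_0 add.commute)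

lemma nc_subst_diff: "nc_subst \<sigma> (p - q) = nc_subst \<sigma> p - nc_subst \<sigma> q"
  using nc_subst_add[of \<sigma> p "- q"] by (simp add: nc_subst_minus)

lemma nc_subst_single: "nc_subst \<sigma> (Poly_Mapping.single m c) = scalar c * prod_list (map \<sigma> (letters m))"
  by (cases "c = 0") (simp_all add: nc_subst_def)

lemma nc_subst_var [simp]: "nc_subst \<sigma> (nc_var g) = \<sigma> g"
  by (simp add: nc_var_def nc_subst_single)

lemma nc_subst_1 [simp]: "nc_subst \<sigma> 1 = 1"
  using nc_subst_single[of \<sigma> 0 1] by simp

lemma nc_subst_mult:
  fixes \<sigma> :: "'g \<Rightarrow> 'h nc_poly"
  shows "nc_subst \<sigma> (p * q) = nc_subst \<sigma> p * nc_subst \<sigma> q"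
proof -
  let ?s = "\<lambda>p m. Poly_Mapping.single m (Poly_Mapping.lookup p m)"
  have s: "nc_subst \<sigma> (Poly_Mapping.single m c * Poly_Mapping.single m' d)
     = nc_subst \<sigma> (Poly_Mapping.single m c) * nc_subst \<sigma> (Poly_Mapping.single m' d)" for m m' c d
  proof -
    have "scalar d * (P * Q) = P * (scalar d * Q)" for P Q :: "'h nc_poly"
      using scalar_commute[of d P] by (metis mult.assoc)
    then show ?thesis
      by (simp add: mult_single nc_subst_single plus_free_mon_def scalar_mult mult.assoc)
  qed
  have "nc_subst \<sigma> ((\<Sum>m\<in>Poly_Mapping.keys p. ?s p m) * (\<Sum>m\<in>Poly_Mapping.keys q. ?s q m))
      = nc_subst \<sigma> (\<Sum>m\<in>Poly_Mapping.keys p. ?s p m) * nc_subst \<sigma> (\<Sum>m\<in>Poly_Mapping.keys q. ?s q m)"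
    by (simp only: sum_product nc_subst_sum s)
  then show ?thesis by (simp only: nc_poly_eq_sum)
qed

lemma nc_subst_scale: "nc_subst \<sigma> (c \<bullet>\<^sub>n\<^sub>c p) = c \<bullet>\<^sub>n\<^sub>c nc_subst \<sigma> p"
  unfolding nc_scale_scalar nc_subst_mult
  by (simp add: scalar_def nc_subst_single)

lemma nc_subst_scalar: "nc_subst \<sigma> (scalar c) = scalar c"
  by (simp add: scalar_def nc_subst_single)

subsection \<open>The free algebra\<close>

lemma free_algebra_simps [simp]:
  "mult (free_algebra G) = (*)" "one (free_algebra G) = 1" "zero (free_algebra G) = 0"
  "add (free_algebra G) = (+)" "smult (free_algebra G) = (\<bullet>\<^sub>n\<^sub>c)"
  by (simp_all add: free_algebra_def)

lemma free_algebra_carrier: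
  "p \<in> carrier (free_algebra G) \<longleftrightarrow> (\<forall>m\<in>Poly_Mapping.keys p. set (letters m) \<subseteq> G)"
  by (simp add: free_algebra_def)

lemma free_algebra_0 [simp]: "0 \<in> carrier (free_algebra G)"
  by (simp add: free_algebra_carrier)

lemma free_algebra_1 [simp]: "1 \<in> carrier (free_algebra G)"
  by (simp add: free_algebra_carrier)

lemma free_algebra_add:
  "p \<in> carrier (free_algebra G) \<Longrightarrow> q \<in> carrier (free_algebra G) \<Longrightarrow> p + q \<in> carrier (free_algebra G)"
  using keys_add[of p q] by (auto simp: free_algebra_carrier)

lemma free_algebra_uminus: "p \<in> carrier (free_algebra G) \<Longrightarrow> - p \<in> carrier (free_algebra G)"
  by (simp add: free_algebra_carrier in_keys_iff)

lemma free_algebra_diff: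
  "p \<in> carrier (free_algebra G) \<Longrightarrow> q \<in> carrier (free_algebra G) \<Longrightarrow> p - q \<in> carrier (free_algebra G)"
  using free_algebra_add[of p G "- q"] free_algebra_uminus[of q G] by simp

lemma free_algebra_mult:
  "p \<in> carrier (free_algebra G) \<Longrightarrow> q \<in> carrier (free_algebra G) \<Longrightarrow> p * q \<in> carrier (free_algebra G)"
  using keys_mult[of p q] by (fastforce simp: free_algebra_carrier plus_free_mon_def)

lemma free_algebra_scalar [simp]: "scalar c \<in> carrier (free_algebra G)"
  by (simp add: free_algebra_carrier scalar_def)

lemma free_algebra_scale: "p \<in> carrier (free_algebra G) \<Longrightarrow> c \<bullet>\<^sub>n\<^sub>c p \<in> carrier (free_algebra G)"
  by (simp add: nc_scale_scalar free_algebra_mult)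

lemma free_algebra_var: "g \<in> G \<Longrightarrow> nc_var g \<in> carrier (free_algebra G)"
  by (simp add: free_algebra_carrier nc_var_def)

lemma free_algebra_sum:
  "(\<And>i. i \<in> I \<Longrightarrow> p i \<in> carrier (free_algebra G)) \<Longrightarrow> (\<Sum>i\<in>I. p i) \<in> carrier (free_algebra G)"
  by (induction I rule: infinite_finite_induct) (simp_all add: free_algebra_add)

lemma free_algebra_prod_list:
  "(\<And>x. x \<in> set xs \<Longrightarrow> x \<in> carrier (free_algebra G)) \<Longrightarrow> prod_list xs \<in> carrier (free_algebra G)"
  by (induction xs) (simp_all add: free_algebra_mult)

lemma ring_free_algebra: "ring (free_algebra G)"
proof (rule ringI)
  show "abelian_group (free_algebra G)"
  proof (rule abelian_groupI)
    fix x assume "x \<in> carrier (free_algebra G)"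
    then show "\<exists>y\<in>carrier (free_algebra G). y \<oplus>\<^bsub>free_algebra G\<^esub> x = \<zero>\<^bsub>free_algebra G\<^esub>"
      by (intro bexI[of _ "- x"]) (simp_all add: free_algebra_uminus)
  qed (simp_all add: free_algebra_add algebra_simps)
  show "monoid (free_algebra G)"
    by (rule monoidI) (simp_all add: free_algebra_mult mult.assoc)
qed (simp_all add: algebra_simps)

lemma nc_subst_carrier:
  assumes "\<And>g. g \<in> G \<Longrightarrow> \<sigma> g \<in> carrier (free_algebra H)" "p \<in> carrier (free_algebra G)"
  shows "nc_subst \<sigma> p \<in> carrier (free_algebra H)"
  unfolding nc_subst_def using assms
  by (intro free_algebra_sum free_algebra_mult free_algebra_prod_list)
     (auto simp: free_algebra_carrier[of p])

subsection \<open>Presented algebras\<close>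

lemma rel_ideal:
  assumes "R \<subseteq> carrier (free_algebra G)"
  shows "ideal (rel_ideal G R) (free_algebra G)" "R \<subseteq> rel_ideal G R"
  unfolding rel_ideal_def
  using ring.genideal_ideal[OF ring_free_algebra assms] ring.genideal_self[OF ring_free_algebra assms]
  by auto

lemma rel_ideal_minimal:
  assumes "R \<subseteq> carrier (free_algebra G)" "ideal I (free_algebra G)" "R \<subseteq> I"
  shows "rel_ideal G R \<subseteq> I"
  unfolding rel_ideal_def by (rule ring.genideal_minimal[OF ring_free_algebra assms(2,3)])

lemma rel_ideal_scale:
  assumes "R \<subseteq> carrier (free_algebra G)" "p \<in> rel_ideal G R"
  shows "c \<bullet>\<^sub>n\<^sub>c p \<in> rel_ideal G R"
  using ideal.I_l_closed[OF rel_ideal(1)[OF assms(1)] assms(2), of "scalar c"]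
  by (simp add: nc_scale_scalar)

lemma rel_ideal_0:
  assumes "R \<subseteq> carrier (free_algebra G)"
  shows "0 \<in> rel_ideal G R"
  using additive_subgroup.zero_closed[OF ideal.axioms(1)[OF rel_ideal(1)[OF assms]]] by simp

lemma rel_ideal_add:
  assumes "R \<subseteq> carrier (free_algebra G)" "p \<in> rel_ideal G R" "q \<in> rel_ideal G R"
  shows "p + q \<in> rel_ideal G R"
  using additive_subgroup.a_closed[OF ideal.axioms(1)[OF rel_ideal(1)[OF assms(1)]] assms(2,3)] by simp

lemma rel_ideal_sum:
  assumes "R \<subseteq> carrier (free_algebra G)" "\<And>i. i \<in> I \<Longrightarrow> p i \<in> rel_ideal G R"
  shows "(\<Sum>i\<in>I. p i) \<in> rel_ideal G R"
  using assms(2) by (induction I rule: infinite_finite_induct)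
    (auto intro: rel_ideal_0[OF assms(1)] rel_ideal_add[OF assms(1)])

lemma rel_class_eq: "rel_class G R p = {h + p | h. h \<in> rel_ideal G R}"
  by (auto simp: rel_class_def a_r_coset_def' )

lemma rel_class_eq_iff:
  assumes R: "R \<subseteq> carrier (free_algebra G)"
  shows "rel_class G R p = rel_class G R q \<longleftrightarrow> p - q \<in> rel_ideal G R"
proof -
  note 0 = rel_ideal_0[OF R] and add = rel_ideal_add[OF R]
  have neg: "- a \<in> rel_ideal G R" if "a \<in> rel_ideal G R" for a
    using rel_ideal_scale[OF R that, of "-1"] by (simp add: nc_scale_scalar scalar_uminus)
  show ?thesis
  proof
    assume "rel_class G R p = rel_class G R q"
    moreover have "p \<in> rel_class G R p" using 0 by (auto simp: rel_class_eq)
    ultimately obtain h where "h \<in> rel_ideal G R" "p = h + q" by (auto simp: rel_class_eq)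
    then show "p - q \<in> rel_ideal G R" by simp
  next
    assume *: "p - q \<in> rel_ideal G R"
    show "rel_class G R p = rel_class G R q"
    proof (intro equalityI subsetI)
      fix x assume "x \<in> rel_class G R p"
      then obtain h where "h \<in> rel_ideal G R" "x = h + p" by (auto simp: rel_class_eq)
      then show "x \<in> rel_class G R q"
        using add[OF _ *] unfolding rel_class_eq by (intro CollectI exI[of _ "h + (p - q)"]) simp
    next
      fix x assume "x \<in> rel_class G R q"
      then obtain h where "h \<in> rel_ideal G R" "x = h + q" by (auto simp: rel_class_eq)
      then show "x \<in> rel_class G R p"
        using add[OF _ neg[OF *]] unfolding rel_class_eq by (intro CollectI exI[of _ "h + - (p - q)"]) simp
    qed
  qed
qed

lemma presented_algebra_simps:
  "carrier (presented_algebra G R) = carrier (free_algebra G Quot rel_ideal G R)"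
  "mult (presented_algebra G R) = mult (free_algebra G Quot rel_ideal G R)"
  "add (presented_algebra G R) = add (free_algebra G Quot rel_ideal G R)"
  "one (presented_algebra G R) = one (free_algebra G Quot rel_ideal G R)"
  "zero (presented_algebra G R) = zero (free_algebra G Quot rel_ideal G R)"
  "smult (presented_algebra G R) = (\<lambda>c X. \<Union>p\<in>X. rel_class G R (c \<bullet>\<^sub>n\<^sub>c p))"
  by (simp_all add: presented_algebra_def ring.defs module.defs)

lemma presented_algebra_carrier:
  "X \<in> carrier (presented_algebra G R) \<longleftrightarrow> (\<exists>p\<in>carrier (free_algebra G). X = rel_class G R p)"
  by (auto simp: presented_algebra_simps FactRing_def A_RCOSETS_def' rel_class_def)

context
  fixes G :: "'g set" and R
  assumes R: "R \<subseteq> carrier (free_algebra G)"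
begin

lemma rel_class_hom: "rel_class G R \<in> Ring.ring_hom (free_algebra G) (free_algebra G Quot rel_ideal G R)"
  using ideal.rcos_ring_hom[OF rel_ideal(1)[OF R]] by (simp add: rel_class_def[abs_def])

lemma rel_class_mult:
  "p \<in> carrier (free_algebra G) \<Longrightarrow> q \<in> carrier (free_algebra G) \<Longrightarrow>
    rel_class G R p \<otimes>\<^bsub>presented_algebra G R\<^esub> rel_class G R q = rel_class G R (p * q)"
  using ring_hom_mult[OF rel_class_hom] by (simp add: presented_algebra_simps)

lemma rel_class_add:
  "p \<in> carrier (free_algebra G) \<Longrightarrow> q \<in> carrier (free_algebra G) \<Longrightarrow>
    rel_class G R p \<oplus>\<^bsub>presented_algebra G R\<^esub> rel_class G R q = rel_class G R (p + q)"
  using ring_hom_add[OF rel_class_hom] by (simp add: presented_algebra_simps)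

lemma rel_class_one: "\<one>\<^bsub>presented_algebra G R\<^esub> = rel_class G R 1"
  using ring_hom_one[OF rel_class_hom] by (simp add: presented_algebra_simps)

lemma rel_class_zero: "\<zero>\<^bsub>presented_algebra G R\<^esub> = rel_class G R 0"
  using ring_hom_zero[OF rel_class_hom ring_free_algebra ideal.quotient_is_ring[OF rel_ideal(1)[OF R]]]
  by (simp add: presented_algebra_simps)

lemma rel_class_smult: "c \<odot>\<^bsub>presented_algebra G R\<^esub> rel_class G R p = rel_class G R (c \<bullet>\<^sub>n\<^sub>c p)"
proof -
  have *: "rel_class G R (c \<bullet>\<^sub>n\<^sub>c x) = rel_class G R (c \<bullet>\<^sub>n\<^sub>c p)" if "x \<in> rel_class G R p" for x
    using that rel_ideal_scale[OF R] unfolding rel_class_eq_iff[OF R]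
    by (auto simp: rel_class_eq nc_scale_scalar distrib_left)
  have p: "p \<in> rel_class G R p"
    using rel_class_eq_iff[OF R, of p p] by (auto simp: rel_class_eq)
  show ?thesis
    unfolding presented_algebra_simps using p * by blast
qed

lemma rel_class_finsum:
  assumes "finite I" "\<And>i. i \<in> I \<Longrightarrow> p i \<in> carrier (free_algebra G)"
  shows "(\<Oplus>\<^bsub>presented_algebra G R\<^esub>i\<in>I. rel_class G R (p i)) = rel_class G R (\<Sum>i\<in>I. p i)"
proof -
  let ?Q = "free_algebra G Quot rel_ideal G R"
  interpret Q: ring ?Q by (rule ideal.quotient_is_ring[OF rel_ideal(1)[OF R]])
  have fs: "finsum (presented_algebra G R) = finsum ?Q"
    by (intro ext) (simp add: finsum_def finprod_def presented_algebra_simps)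
  have c: "rel_class G R q \<in> carrier ?Q" if "q \<in> carrier (free_algebra G)" for q
    using ring_hom_closed[OF rel_class_hom that] .
  show ?thesis
    using assms unfolding fs
  proof (induction I)
    case empty
    show ?case using rel_class_zero by (simp add: presented_algebra_simps)
  next
    case (insert x F)
    then have "finsum ?Q (\<lambda>i. rel_class G R (p i)) (insert x F)
      = rel_class G R (p x) \<oplus>\<^bsub>?Q\<^esub> rel_class G R (\<Sum>i\<in>F. p i)"
      using c by (subst Q.finsum_insert) auto
    also have "\<dots> = rel_class G R (p x + (\<Sum>i\<in>F. p i))"
      using insert.prems by (simp add: presented_algebra_simps free_algebra_sum flip: rel_class_add)
    finally show ?case using insert.hyps by simp
  qed
qed

end

text \<open>The preimage of the ideal of \<open>S\<close> under the substitution is an ideal containing \<open>R\<close>, hence contains the ideal of \<open>R\<close>.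
  The homomorphism is therefore well defined by any choice of representatives.\<close>

theorem presented_algebra_hom:
  assumes R: "R \<subseteq> carrier (free_algebra G)" and S: "S \<subseteq> carrier (free_algebra H)"
    and \<sigma>: "\<And>g. g \<in> G \<Longrightarrow> \<sigma> g \<in> carrier (free_algebra H)"
    and rel: "\<And>r. r \<in> R \<Longrightarrow> nc_subst \<sigma> r \<in> rel_ideal H S"
  obtains \<Psi> where "\<Psi> \<in> algebra_hom (presented_algebra G R) (presented_algebra H S)"
    "\<And>p. p \<in> carrier (free_algebra G) \<Longrightarrow> \<Psi> (rel_class G R p) = rel_class H S (nc_subst \<sigma> p)"
proof -
  interpret H: ideal "rel_ideal H S" "free_algebra H" by (rule rel_ideal(1)[OF S])
  have sub: "nc_subst \<sigma> p \<in> carrier (free_algebra H)" if "p \<in> carrier (free_algebra G)" for p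
    using nc_subst_carrier[of G \<sigma> H] \<sigma> that by blast
  have "(nc_subst \<sigma>) \<in> Ring.ring_hom (free_algebra G) (free_algebra H)"
    by (rule ring_hom_memI) (simp_all add: sub nc_subst_mult nc_subst_add)
  then interpret h: ring_hom_ring "free_algebra G" "free_algebra H" "nc_subst \<sigma>"
    by (intro ring_hom_ringI2 ring_free_algebra)
  have "ideal {p \<in> carrier (free_algebra G). nc_subst \<sigma> p \<in> rel_ideal H S} (free_algebra G)"
    by (rule h.ideal_vimage[OF rel_ideal(1)[OF S]])
  then have "rel_ideal G R \<subseteq> {p \<in> carrier (free_algebra G). nc_subst \<sigma> p \<in> rel_ideal H S}"
    by (rule rel_ideal_minimal[OF R]) (use R rel in auto)
  then have I: "nc_subst \<sigma> p \<in> rel_ideal H S" if "p \<in> rel_ideal G R" for p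
    using that by blast
  define \<Psi> where "\<Psi> X = rel_class H S (nc_subst \<sigma> (SOME p. p \<in> X))" for X
  have \<Psi>: "\<Psi> (rel_class G R p) = rel_class H S (nc_subst \<sigma> p)" for p
  proof -
    have "p \<in> rel_class G R p"
      using rel_class_eq_iff[OF R, of p p] by (auto simp: rel_class_eq)
    then have "(SOME q. q \<in> rel_class G R p) \<in> rel_class G R p" by (rule someI)
    then obtain h where "h \<in> rel_ideal G R" "(SOME q. q \<in> rel_class G R p) = h + p"
      by (auto simp: rel_class_eq)
    then show ?thesis
      using I[of h] by (simp add: \<Psi>_def rel_class_eq_iff[OF S] nc_subst_add)
  qed
  have "\<Psi> \<in> algebra_hom (presented_algebra G R) (presented_algebra H S)"
    unfolding algebra_hom_def
  proof (intro CollectI conjI ring_hom_memI allI ballI)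
    fix X assume "X \<in> carrier (presented_algebra G R)"
    then obtain p where p: "p \<in> carrier (free_algebra G)" "X = rel_class G R p"
      by (auto simp: presented_algebra_carrier)
    show "\<Psi> X \<in> carrier (presented_algebra H S)"
      using p sub by (auto simp: presented_algebra_carrier \<Psi>)
    show "\<Psi> (c \<odot>\<^bsub>presented_algebra G R\<^esub> X) = c \<odot>\<^bsub>presented_algebra H S\<^esub> \<Psi> X" for c
      by (simp add: p \<Psi> rel_class_smult[OF R] rel_class_smult[OF S] nc_subst_scale)
    fix Y assume "Y \<in> carrier (presented_algebra G R)"
    then obtain q where q: "q \<in> carrier (free_algebra G)" "Y = rel_class G R q"
      by (auto simp: presented_algebra_carrier)
    show "\<Psi> (X \<otimes>\<^bsub>presented_algebra G R\<^esub> Y) = \<Psi> X \<otimes>\<^bsub>presented_algebra H S\<^esub> \<Psi> Y"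
      by (simp add: p q \<Psi> sub rel_class_mult[OF R] rel_class_mult[OF S] nc_subst_mult)
    show "\<Psi> (X \<oplus>\<^bsub>presented_algebra G R\<^esub> Y) = \<Psi> X \<oplus>\<^bsub>presented_algebra H S\<^esub> \<Psi> Y"
      by (simp add: p q \<Psi> sub rel_class_add[OF R] rel_class_add[OF S] nc_subst_add)
  next
    show "\<Psi> \<one>\<^bsub>presented_algebra G R\<^esub> = \<one>\<^bsub>presented_algebra H S\<^esub>"
      by (simp add: rel_class_one[OF R] rel_class_one[OF S] \<Psi>)
  qed
  with \<Psi> show ?thesis using that by blast
qed

section \<open>The functions \<open>\<theta>\<^sub>\<alpha>\<close>\<close>

definition theta_prod :: "complex \<Rightarrow> nat \<Rightarrow> complex \<Rightarrow> complex" where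
  "theta_prod \<tau> n z = (\<Prod>m<n. theta \<tau> (z + of_nat m / of_nat n))"

lemma theta_idx_eq:
  "theta_idx \<tau> n \<alpha> z = theta_prod \<tau> n (z + of_int \<alpha> / of_nat n * \<tau>) *
    e2pi (of_int \<alpha> * z + of_int (\<alpha> * (\<alpha> - int n)) / (2 * of_nat n) * \<tau> + of_int \<alpha> / (2 * of_nat n))"
  by (simp add: theta_idx_def theta_prod_def)

lemma theta_prod_shift:
  assumes "n > 0" shows "theta_prod \<tau> n (z + 1 / of_nat n) = theta_prod \<tau> n z"
proof -
  obtain n' where n': "n = Suc n'" using assms gr0_implies_Suc by blast
  have "theta_prod \<tau> n (z + 1 / of_nat n) = (\<Prod>m<n. theta \<tau> (z + of_nat (Suc m) / of_nat n))"
    unfolding theta_prod_def by (intro prod.cong) (simp_all add: add_divide_distrib add_ac)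
  also have "\<dots> = (\<Prod>m<n'. theta \<tau> (z + of_nat (Suc m) / of_nat n)) * theta \<tau> (z + of_nat n / of_nat n)"
    by (simp only: n' prod.lessThan_Suc)
  also have "z + of_nat n / of_nat n = z + 1"
    using assms by simp
  also have "(\<Prod>m<n'. theta \<tau> (z + of_nat (Suc m) / of_nat n)) * theta \<tau> (z + 1) = theta_prod \<tau> n z"
    unfolding theta_prod_def n' prod.lessThan_Suc_shift by (simp add: theta_plus_1 mult.commute)
  finally show ?thesis .
qed

lemma sum_of_nat_lessThan: "(\<Sum>m<n. of_nat m :: complex) = of_nat n * (of_nat n - 1) / 2"
  by (induction n) (simp_all add: field_simps)

lemma e2pi_sum: "e2pi (\<Sum>i\<in>I. f i) = (\<Prod>i\<in>I. e2pi (f i))"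
  by (induction I rule: infinite_finite_induct) (simp_all add: e2pi_add)

lemma theta_prod_plus_tau:
  assumes "n > 0"
  shows "theta_prod \<tau> n (z + \<tau>) = - e2pi (- of_nat n * z) * theta_prod \<tau> n z"
proof -
  have "theta_prod \<tau> n (z + \<tau>) = (\<Prod>m<n. - e2pi (- (z + of_nat m / of_nat n)) * theta \<tau> (z + of_nat m / of_nat n))"
  proof -
    have "theta \<tau> (z + \<tau> + x) = - e2pi (- (z + x)) * theta \<tau> (z + x)" for x
      using theta_plus_tau[of \<tau> "z + x"] by (simp add: add_ac)
    then show ?thesis unfolding theta_prod_def by simp
  qed
  also have "\<dots> = (\<Prod>m<n. - e2pi (- (z + of_nat m / of_nat n))) * theta_prod \<tau> n z"
    unfolding theta_prod_def by (rule prod.distrib)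
  also have "(\<Prod>m<n. - e2pi (- (z + of_nat m / of_nat n))) = (\<Prod>m<n. e2pi (1/2 - (z + of_nat m / of_nat n)))"
  proof -
    have "e2pi (1 / 2 - x) = - e2pi (- x)" for x
      using e2pi_add[of "1 / 2" "- x"] by simp
    then show ?thesis by (simp only:)
  qed
  also have "\<dots> = e2pi (\<Sum>m<n. 1/2 - (z + of_nat m / of_nat n))"
    by (rule e2pi_sum[symmetric])
  also have "(\<Sum>m<n. 1/2 - (z + of_nat m / of_nat n)) = of_nat n / 2 - (of_nat n * z + (\<Sum>m<n. of_nat m :: complex) / of_nat n)"
    by (simp add: sum_subtractf sum.distrib sum_divide_distrib)
  also have "\<dots> = - of_nat n * z + 1 / 2"
    unfolding sum_of_nat_lessThan using assms by (simp add: field_simps)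
  finally show ?thesis unfolding e2pi_add e2pi_half by simp
qed

lemma periodic_mod:
  fixes f :: "int \<Rightarrow> 'b"
  assumes "\<And>i. f (i + int n) = f i"
  shows "f (i mod int n) = f i"
proof -
  have "f (j + int n * m) = f j" for j m
  proof (induction m rule: int_induct[of _ 0])
    case (step1 m)
    then show ?case using assms[of "j + int n * m"] by (simp add: algebra_simps)
  next
    case (step2 m)
    then show ?case using assms[of "j + int n * (m - 1)"] by (simp add: algebra_simps)
  qed simp
  from this[of "i mod int n" "i div int n"] show ?thesis by simp
qed

lemma sum_shift_periodic:
  fixes f :: "int \<Rightarrow> 'b :: comm_monoid_add"
  assumes n: "n > 0" and f: "\<And>i. f (i + int n) = f i"
  shows "(\<Sum>i\<in>{0..<int n}. f (i + r)) = (\<Sum>i\<in>{0..<int n}. f i)"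
proof -
  have m: "f ((i + c) mod int n) = f (i + c)" for i c by (rule periodic_mod[of f, OF f])
  have "(\<Sum>i\<in>{0..<int n}. f (i + r)) = (\<Sum>i\<in>{0..<int n}. f i)"
    by (rule sum.reindex_bij_witness[of _ "\<lambda>i. (i - r) mod int n" "\<lambda>i. (i + r) mod int n"])
      (use n m in \<open>auto simp: mod_simps\<close>)
  then show ?thesis .
qed

context
  fixes \<tau> :: complex and n :: nat
  assumes \<tau>: "Im \<tau> > 0" and n: "n > 0"
begin

lemma theta_idx_plus_inverse:
  "theta_idx \<tau> n \<alpha> (z + 1 / of_nat n) = e2pi (of_int \<alpha> / of_nat n) * theta_idx \<tau> n \<alpha> z"
proof -
  have 1: "z + 1 / of_nat n + of_int \<alpha> / of_nat n * \<tau> = (z + of_int \<alpha> / of_nat n * \<tau>) + 1 / of_nat n"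
    by simp
  have 2: "of_int \<alpha> * (z + 1 / of_nat n) + of_int (\<alpha> * (\<alpha> - int n)) / (2 * of_nat n) * \<tau> + of_int \<alpha> / (2 * of_nat n)
    = of_int \<alpha> / of_nat n +
      (of_int \<alpha> * z + of_int (\<alpha> * (\<alpha> - int n)) / (2 * of_nat n) * \<tau> + of_int \<alpha> / (2 * of_nat n))"
    by (simp add: distrib_left)
  show ?thesis
    unfolding theta_idx_eq 1 2 theta_prod_shift[OF n] e2pi_add[of "of_int \<alpha> / of_nat n"] by simp
qed

lemma theta_idx_plus_tau_div:
  "theta_idx \<tau> n \<alpha> (z + \<tau> / of_nat n) =
    e2pi (- z + (of_nat n - 1) / (2 * of_nat n) * \<tau> - 1 / (2 * of_nat n)) * theta_idx \<tau> n (\<alpha> + 1) z"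
proof -
  have 1: "z + \<tau> / of_nat n + of_int \<alpha> / of_nat n * \<tau> = z + of_int (\<alpha> + 1) / of_nat n * \<tau>"
    by (simp add: add_divide_distrib distrib_right)
  have 2: "of_int \<alpha> * (z + \<tau> / of_nat n) + of_int (\<alpha> * (\<alpha> - int n)) / (2 * of_nat n) * \<tau> + of_int \<alpha> / (2 * of_nat n)
    = (- z + (of_nat n - 1) / (2 * of_nat n) * \<tau> - 1 / (2 * of_nat n)) +
      (of_int (\<alpha> + 1) * z + of_int ((\<alpha> + 1) * (\<alpha> + 1 - int n)) / (2 * of_nat n) * \<tau> + of_int (\<alpha> + 1) / (2 * of_nat n))"
    using n by (simp add: divide_simps) (simp add: algebra_simps)
  show ?thesis
    unfolding theta_idx_eq 1 2 e2pi_add[of "- z + (of_nat n - 1) / (2 * of_nat n) * \<tau> - 1 / (2 * of_nat n)"]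
    by (simp add: mult_ac)
qed

lemma theta_idx_periodic: "theta_idx \<tau> n (\<alpha> + int n) z = theta_idx \<tau> n \<alpha> z"
proof -
  define w where "w = z + of_int \<alpha> / of_nat n * \<tau>"
  have 1: "z + of_int (\<alpha> + int n) / of_nat n * \<tau> = w + \<tau>"
    using n by (simp add: w_def add_divide_distrib distrib_right)
  have 2: "of_int (\<alpha> + int n) * z + of_int ((\<alpha> + int n) * (\<alpha> + int n - int n)) / (2 * of_nat n) * \<tau> + of_int (\<alpha> + int n) / (2 * of_nat n)
    = of_nat n * w + 1 / 2 +
      (of_int \<alpha> * z + of_int (\<alpha> * (\<alpha> - int n)) / (2 * of_nat n) * \<tau> + of_int \<alpha> / (2 * of_nat n))"
    unfolding w_def using n by (simp add: divide_simps) (simp add: algebra_simps)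
  have 3: "- e2pi (- of_nat n * w) * e2pi (of_nat n * w + 1 / 2) = 1"
    by (simp add: e2pi_add e2pi_minus)
  have 4: "- a * P * (b * e) = (- a * b) * (P * e)" for a b P e :: complex
    by simp
  show ?thesis
    unfolding theta_idx_eq 1 2 theta_prod_plus_tau[OF n] e2pi_add[of "of_nat n * w + 1 / 2"]
    unfolding w_def[symmetric] by (subst 4, subst 3, simp)
qed

lemma theta_idx_mod: "theta_idx \<tau> n (\<alpha> mod int n) z = theta_idx \<tau> n \<alpha> z"
  by (rule periodic_mod[of "\<lambda>\<alpha>. theta_idx \<tau> n \<alpha> z"]) (rule theta_idx_periodic)

lemma theta_idx_cong: "\<alpha> mod int n = \<beta> mod int n \<Longrightarrow> theta_idx \<tau> n \<alpha> z = theta_idx \<tau> n \<beta> z"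
  using theta_idx_mod by metis

lemma theta_idx_holomorphic: "theta_idx \<tau> n \<alpha> holomorphic_on UNIV"
  unfolding theta_idx_def[abs_def]
  by (intro holomorphic_intros theta_holomorphic' \<tau>)

lemma theta_idx_zero:
  assumes "theta_idx \<tau> n \<alpha> z = 0"
  shows "of_nat n * z \<in> period_lattice \<tau>"
proof -
  obtain m where "m < n" "theta \<tau> (z + of_int \<alpha> / of_nat n * \<tau> + of_nat m / of_nat n) = 0"
    using assms by (auto simp: theta_idx_def)
  then obtain a b :: int where "z + of_int \<alpha> / of_nat n * \<tau> + of_nat m / of_nat n = of_int a + of_int b * \<tau>"
    by (auto simp: theta_eq_0_iff[OF \<tau>] period_lattice_def)
  then have "of_nat n * z = of_int (int n * a - int m) + of_int (int n * b - \<alpha>) * \<tau>"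
    using n by (simp add: field_simps)
  then show ?thesis by (rule period_lattice_eqI)
qed

lemma theta_idx_0_0: "theta_idx \<tau> n 0 0 = 0"
  using n by (auto simp: theta_idx_def intro!: bexI[of _ 0])

lemma theta_idx_nonzero_at_0:
  assumes "0 < \<alpha>" "\<alpha> < int n"
  shows "theta_idx \<tau> n \<alpha> 0 \<noteq> 0"
proof
  assume "theta_idx \<tau> n \<alpha> 0 = 0"
  then obtain m where "m < n" "theta \<tau> (of_int \<alpha> / of_nat n * \<tau> + of_nat m / of_nat n) = 0"
    by (auto simp: theta_idx_def)
  then obtain a b :: int where "of_int \<alpha> / of_nat n * \<tau> + of_nat m / of_nat n = of_int a + of_int b * \<tau>"
    by (auto simp: theta_eq_0_iff[OF \<tau>] period_lattice_def)
  then have "of_int \<alpha> * \<tau> + of_nat m = of_nat n * of_int a + of_nat n * of_int b * \<tau>"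
    using n by (simp add: field_simps)
  then have "Im (of_int \<alpha> * \<tau> + of_nat m) = Im (of_nat n * of_int a + of_nat n * of_int b * \<tau>)"
    by simp
  then have "of_int \<alpha> = real n * of_int b"
    using \<tau> by (simp add: mult.assoc)
  then have "\<alpha> = int n * b"
    by (metis of_int_eq_iff of_int_mult of_int_of_nat_eq)
  with assms show False
    by (metis dvd_triv_left zdvd_not_zless)
qed

text \<open>The left coefficients of the relations of \<open>Z\<close> are made of values of this product; the comparison with
  \<open>\<theta>(n z)\<close> below brings them to the form of the coefficients of \<open>Y\<close>.\<close>

definition theta_Omega :: "complex \<Rightarrow> complex" where
  "theta_Omega z = (\<Prod>i\<in>{0..<int n}. theta_idx \<tau> n i z)"

lemma theta_Omega_holomorphic: "theta_Omega holomorphic_on UNIV"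
  unfolding theta_Omega_def[abs_def] by (intro holomorphic_intros theta_idx_holomorphic)

lemma prod_shift_mod:
  assumes "\<And>i :: int. f (i + int n) = f i"
  shows "(\<Prod>i\<in>{0..<int n}. f (i + 1)) = (\<Prod>i\<in>{0..<int n}. f i :: complex)"
proof -
  have "{0..<int n} = insert 0 {1..<int n}" "{1..<int n + 1} = insert (int n) {1..<int n}"
    using n by auto
  then have "(\<Prod>i\<in>{0..<int n}. f i) = (\<Prod>i\<in>{1..<int n + 1}. f i)"
    using assms[of 0] by simp
  also have "\<dots> = (\<Prod>i\<in>{0..<int n}. f (i + 1))"
    by (rule prod.reindex_bij_witness[of _ "\<lambda>i. i + 1" "\<lambda>i. i - 1"]) auto
  finally show ?thesis by simp
qed

lemma sum_of_int_atLeastLessThan: "(\<Sum>i\<in>{0..<int n}. of_int i :: complex) = of_nat n * (of_nat n - 1) / 2"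
proof -
  have "(\<Sum>i\<in>{0..<int n}. of_int i :: complex) = (\<Sum>m<n. of_nat m)"
    by (rule sum.reindex_bij_witness[of _ int nat]) auto
  then show ?thesis by (simp add: sum_of_nat_lessThan)
qed

lemma theta_Omega_plus_inverse:
  "theta_Omega (z + 1 / of_nat n) = e2pi ((of_nat n - 1) / 2) * theta_Omega z"
proof -
  have "theta_Omega (z + 1 / of_nat n) = (\<Prod>i\<in>{0..<int n}. e2pi (of_int i / of_nat n)) * theta_Omega z"
    unfolding theta_Omega_def theta_idx_plus_inverse by (simp add: prod.distrib)
  also have "(\<Prod>i\<in>{0..<int n}. e2pi (of_int i / of_nat n)) = e2pi ((\<Sum>i\<in>{0..<int n}. of_int i) / of_nat n)"
    by (simp add: e2pi_sum sum_divide_distrib)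
  also have "(\<Sum>i\<in>{0..<int n}. of_int i :: complex) / of_nat n = (of_nat n - 1) / 2"
    unfolding sum_of_int_atLeastLessThan using n by simp
  finally show ?thesis .
qed

lemma theta_Omega_plus_tau_div:
  "theta_Omega (z + \<tau> / of_nat n) = - e2pi (- of_nat n * z + (of_nat n - 1) / 2 * \<tau>) * theta_Omega z"
proof -
  let ?x = "- z + (of_nat n - 1) / (2 * of_nat n) * \<tau> - 1 / (2 * of_nat n)"
  have "theta_Omega (z + \<tau> / of_nat n) = e2pi ?x ^ n * (\<Prod>i\<in>{0..<int n}. theta_idx \<tau> n (i + 1) z)"
    unfolding theta_Omega_def theta_idx_plus_tau_div by (simp add: prod.distrib)
  also have "(\<Prod>i\<in>{0..<int n}. theta_idx \<tau> n (i + 1) z) = theta_Omega z"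
    unfolding theta_Omega_def by (rule prod_shift_mod) (rule theta_idx_periodic)
  also have "e2pi ?x ^ n = e2pi (of_nat n * ?x)" by (rule e2pi_power)
  also have "of_nat n * ?x = - of_nat n * z + (of_nat n - 1) / 2 * \<tau> - 1 / 2"
    using n by (simp add: field_simps)
  finally show ?thesis by (simp add: e2pi_diff)
qed

text \<open>Both sides vanish on \<open>1/n \<Gamma>\<close> and have the same quasi-periods, so the quotient is entire and doubly periodic,
  hence constant. The quotient is formed after the substitution of \<open>z / n\<close> for \<open>z\<close>.\<close>

lemma theta_Omega_eq:
  obtains C where "C \<noteq> 0"
    "\<And>z. theta_Omega z = C * theta \<tau> (of_nat n * z) * e2pi (of_nat n * (of_nat n - 1) / 2 * z)"
proof -
  define Q where "Q z = theta_Omega (z / of_nat n) * e2pi (- (of_nat n - 1) / 2 * z)" for z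
  have hol: "Q holomorphic_on UNIV"
  proof -
    have "(\<lambda>z. theta_Omega (z / of_nat n)) holomorphic_on UNIV"
      using holomorphic_on_compose_gen[OF _ theta_Omega_holomorphic, of "\<lambda>z. z / of_nat n" UNIV] n
      by (simp add: o_def holomorphic_on_divide holomorphic_on_ident)
    then show ?thesis unfolding Q_def by (intro holomorphic_intros)
  qed
  have Q1: "Q (z + 1) = Q z" for z
  proof -
    have "Q (z + 1) = (e2pi ((of_nat n - 1) / 2) * e2pi (- (of_nat n - 1) / 2)) * Q z"
    proof -
      have x: "- (of_nat n - 1) / 2 * (z + 1) = - (of_nat n - 1) / 2 * z + - (of_nat n - 1) / 2"
        by (simp add: distrib_left)
      show ?thesis
        unfolding Q_def add_divide_distrib[of z] theta_Omega_plus_inverse x e2pi_add by simp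
    qed
    also have "e2pi ((of_nat n - 1) / 2) * e2pi (- (of_nat n - 1) / 2) = 1"
    proof -
      have "(of_nat n - 1) / 2 + - (of_nat n - 1) / 2 = (0 :: complex)"
        by (simp flip: add_divide_distrib)
      then show ?thesis by (simp only: e2pi_0 e2pi_add[symmetric])
    qed
    finally show ?thesis by simp
  qed
  have Q2: "Q (z + \<tau>) = - e2pi (- z) * Q z" for z
  proof -
    have "Q (z + \<tau>) = - (e2pi (- of_nat n * (z / of_nat n) + (of_nat n - 1) / 2 * \<tau>) * e2pi (- (of_nat n - 1) / 2 * \<tau>)) * Q z"
    proof -
      have x: "- (of_nat n - 1) / 2 * (z + \<tau>) = - (of_nat n - 1) / 2 * z + - (of_nat n - 1) / 2 * \<tau>"
        by (simp add: distrib_left)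
      show ?thesis
        unfolding Q_def add_divide_distrib[of z] theta_Omega_plus_tau_div x
          e2pi_add[of "- (of_nat n - 1) / 2 * z"] by simp
    qed
    also have "e2pi (- of_nat n * (z / of_nat n) + (of_nat n - 1) / 2 * \<tau>) * e2pi (- (of_nat n - 1) / 2 * \<tau>) = e2pi (- z)"
    proof -
      have "- of_nat n * (z / of_nat n) + (of_nat n - 1) / 2 * \<tau> + - (of_nat n - 1) / 2 * \<tau> = - z"
        using n by (simp add: field_simps)
      then show ?thesis by (simp only: e2pi_add[symmetric])
    qed
    finally show ?thesis by simp
  qed
  have Q0: "Q 0 = 0"
    using n by (auto simp: Q_def theta_Omega_def theta_idx_0_0 intro!: bexI[of _ 0])
  have "Q z = 0" if "z \<in> period_lattice \<tau>" for z
    using that by (induction rule: lattice_induct) (simp_all add: Q0 Q1 Q2)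
  then obtain E where E: "E holomorphic_on UNIV" "\<And>z. Q z = theta \<tau> z * E z"
    using entire_divide_theta[OF \<tau> hol] by blast
  have Eh: "(\<lambda>z. E (z + h)) holomorphic_on UNIV" for h
    using holomorphic_on_compose_gen[OF _ E(1), of "\<lambda>z. z + h" UNIV]
    by (simp add: o_def holomorphic_on_add holomorphic_on_ident)
  have E1: "E (z + 1) = E z" for z
  proof (rule theta_mult_cancel[OF \<tau> Eh E(1)])
    show "theta \<tau> z * E (z + 1) = theta \<tau> z * E z" for z
      using E(2)[of z] E(2)[of "z + 1"] unfolding Q1 theta_plus_1 by metis
  qed
  have E2: "E (z + \<tau>) = 1 * E z" for z
    unfolding mult_1
  proof (rule theta_mult_cancel[OF \<tau> Eh E(1)])
    have "- e2pi (- z) * (theta \<tau> z * E (z + \<tau>)) = - e2pi (- z) * (theta \<tau> z * E z)" for z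
      using E(2)[of z] E(2)[of "z + \<tau>"] unfolding Q2 theta_plus_tau by (metis mult.assoc)
    then show "theta \<tau> z * E (z + \<tau>) = theta \<tau> z * E z" for z
      by simp
  qed
  obtain c and m :: int where c: "\<And>z. E z = c * e2pi (of_int m * z)" "c = 0 \<or> 1 = e2pi (of_int m * \<tau>)"
    using entire_quasi_periodic[OF \<tau> E(1) E1 E2] by metis
  obtain a where a: "theta \<tau> a \<noteq> 0" using theta_not_identically_zero[OF \<tau>] by blast
  have c0: "c \<noteq> 0"
  proof
    assume "c = 0"
    then have "Q (of_nat n * (a / of_nat n)) = 0" using c by (simp add: E)
    then obtain i where "theta_idx \<tau> n i (a / of_nat n) = 0"
      using n by (auto simp: Q_def theta_Omega_def)
    then have "a \<in> period_lattice \<tau>" using theta_idx_zero n by fastforce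
    with a show False by (simp add: theta_lattice)
  qed
  with c have "of_int m * \<tau> \<in> \<int>" by (metis e2pi_eq_1_iff)
  then obtain j :: int where "of_int m * \<tau> = of_int j" by (auto elim: Ints_cases)
  then have "Im (of_int m * \<tau>) = Im (of_int j)" by simp
  then have "m = 0" using \<tau> by simp
  then have Qc: "Q z = c * theta \<tau> z" for z by (simp add: E c)
  show ?thesis
  proof (rule that[OF c0])
    fix z
    have "- (of_nat n - 1) / 2 * (of_nat n * z) + of_nat n * (of_nat n - 1) / 2 * z = (0 :: complex)"
      by (simp add: field_simps)
    then have "e2pi (- (of_nat n - 1) / 2 * (of_nat n * z)) * e2pi (of_nat n * (of_nat n - 1) / 2 * z) = 1"
      by (simp only: e2pi_0 e2pi_add[symmetric])
    then have "theta_Omega z = Q (of_nat n * z) * e2pi (of_nat n * (of_nat n - 1) / 2 * z)"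
      using n unfolding Q_def by (simp only: mult.assoc) simp
    then show "theta_Omega z = c * theta \<tau> (of_nat n * z) * e2pi (of_nat n * (of_nat n - 1) / 2 * z)"
      by (simp add: Qc)
  qed
qed

definition theta_const :: complex where
  "theta_const = (SOME C. C \<noteq> 0 \<and>
    (\<forall>z. theta_Omega z = C * theta \<tau> (of_nat n * z) * e2pi (of_nat n * (of_nat n - 1) / 2 * z)))"

lemma theta_const_nonzero: "theta_const \<noteq> 0"
  and theta_Omega_theta:
    "theta_Omega z = theta_const * theta \<tau> (of_nat n * z) * e2pi (of_nat n * (of_nat n - 1) / 2 * z)"
proof -
  have "\<exists>C. C \<noteq> 0 \<and>
    (\<forall>z. theta_Omega z = C * theta \<tau> (of_nat n * z) * e2pi (of_nat n * (of_nat n - 1) / 2 * z))"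
    using theta_Omega_eq by metis
  from someI_ex[OF this] show "theta_const \<noteq> 0"
    "theta_Omega z = theta_const * theta \<tau> (of_nat n * z) * e2pi (of_nat n * (of_nat n - 1) / 2 * z)"
    unfolding theta_const_def by blast+
qed

text \<open>This is \<open>\<theta>(n z) / \<theta>\<^sub>j(z)\<close> (\<open>theta_idx_times_cofactor\<close>), written as an entire function. It expresses the
  coefficients of the relations of \<open>Z\<close> without denominators, uniformly in \<open>\<eta>\<close>.\<close>

definition theta_cofactor :: "int \<Rightarrow> complex \<Rightarrow> complex" where
  "theta_cofactor j z = (\<Prod>i\<in>{0..<int n} - {j mod int n}. theta_idx \<tau> n i z) *
     e2pi (- (of_nat n * (of_nat n - 1) / 2 * z)) / theta_const"

lemma theta_cofactor_holomorphic: "theta_cofactor j holomorphic_on UNIV"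
  unfolding theta_cofactor_def[abs_def]
  by (intro holomorphic_intros theta_idx_holomorphic) (simp add: theta_const_nonzero)

lemma theta_cofactor_cong: "i mod int n = j mod int n \<Longrightarrow> theta_cofactor i z = theta_cofactor j z"
  by (simp add: theta_cofactor_def)

lemma theta_idx_times_cofactor: "theta_idx \<tau> n j z * theta_cofactor j z = theta \<tau> (of_nat n * z)"
proof -
  have "j mod int n \<in> {0..<int n}" using n by simp
  then have "theta_Omega z = theta_idx \<tau> n (j mod int n) z * (\<Prod>i\<in>{0..<int n} - {j mod int n}. theta_idx \<tau> n i z)"
    unfolding theta_Omega_def by (intro prod.remove) auto
  then have *: "theta_idx \<tau> n j z * (\<Prod>i\<in>{0..<int n} - {j mod int n}. theta_idx \<tau> n i z)
    = theta_const * theta \<tau> (of_nat n * z) * e2pi (of_nat n * (of_nat n - 1) / 2 * z)"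
    by (simp only: theta_idx_mod theta_Omega_theta)
  have "theta_idx \<tau> n j z * theta_cofactor j z
    = (theta_idx \<tau> n j z * (\<Prod>i\<in>{0..<int n} - {j mod int n}. theta_idx \<tau> n i z)) *
       e2pi (- (of_nat n * (of_nat n - 1) / 2 * z)) / theta_const"
    by (simp add: theta_cofactor_def)
  also have "\<dots> = theta \<tau> (of_nat n * z)"
    unfolding * e2pi_minus using theta_const_nonzero by simp
  finally show ?thesis .
qed

lemma theta_idx_mult_cancel:
  assumes "f holomorphic_on UNIV" "g holomorphic_on UNIV"
    and "\<And>z. theta_idx \<tau> n j z * f z = theta_idx \<tau> n j z * g z"
  shows "f z = g z"
proof -
  obtain a where "theta \<tau> a \<noteq> 0" using theta_not_identically_zero[OF \<tau>] by blast
  then have nz: "theta_idx \<tau> n j (a / of_nat n) \<noteq> 0"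
    using theta_idx_times_cofactor[of j "a / of_nat n"] n by auto
  have "(\<lambda>z. f z - g z) holomorphic_on UNIV" by (intro holomorphic_on_diff assms(1,2))
  from entire_mult_cancel[OF theta_idx_holomorphic this nz] show ?thesis
    by (simp add: right_diff_distrib assms(3))
qed

lemma theta_cofactor_plus_inverse:
  "theta_cofactor j (z + 1 / of_nat n) = e2pi (- of_int j / of_nat n) * theta_cofactor j z"
proof (rule theta_idx_mult_cancel[where j = j and z = z and
      f = "\<lambda>z. theta_cofactor j (z + 1 / of_nat n)" and
      g = "\<lambda>z. e2pi (- of_int j / of_nat n) * theta_cofactor j z"])
  show "(\<lambda>z. theta_cofactor j (z + 1 / of_nat n)) holomorphic_on UNIV"
    using holomorphic_on_compose_gen[OF _ theta_cofactor_holomorphic, of "\<lambda>z. z + 1 / of_nat n" UNIV]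
    by (simp add: o_def holomorphic_on_add holomorphic_on_ident)
  show "(\<lambda>z. e2pi (- of_int j / of_nat n) * theta_cofactor j z) holomorphic_on UNIV"
    by (intro holomorphic_intros theta_cofactor_holomorphic)
  fix z :: complex
  have "of_nat n * (z + 1 / of_nat n) = of_nat n * z + 1" using n by (simp add: distrib_left)
  then have "e2pi (of_int j / of_nat n) * theta_idx \<tau> n j z * theta_cofactor j (z + 1 / of_nat n)
     = theta_idx \<tau> n j z * theta_cofactor j z"
    using theta_idx_times_cofactor[of j "z + 1 / of_nat n"] theta_idx_times_cofactor[of j z]
    by (simp add: theta_plus_1 theta_idx_plus_inverse)
  then show "theta_idx \<tau> n j z * theta_cofactor j (z + 1 / of_nat n)
      = theta_idx \<tau> n j z * (e2pi (- of_int j / of_nat n) * theta_cofactor j z)"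
    unfolding minus_divide_left[symmetric] e2pi_minus by (simp add: field_simps)
qed

lemma theta_cofactor_plus_tau_div:
  "theta_cofactor j (z + \<tau> / of_nat n) =
     - e2pi (- of_nat n * z - (- z + (of_nat n - 1) / (2 * of_nat n) * \<tau> - 1 / (2 * of_nat n))) *
       theta_cofactor (j + 1) z"
proof (rule theta_idx_mult_cancel[where j = "j + 1" and z = z and
      f = "\<lambda>z. theta_cofactor j (z + \<tau> / of_nat n)" and
      g = "\<lambda>z. - e2pi (- of_nat n * z - (- z + (of_nat n - 1) / (2 * of_nat n) * \<tau> - 1 / (2 * of_nat n))) *
       theta_cofactor (j + 1) z"])
  let ?x = "\<lambda>z. - z + (of_nat n - 1) / (2 * of_nat n) * \<tau> - 1 / (2 * of_nat n)"
  show "(\<lambda>z. theta_cofactor j (z + \<tau> / of_nat n)) holomorphic_on UNIV"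
    using holomorphic_on_compose_gen[OF _ theta_cofactor_holomorphic, of "\<lambda>z. z + \<tau> / of_nat n" UNIV]
    by (simp add: o_def holomorphic_on_add holomorphic_on_ident)
  show "(\<lambda>z. - e2pi (- of_nat n * z - ?x z) * theta_cofactor (j + 1) z) holomorphic_on UNIV"
    by (intro holomorphic_intros theta_cofactor_holomorphic) (use n in auto)
  fix z
  have "of_nat n * (z + \<tau> / of_nat n) = of_nat n * z + \<tau>" using n by (simp add: distrib_left)
  then have "e2pi (?x z) * theta_idx \<tau> n (j + 1) z * theta_cofactor j (z + \<tau> / of_nat n)
     = - e2pi (- (of_nat n * z)) * (theta_idx \<tau> n (j + 1) z * theta_cofactor (j + 1) z)"
    using theta_idx_times_cofactor[of j "z + \<tau> / of_nat n"]
    unfolding theta_idx_times_cofactor[of "j + 1" z] by (simp only: theta_plus_tau theta_idx_plus_tau_div)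
  moreover have "T * K = T * (- (B / A) * K')" if "A * T * K = - B * (T * K')" "A \<noteq> 0" for A B T K K' :: complex
    using that by (simp add: field_simps)
  moreover have "e2pi (- of_nat n * z - ?x z) = e2pi (- (of_nat n * z)) / e2pi (?x z)"
    unfolding e2pi_diff[of "- of_nat n * z" "?x z"] by simp
  ultimately show "theta_idx \<tau> n (j + 1) z * theta_cofactor j (z + \<tau> / of_nat n)
      = theta_idx \<tau> n (j + 1) z * (- e2pi (- of_nat n * z - ?x z) * theta_cofactor (j + 1) z)"
    using e2pi_nonzero by metis
qed

lemma theta_cofactor_at_0:
  "theta_cofactor j 0 = (if int n dvd j then (\<Prod>i\<in>{1..<int n}. theta_idx \<tau> n i 0) / theta_const else 0)"
proof (cases "int n dvd j")
  case True
  then have "{0..<int n} - {j mod int n} = {1..<int n}" by auto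
  then show ?thesis using True by (simp add: theta_cofactor_def)
next
  case False
  then have "0 \<in> {0..<int n} - {j mod int n}" using n by (auto simp: dvd_eq_mod_eq_0)
  then have "(\<Prod>i\<in>{0..<int n} - {j mod int n}. theta_idx \<tau> n i 0) = 0"
    using theta_idx_0_0 by (intro prod_zero) auto
  then show ?thesis using False by (simp add: theta_cofactor_def)
qed

lemma theta_idx_prod_nonzero_at_0: "(\<Prod>i\<in>{1..<int n}. theta_idx \<tau> n i 0) \<noteq> 0"
  using theta_idx_nonzero_at_0 by auto

end

section \<open>Theta functions and their translations by torsion\<close>

text \<open>The multiplier of \<open>\<Theta>\<^sub>n\<^sub>/\<^sub>n\<^sub>-\<^sub>k\<close> for the translation of the coordinate \<open>j\<close> by \<open>\<tau>\<close>. Its argument \<open>c\<close> includes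
  the boundary values at \<open>0\<close> and \<open>p + 1\<close>.\<close>

definition theta_mult :: "complex \<Rightarrow> int list \<Rightarrow> nat \<Rightarrow> (nat \<Rightarrow> complex) \<Rightarrow> complex" where
  "theta_mult \<tau> ns j c = (-1) powi (ns ! (j - 1)) *
     e2pi (- (of_int (ns ! (j - 1)) * c j - c (j - 1) - c (j + 1) - ((if j = 1 then 1 else 0) - 1) * \<tau>))"

lemma theta_mult_eqI:
  assumes "of_int (ns ! (j - 1)) * c' j - c' (j - 1) - c' (j + 1)
      = of_int (ns ! (j - 1)) * c j - c (j - 1) - c (j + 1) + d"
  shows "theta_mult \<tau> ns j c' = theta_mult \<tau> ns j c * e2pi (- d)"
proof -
  have "- (of_int (ns ! (j - 1)) * c' j - c' (j - 1) - c' (j + 1) - ((if j = 1 then 1 else 0) - 1) * \<tau>)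
    = - (of_int (ns ! (j - 1)) * c j - c (j - 1) - c (j + 1) - ((if j = 1 then 1 else 0) - 1) * \<tau>) + - d"
    unfolding assms by simp
  then show ?thesis unfolding theta_mult_def by (simp only: e2pi_add mult.assoc)
qed

lemma theta_minus_tau: "theta \<tau> (z - \<tau>) = - e2pi (z - \<tau>) * theta \<tau> z"
  using theta_plus_tau[of \<tau> "z - \<tau>"] by (simp add: e2pi_minus e2pi_diff)

lemma theta_minus_1: "theta \<tau> (z - 1) = theta \<tau> z"
  using theta_plus_1[of \<tau> "z - 1"] by simp

locale theta_basis_data =
  fixes \<tau> \<phi> :: complex and n k :: nat and ns :: "int list"
    and w :: "int \<Rightarrow> (nat \<Rightarrow> complex) \<Rightarrow> complex"
  assumes \<tau>: "Im \<tau> > 0" and kn: "1 \<le> k" "k < n" and ns: "ns \<noteq> []"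
    and det_ns: "tridiag_det ns = int n"
    and basis: "theta_basis \<tau> n k ns \<phi> w"
begin

abbreviation p where "p \<equiv> length ns"

abbreviation tht where "tht \<equiv> theta \<tau>"

text \<open>The sequences \<open>\<gamma>\<close> and \<open>\<mu>\<close> are extended to the indices \<open>0\<close> and \<open>p + 1\<close> by the values \<open>-n, 0\<close> and
  \<open>0, n\<close> that make the recurrences \<open>gamma_coef_rec\<close> and \<open>mu_coef_rec\<close> valid up to the ends.\<close>

definition gamma_coef :: "nat \<Rightarrow> int" where
  "gamma_coef j = (if j \<le> p then - tridiag_det (drop j ns) else 0)"

definition mu_coef :: "nat \<Rightarrow> int" where
  "mu_coef j = (if j = 0 then 0 else tridiag_det (take (j - 1) ns))"

lemma n_pos: "n > 0" using kn by simp

lemma p_pos: "p > 0" using ns by simp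

lemma one_le_p: "Suc 0 \<le> p" by (rule Suc_leI[OF p_pos])

lemma gamma_coef_simps: "gamma_coef 0 = - int n" "gamma_coef (Suc p) = 0"
  by (simp_all add: gamma_coef_def det_ns)

lemma mu_coef_simps: "mu_coef 0 = 0" "mu_coef (Suc 0) = 1" "mu_coef (Suc p) = int n"
  by (simp_all add: mu_coef_def det_ns)

lemma gamma_coef_rec: "j \<in> {1..p} \<Longrightarrow> gamma_coef (j - 1) + gamma_coef (j + 1) = ns ! (j - 1) * gamma_coef j"
proof (cases "j = p")
  case True
  have "drop (p - 1) ns = [ns ! (p - 1)]"
    using Cons_nth_drop_Suc[of "p - 1" ns] p_pos by simp
  then show ?thesis using True by (simp add: gamma_coef_def)
next
  case False
  assume "j \<in> {1..p}"
  with False tridiag_det_drop[of j ns] show ?thesis by (auto simp: gamma_coef_def)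
qed

lemma mu_coef_rec: "j \<in> {1..p} \<Longrightarrow> mu_coef (j - 1) + mu_coef (j + 1) = ns ! (j - 1) * mu_coef j"
proof (cases "j = 1")
  case True
  have "take 1 ns = [ns ! 0]" using ns by (cases ns) simp_all
  then show ?thesis using True by (simp add: mu_coef_def)
next
  case False
  assume "j \<in> {1..p}"
  with False have j: "2 \<le> j" "j \<le> p" by auto
  then have "j - 1 - 1 = j - 2" "j - 1 \<noteq> 0" "j \<noteq> 0" by auto
  then show ?thesis
    using tridiag_det_take[OF j] by (simp add: mu_coef_def add.commute)
qed

lemma w_space: "w \<alpha> \<in> theta_space \<tau> ns"
  using basis unfolding theta_basis_def by blast

lemma w_entire: "entire_in p (w \<alpha>)"
  using w_space[of \<alpha>] by (simp add: theta_space_def)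

lemma w_cong: "(\<And>j. j \<in> {1..p} \<Longrightarrow> z j = z' j) \<Longrightarrow> w \<alpha> z = w \<alpha> z'"
  using w_entire[of \<alpha>] unfolding entire_in_def by blast

lemma w_sep_entire: "sep_entire (w \<alpha>)"
  by (rule entire_in_sep_entire[OF w_entire])

lemma w_cong_Ball: "\<forall>j\<in>{1..p}. z j = z' j \<Longrightarrow> w \<alpha> z = w \<alpha> z'"
  by (rule w_cong) blast

lemma w_compose: "(\<And>j. sep_entire (A j)) \<Longrightarrow> sep_entire (\<lambda>x. w \<alpha> (\<lambda>j. A j x))"
  by (rule sep_entire_compose[OF w_sep_entire finite_atLeastAtMost w_cong_Ball])

lemma w_along: "(\<And>j. a j holomorphic_on UNIV) \<Longrightarrow> (\<lambda>t. w \<alpha> (\<lambda>j. a j t)) holomorphic_on UNIV"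
  by (rule sep_entire_along[OF w_sep_entire finite_atLeastAtMost w_cong_Ball])

lemma w_periodic: "w (\<alpha> + int n) = w \<alpha>"
  using basis unfolding theta_basis_def by blast

lemma T_one_w: "T_one n ns (w \<alpha>) = (\<lambda>z. e2pi ((of_nat n - of_nat k) / of_nat n * of_int \<alpha>) * w \<alpha> z)"
  using basis unfolding theta_basis_def by (elim conjE allE)

lemma T_tau_w: "T_tau \<tau> n ns \<phi> (w \<alpha>) = w (\<alpha> + 1)"
  using basis unfolding theta_basis_def by blast

lemma w_mod: "w (\<alpha> mod int n) = w \<alpha>"
  by (rule periodic_mod[of w]) (rule w_periodic)

lemma w_plus_1: "j \<in> {1..p} \<Longrightarrow> w \<alpha> (z(j := z j + 1)) = w \<alpha> z"
  using w_space[of \<alpha>] unfolding theta_space_def by blast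

lemma w_plus_tau:
  assumes "j \<in> {1..p}"
  shows "w \<alpha> (z(j := z j + \<tau>)) = theta_mult \<tau> ns j (coord0 p z) * w \<alpha> z"
proof -
  have "coord0 p z j = z j" using assms by (simp add: coord0_def)
  then show ?thesis
    using w_space[of \<alpha>] assms unfolding theta_space_def theta_mult_def by simp
qed

lemma r_shift_gamma_coef: "j \<in> {1..p} \<Longrightarrow> r_shift n ns j = - of_int (gamma_coef j) / of_nat n"
  by (simp add: r_shift_def gamma_coef_def)

text \<open>The torsion translation by \<open>r\<^sub>j = - \<gamma>\<^sub>j / n\<close>, written with \<open>\<gamma>\<close> in order to be matched with a shift of the spectral
  parameter by \<open>1/n\<close>.\<close>

lemma w_shift_one:
  "w \<alpha> (\<lambda>j. z j - of_int (gamma_coef j) / of_nat n) = e2pi ((of_nat n - of_nat k) / of_nat n * of_int \<alpha>) * w \<alpha> z"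
proof -
  have "T_one n ns (w \<alpha>) z = e2pi ((of_nat n - of_nat k) / of_nat n * of_int \<alpha>) * w \<alpha> z"
    by (simp add: T_one_w)
  moreover have "T_one n ns (w \<alpha>) z = w \<alpha> (\<lambda>j. z j - of_int (gamma_coef j) / of_nat n)"
    unfolding T_one_def by (rule w_cong) (simp add: r_shift_gamma_coef)
  ultimately show ?thesis by simp
qed

lemma w_shift_tau:
  "w \<alpha> (\<lambda>j. z j - of_int (gamma_coef j) / of_nat n * \<tau>) = e2pi (- (z 1 + \<phi>)) * w (\<alpha> + 1) z"
proof -
  have "T_tau \<tau> n ns \<phi> (w \<alpha>) z = w (\<alpha> + 1) z"
    by (simp add: T_tau_w)
  then have "w (\<alpha> + 1) z = T_tau \<tau> n ns \<phi> (w \<alpha>) z" by simp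
  also have "\<dots> = e2pi (z 1 + \<phi>) * w \<alpha> (\<lambda>j. z j - of_int (gamma_coef j) / of_nat n * \<tau>)"
    unfolding T_tau_def by (intro arg_cong2[of _ _ _ _ "(*)"] refl w_cong) (simp add: r_shift_gamma_coef)
  finally have *: "w (\<alpha> + 1) z = e2pi (z 1 + \<phi>) * w \<alpha> (\<lambda>j. z j - of_int (gamma_coef j) / of_nat n * \<tau>)" .
  have "e2pi (- (z 1 + \<phi>)) * e2pi (z 1 + \<phi>) = 1"
    by (simp flip: e2pi_add)
  then show ?thesis by (simp only: * mult.assoc[symmetric] mult_1)
qed

section \<open>The relation of \<open>Y\<close> with denominators cleared\<close>

text \<open>A point \<open>x\<close> encodes the spectral parameter \<open>z\<close> as \<open>x 0\<close> and the differences \<open>s\<^sub>j\<close> as \<open>x j\<close>. This is the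
  sequence \<open>s\<^sub>0, \<dots>, s\<^sub>p\<^sub>+\<^sub>1\<close> completed at both ends.\<close>

definition offset :: "complex \<Rightarrow> (nat \<Rightarrow> complex) \<Rightarrow> nat \<Rightarrow> complex" where
  "offset \<eta> x j = (if j = 0 then - of_nat n * x 0 else if j \<le> p then x j else of_nat n * \<eta>)"

text \<open>Up to sign, this is the quotient
  \<open>\<theta>(s\<^sub>t\<^sub>+\<^sub>1 - s\<^sub>t) / (\<theta>(- s\<^sub>t) \<theta>(s\<^sub>t\<^sub>+\<^sub>1))\<close> multiplied by \<open>\<theta>(s\<^sub>0) \<dots> \<theta>(s\<^sub>p\<^sub>+\<^sub>1)\<close>; the exponential comes from
  \<open>\<theta>(- s) = - e2pi (- s) \<theta>(s)\<close>.\<close>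

definition kern :: "complex \<Rightarrow> nat \<Rightarrow> (nat \<Rightarrow> complex) \<Rightarrow> complex" where
  "kern \<eta> t x = e2pi (offset \<eta> x t) * tht (offset \<eta> x (Suc t) - offset \<eta> x t) *
     (\<Prod>j\<in>{0..Suc p} - {t, Suc t}. tht (offset \<eta> x j))"

text \<open>The arguments of \<open>w\<close> in the image of the \<open>t\<close>-th product on the right of a relation of \<open>Y\<close>: \<open>arg1\<close> belongs to the
  generator at \<open>v\<close>, \<open>arg2\<close> to the generator at \<open>u\<close>. The left side has the arguments \<open>ycoord\<close> and \<open>Y\<close>.
  All are expressed through \<open>Y\<close>, \<open>s\<close> and \<open>z\<close>.\<close>

definition arg1 :: "complex \<Rightarrow> (nat \<Rightarrow> complex) \<Rightarrow> nat \<Rightarrow> (nat \<Rightarrow> complex) \<Rightarrow> nat \<Rightarrow> complex" where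
  "arg1 \<eta> Y t x j = Y j - of_int (mu_coef j) * \<eta> + (if t < j then x j else 0)"

definition arg2 :: "(nat \<Rightarrow> complex) \<Rightarrow> nat \<Rightarrow> (nat \<Rightarrow> complex) \<Rightarrow> nat \<Rightarrow> complex" where
  "arg2 Y t x j = Y j - of_int (gamma_coef j) * x 0 + (if j \<le> t then x j else 0)"

definition ycoord :: "complex \<Rightarrow> (nat \<Rightarrow> complex) \<Rightarrow> (nat \<Rightarrow> complex) \<Rightarrow> nat \<Rightarrow> complex" where
  "ycoord \<eta> Y x j = x j + Y j - of_int (gamma_coef j) * x 0 - of_int (mu_coef j) * \<eta>"

definition numer :: "complex \<Rightarrow> (nat \<Rightarrow> complex) \<Rightarrow> int \<Rightarrow> int \<Rightarrow> (nat \<Rightarrow> complex) \<Rightarrow> complex" where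
  "numer \<eta> Y a b x = (\<Sum>t\<le>p. kern \<eta> t x * (w a (arg1 \<eta> Y t x) * w b (arg2 Y t x)))"

lemma sep_entire_offset: "sep_entire (\<lambda>x. offset \<eta> x j)"
  unfolding offset_def
  by (cases "j = 0"; cases "j \<le> p") (auto intro!: sep_entire_minus sep_entire_mult)

lemma sep_entire_numer: "sep_entire (numer \<eta> Y a b)"
proof -
  have th: "sep_entire (\<lambda>x. tht (f x))" if "sep_entire f" for f
    by (rule sep_entire_compose1[OF theta_holomorphic[OF \<tau>] that])
  have e: "sep_entire (\<lambda>x. e2pi (f x))" if "sep_entire f" for f
    by (rule sep_entire_compose1[OF _ that]) (intro holomorphic_intros)
  have k: "sep_entire (\<lambda>x. kern \<eta> t x)" for t
    unfolding kern_def by (intro sep_entire_mult sep_entire_prod th e sep_entire_diff sep_entire_offset)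
  have 1: "sep_entire (\<lambda>x. w a (arg1 \<eta> Y t x))" for t
  proof (rule w_compose)
    show "sep_entire (\<lambda>x. arg1 \<eta> Y t x j)" for j
      unfolding arg1_def by (cases "t < j") (auto intro!: sep_entire_add)
  qed
  have 2: "sep_entire (\<lambda>x. w b (arg2 Y t x))" for t
  proof (rule w_compose)
    show "sep_entire (\<lambda>x. arg2 Y t x j)" for j
      unfolding arg2_def by (cases "j \<le> t") (auto intro!: sep_entire_add sep_entire_diff sep_entire_mult)
  qed
  have "sep_entire (\<lambda>x. numer \<eta> Y a b x)"
    unfolding numer_def by (intro sep_entire_sum sep_entire_mult k 1 2)
  then show ?thesis by simp
qed

lemma prod_upd_scale:
  assumes "finite J" "j \<in> J" "f' j = c * f j" "\<And>i. i \<in> J \<Longrightarrow> i \<noteq> j \<Longrightarrow> f' i = f i"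
  shows "(\<Prod>i\<in>J. f' i) = (c :: complex) * (\<Prod>i\<in>J. f i)"
proof -
  have "(\<Prod>i\<in>J. f' i) = f' j * (\<Prod>i\<in>J - {j}. f' i)" "(\<Prod>i\<in>J. f i) = f j * (\<Prod>i\<in>J - {j}. f i)"
    using assms(1,2) by (simp_all add: prod.remove)
  moreover have "(\<Prod>i\<in>J - {j}. f' i) = (\<Prod>i\<in>J - {j}. f i)"
    using assms(4) by (intro prod.cong) auto
  ultimately show ?thesis using assms(3) by simp
qed

lemma offset_upd: "j \<in> {1..p} \<Longrightarrow> offset \<eta> (x(j := v)) = (offset \<eta> x)(j := v)"
  by (auto simp: offset_def fun_eq_iff)

lemma kern_plus_1:
  assumes j: "j \<in> {1..p}"
  shows "kern \<eta> t (x(j := x j + 1)) = kern \<eta> t x"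
proof -
  have e: "offset \<eta> x j = x j" using j by (auto simp: offset_def)
  have th: "tht (((offset \<eta> x)(j := x j + 1)) i) = tht (offset \<eta> x i)" for i
    by (simp add: e theta_plus_1)
  have "tht (((offset \<eta> x)(j := x j + 1)) (Suc t) - ((offset \<eta> x)(j := x j + 1)) t) = tht (offset \<eta> x (Suc t) - offset \<eta> x t)"
  proof -
    have *: "((offset \<eta> x)(j := x j + 1)) (Suc t) - ((offset \<eta> x)(j := x j + 1)) t =
      offset \<eta> x (Suc t) - offset \<eta> x t + (if j = Suc t then 1 else 0) - (if j = t then 1 else 0)"
      using e by auto
    show ?thesis
      unfolding * by (cases "j = t"; cases "j = Suc t") (simp_all add: theta_plus_1 theta_minus_1)
  qed
  moreover have "e2pi (((offset \<eta> x)(j := x j + 1)) t) = e2pi (offset \<eta> x t)"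
    by (simp add: e e2pi_add)
  ultimately show ?thesis
    unfolding kern_def offset_upd[OF j] th by simp
qed

text \<open>Every term acquires the multiplier of \<open>\<theta>(s\<^sub>j)\<close>, except that in the terms adjacent to \<open>j\<close> a neighbour of \<open>s\<^sub>j\<close>
  enters; \<open>arg_mult\<close> shows that the arguments of \<open>w\<close> compensate for this.\<close>

lemma kern_plus_tau:
  assumes j: "j \<in> {1..p}" and t: "t \<le> p"
  shows "kern \<eta> t (x(j := x j + \<tau>)) =
    - e2pi (- x j) * (if j = t then e2pi (offset \<eta> x (j + 1)) else if j = Suc t then e2pi (offset \<eta> x (j - 1)) else 1) *
      kern \<eta> t x"
proof -
  have e: "offset \<eta> x j = x j" using j by (auto simp: offset_def)
  let ?e = "offset \<eta> x" and ?e' = "(offset \<eta> x)(j := x j + \<tau>)"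
  consider "j = t" | "j = Suc t" | "j \<noteq> t" "j \<noteq> Suc t" by blast
  then show ?thesis
  proof cases
    case 1
    have "(\<Prod>i\<in>{0..Suc p} - {t, Suc t}. tht (?e' i)) = (\<Prod>i\<in>{0..Suc p} - {t, Suc t}. tht (?e i))"
      using 1 by (intro prod.cong) auto
    moreover have "e2pi (?e' t) * tht (?e' (Suc t) - ?e' t) = - e2pi (- x j) * e2pi (?e (Suc t)) * (e2pi (?e t) * tht (?e (Suc t) - ?e t))"
    proof -
      have "e2pi (?e' t) * tht (?e' (Suc t) - ?e' t) = e2pi (x j + \<tau>) * tht (?e (Suc t) - ?e t - \<tau>)"
        using 1 e by (simp add: diff_diff_eq)
      also have "\<dots> = - (e2pi (x j + \<tau>) * e2pi (?e (Suc t) - ?e t - \<tau>)) * tht (?e (Suc t) - ?e t)"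
        by (simp add: theta_minus_tau)
      also have "e2pi (x j + \<tau>) * e2pi (?e (Suc t) - ?e t - \<tau>) = e2pi (- x j) * e2pi (?e (Suc t)) * e2pi (?e t)"
        using 1 e by (simp flip: e2pi_add)
      finally show ?thesis by simp
    qed
    ultimately show ?thesis using 1 unfolding kern_def offset_upd[OF j] by simp
  next
    case 2
    have "(\<Prod>i\<in>{0..Suc p} - {t, Suc t}. tht (?e' i)) = (\<Prod>i\<in>{0..Suc p} - {t, Suc t}. tht (?e i))"
      using 2 by (intro prod.cong) auto
    moreover have "tht (?e' (Suc t) - ?e' t) = - e2pi (- x j) * e2pi (?e t) * tht (?e (Suc t) - ?e t)"
    proof -
      have "?e' (Suc t) - ?e' t = (?e (Suc t) - ?e t) + \<tau>" using 2 e by simp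
      moreover have "e2pi (- (?e (Suc t) - ?e t)) = e2pi (- x j) * e2pi (?e t)"
        using 2 e by (simp flip: e2pi_add)
      ultimately show ?thesis
        using theta_plus_tau[of \<tau> "?e (Suc t) - ?e t"] by simp
    qed
    moreover have "?e' t = ?e t" using 2 by simp
    ultimately show ?thesis using 2 unfolding kern_def offset_upd[OF j] by simp
  next
    case 3
    have "(\<Prod>i\<in>{0..Suc p} - {t, Suc t}. tht (?e' i)) = - e2pi (- x j) * (\<Prod>i\<in>{0..Suc p} - {t, Suc t}. tht (?e i))"
      by (rule prod_upd_scale[of _ j]) (use 3 j e in \<open>auto simp: theta_plus_tau\<close>)
    then show ?thesis using 3 unfolding kern_def offset_upd[OF j] by simp
  qed
qed

text \<open>The extended values of \<open>\<gamma>\<close> and \<open>\<mu>\<close> make one formula for \<open>s\<^sub>j\<close> hold at the two ends as well, where the coordinates are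
  replaced by \<open>0\<close>.\<close>

lemma offset_ycoord:
  assumes "j \<le> Suc p"
  shows "offset \<eta> x j = coord0 p (ycoord \<eta> Y x) j - coord0 p Y j + of_int (gamma_coef j) * x 0 + of_int (mu_coef j) * \<eta>"
proof -
  consider "j = 0" | "j \<in> {1..p}" | "j = Suc p" using assms by fastforce
  then show ?thesis
    by cases (auto simp: offset_def coord0_def ycoord_def gamma_coef_simps mu_coef_simps)
qed

lemma coord0_arg1:
  assumes "j \<le> Suc p" "t \<le> p"
  shows "coord0 p (arg1 \<eta> Y t x) j =
    (if t < j then coord0 p (ycoord \<eta> Y x) j + of_int (gamma_coef j) * x 0 else coord0 p Y j - of_int (mu_coef j) * \<eta>)"
proof -
  consider "j = 0" | "j \<in> {1..p}" | "j = Suc p" using assms by fastforce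
  then show ?thesis
    using assms by cases (auto simp: coord0_def ycoord_def arg1_def gamma_coef_simps mu_coef_simps)
qed

lemma coord0_arg2:
  assumes "j \<le> Suc p" "t \<le> p"
  shows "coord0 p (arg2 Y t x) j =
    (if j \<le> t then coord0 p (ycoord \<eta> Y x) j + of_int (mu_coef j) * \<eta> else coord0 p Y j - of_int (gamma_coef j) * x 0)"
proof -
  consider "j = 0" | "j \<in> {1..p}" | "j = Suc p" using assms by fastforce
  then show ?thesis
    using assms by cases (auto simp: coord0_def ycoord_def arg2_def gamma_coef_simps mu_coef_simps)
qed

lemma gamma_coef_rec': "j \<in> {1..p} \<Longrightarrow> of_int (ns ! (j - 1)) * of_int (gamma_coef j) = (of_int (gamma_coef (j - 1)) + of_int (gamma_coef (j + 1)) :: complex)"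
  using gamma_coef_rec[of j] by (metis of_int_add of_int_mult)

lemma mu_coef_rec': "j \<in> {1..p} \<Longrightarrow> of_int (ns ! (j - 1)) * of_int (mu_coef j) = (of_int (mu_coef (j - 1)) + of_int (mu_coef (j + 1)) :: complex)"
  using mu_coef_rec[of j] by (metis of_int_add of_int_mult)

text \<open>By the recurrences for \<open>\<gamma>\<close> and \<open>\<mu>\<close>, the terms in \<open>z\<close> and \<open>\<eta>\<close> drop out of the multiplier unless the cut \<open>t\<close>
  separates \<open>j\<close> from a neighbour; then the discrepancy is the adjacent \<open>s\<close>.\<close>

lemma arg_mult:
  assumes j: "j \<in> {1..p}" and t: "t \<le> p"
  shows "t < j \<Longrightarrow> (if j = Suc t then e2pi (offset \<eta> x (j - 1)) else 1) * theta_mult \<tau> ns j (coord0 p (arg1 \<eta> Y t x))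
      = theta_mult \<tau> ns j (coord0 p (ycoord \<eta> Y x))" (is "_ \<Longrightarrow> ?one")
    and "j \<le> t \<Longrightarrow> (if j = t then e2pi (offset \<eta> x (j + 1)) else 1) * theta_mult \<tau> ns j (coord0 p (arg2 Y t x))
      = theta_mult \<tau> ns j (coord0 p (ycoord \<eta> Y x))" (is "_ \<Longrightarrow> ?two")
proof -
  have b: "j \<le> Suc p" "j - 1 \<le> Suc p" "j + 1 \<le> Suc p" using j by auto
  have J: "Suc (j - 1) = j" using j by simp
  define g where "g = (\<lambda>i. of_int (gamma_coef i) :: complex)"
  define m where "m = (\<lambda>i. of_int (mu_coef i) :: complex)"
  define N where "N = (of_int (ns ! (j - 1)) :: complex)"
  define y where "y = coord0 p (ycoord \<eta> Y x)"
  define y' where "y' = coord0 p Y"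
  have g: "N * g j = g (j - 1) + g (j + 1)" and m: "N * m j = m (j - 1) + m (j + 1)"
    using gamma_coef_rec'[OF j] mu_coef_rec'[OF j] by (simp_all add: g_def m_def N_def)
  have E: "offset \<eta> x i = y i - y' i + g i * x 0 + m i * \<eta>" if "i \<le> Suc p" for i
    using offset_ycoord[OF that, of \<eta> x Y] by (simp add: y_def y'_def g_def m_def)
  show ?one if tj: "t < j"
  proof -
    define d where "d = (if j = Suc t then offset \<eta> x (j - 1) else 0)"
    have A: "coord0 p (arg1 \<eta> Y t x) i = (if t < i then y i + g i * x 0 else y' i - m i * \<eta>)" if "i \<le> Suc p" for i
      using coord0_arg1[OF that t] by (simp add: y_def y'_def g_def m_def)
    have "N * (y j + g j * x 0) - (if t < j - 1 then y (j - 1) + g (j - 1) * x 0 else y' (j - 1) - m (j - 1) * \<eta>)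
       - (y (j + 1) + g (j + 1) * x 0) = N * y j - y (j - 1) - y (j + 1) + d"
    proof -
      have "N * (y j + g j * x 0) = N * y j + (g (j - 1) + g (j + 1)) * x 0"
        using g by (simp add: distrib_left flip: mult.assoc)
      moreover have "t < j - 1 \<longleftrightarrow> j \<noteq> Suc t" using tj by auto
      ultimately show ?thesis
        unfolding d_def E[OF b(2)] by (simp add: algebra_simps)
    qed
    then have "theta_mult \<tau> ns j (coord0 p (arg1 \<eta> Y t x)) = theta_mult \<tau> ns j y * e2pi (- d)"
      using tj unfolding N_def by (intro theta_mult_eqI) (simp only: A[OF b(1)] A[OF b(2)] A[OF b(3)], simp)
    then show ?thesis
      unfolding y_def d_def by (simp add: e2pi_minus)
  qed
  show ?two if tj: "j \<le> t"
  proof -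
    define d where "d = (if j = t then offset \<eta> x (j + 1) else 0)"
    have A: "coord0 p (arg2 Y t x) i = (if i \<le> t then y i + m i * \<eta> else y' i - g i * x 0)" if "i \<le> Suc p" for i
      using coord0_arg2[OF that t, of Y x \<eta>] by (simp add: y_def y'_def g_def m_def)
    have "N * (y j + m j * \<eta>) - (y (j - 1) + m (j - 1) * \<eta>)
       - (if j + 1 \<le> t then y (j + 1) + m (j + 1) * \<eta> else y' (j + 1) - g (j + 1) * x 0) = N * y j - y (j - 1) - y (j + 1) + d"
    proof -
      have "N * (y j + m j * \<eta>) = N * y j + (m (j - 1) + m (j + 1)) * \<eta>"
        using m by (simp add: distrib_left flip: mult.assoc)
      moreover have "j + 1 \<le> t \<longleftrightarrow> j \<noteq> t" using tj by auto
      ultimately show ?thesis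
        unfolding d_def E[OF b(3)] by (simp add: algebra_simps)
    qed
    then have "theta_mult \<tau> ns j (coord0 p (arg2 Y t x)) = theta_mult \<tau> ns j y * e2pi (- d)"
    proof -
      assume *: "N * (y j + m j * \<eta>) - (y (j - 1) + m (j - 1) * \<eta>)
       - (if j + 1 \<le> t then y (j + 1) + m (j + 1) * \<eta> else y' (j + 1) - g (j + 1) * x 0) = N * y j - y (j - 1) - y (j + 1) + d"
      have c: "j - 1 \<le> t" using tj by simp
      show ?thesis
        by (rule theta_mult_eqI) (simp only: A[OF b(1)] A[OF b(2)] A[OF b(3)] tj c if_True *[unfolded N_def])
    qed
    then show ?thesis
      unfolding y_def d_def by (simp add: e2pi_minus)
  qed
qed

lemma arg1_upd: "j \<noteq> 0 \<Longrightarrow> arg1 \<eta> Y t (x(j := x j + v)) =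
    (if t < j then (arg1 \<eta> Y t x)(j := arg1 \<eta> Y t x j + v) else arg1 \<eta> Y t x)"
  by (auto simp: arg1_def fun_eq_iff)

lemma arg2_upd: "j \<noteq> 0 \<Longrightarrow> arg2 Y t (x(j := x j + v)) =
    (if j \<le> t then (arg2 Y t x)(j := arg2 Y t x j + v) else arg2 Y t x)"
  by (auto simp: arg2_def fun_eq_iff)

lemma numer_plus_1:
  assumes "j \<in> {1..p}"
  shows "numer \<eta> Y a b (x(j := x j + 1)) = numer \<eta> Y a b x"
  using assms unfolding numer_def
  by (intro sum.cong) (simp_all add: kern_plus_1 arg1_upd arg2_upd w_plus_1)

lemma numer_plus_tau:
  assumes j: "j \<in> {1..p}"
  shows "numer \<eta> Y a b (x(j := x j + \<tau>)) =
    - e2pi (- x j) * theta_mult \<tau> ns j (coord0 p (ycoord \<eta> Y x)) * numer \<eta> Y a b x"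
  unfolding numer_def sum_distrib_left
proof (rule sum.cong)
  fix t assume "t \<in> {..p}"
  then have t: "t \<le> p" by simp
  have j0: "j \<noteq> 0" using j by auto
  let ?M = "theta_mult \<tau> ns j (coord0 p (ycoord \<eta> Y x))"
  show "kern \<eta> t (x(j := x j + \<tau>)) * (w a (arg1 \<eta> Y t (x(j := x j + \<tau>))) * w b (arg2 Y t (x(j := x j + \<tau>)))) =
    - e2pi (- x j) * ?M * (kern \<eta> t x * (w a (arg1 \<eta> Y t x) * w b (arg2 Y t x)))"
  proof (cases "t < j")
    case True
    have "kern \<eta> t (x(j := x j + \<tau>)) = - e2pi (- x j) * (if j = Suc t then e2pi (offset \<eta> x (j - 1)) else 1) * kern \<eta> t x"
      using True by (simp add: kern_plus_tau[OF j t])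
    moreover have "w a (arg1 \<eta> Y t (x(j := x j + \<tau>))) = theta_mult \<tau> ns j (coord0 p (arg1 \<eta> Y t x)) * w a (arg1 \<eta> Y t x)"
      using True j0 by (simp add: arg1_upd w_plus_tau[OF j])
    moreover have "arg2 Y t (x(j := x j + \<tau>)) = arg2 Y t x"
      using True j0 by (simp add: arg2_upd)
    ultimately show ?thesis
      using arg_mult(1)[OF j t True, of \<eta> x Y, symmetric] by (simp only: mult_ac)
  next
    case False
    then have "j \<le> t" by simp
    have "kern \<eta> t (x(j := x j + \<tau>)) = - e2pi (- x j) * (if j = t then e2pi (offset \<eta> x (j + 1)) else 1) * kern \<eta> t x"
      using \<open>j \<le> t\<close> by (simp add: kern_plus_tau[OF j t])
    moreover have "w b (arg2 Y t (x(j := x j + \<tau>))) = theta_mult \<tau> ns j (coord0 p (arg2 Y t x)) * w b (arg2 Y t x)"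
      using \<open>j \<le> t\<close> j0 by (simp add: arg2_upd w_plus_tau[OF j])
    moreover have "arg1 \<eta> Y t (x(j := x j + \<tau>)) = arg1 \<eta> Y t x"
      using False j0 by (simp add: arg1_upd)
    ultimately show ?thesis
      using arg_mult(2)[OF j t \<open>j \<le> t\<close>, of \<eta> x Y, symmetric] by (simp only: mult_ac)
  qed
qed simp

text \<open>On \<open>x j = 0\<close> only the terms \<open>t = j - 1\<close> and \<open>t = j\<close> survive, their arguments of
  \<open>w\<close> coincide, and they cancel.\<close>

lemma numer_zero:
  assumes j: "j \<in> {1..p}" and x: "x j = 0"
  shows "numer \<eta> Y a b x = 0"
proof -
  have e: "offset \<eta> x j = 0" using j x by (auto simp: offset_def)
  obtain i where i: "j = Suc i" using j by (cases j) auto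
  let ?f = "\<lambda>t. kern \<eta> t x * (w a (arg1 \<eta> Y t x) * w b (arg2 Y t x))"
  have "(\<Sum>t\<le>p. ?f t) = (\<Sum>t\<in>{i, Suc i}. ?f t)"
  proof (rule sum.mono_neutral_right)
    show "\<forall>t\<in>{..p} - {i, Suc i}. ?f t = 0"
    proof
      fix t assume t: "t \<in> {..p} - {i, Suc i}"
      have "(\<Prod>j\<in>{0..Suc p} - {t, Suc t}. tht (offset \<eta> x j)) = 0"
        using t j i e by (intro prod_zero) (auto intro!: bexI[of _ j])
      then show "?f t = 0" by (simp add: kern_def)
    qed
  qed (use j i in auto)
  also have "\<dots> = 0"
  proof -
    have "arg1 \<eta> Y (Suc i) x = arg1 \<eta> Y i x" "arg2 Y (Suc i) x = arg2 Y i x"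
    proof -
      have "arg1 \<eta> Y (Suc i) x l = arg1 \<eta> Y i x l \<and> arg2 Y (Suc i) x l = arg2 Y i x l" for l
      proof (cases "l = Suc i")
        case False
        then have "Suc i < l \<longleftrightarrow> i < l" "l \<le> Suc i \<longleftrightarrow> l \<le> i" by auto
        then show ?thesis by (simp add: arg1_def arg2_def)
      qed (use x i in \<open>simp add: arg1_def arg2_def\<close>)
      then show "arg1 \<eta> Y (Suc i) x = arg1 \<eta> Y i x" "arg2 Y (Suc i) x = arg2 Y i x" by auto
    qed
    moreover have "kern \<eta> (Suc i) x = - kern \<eta> i x"
    proof -
      define R where "R = {0..Suc p} - {i, Suc i, Suc (Suc i)}"
      define P where "P = (\<Prod>l\<in>R. tht (offset \<eta> x l))"
      have s1: "{0..Suc p} - {i, Suc i} = insert (Suc (Suc i)) R"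
        and s2: "{0..Suc p} - {Suc i, Suc (Suc i)} = insert i R"
        unfolding R_def using i j by auto
      have p1: "(\<Prod>l\<in>{0..Suc p} - {i, Suc i}. tht (offset \<eta> x l)) = tht (offset \<eta> x (Suc (Suc i))) * P"
        unfolding s1 P_def by (rule prod.insert) (simp_all add: R_def)
      have p2: "(\<Prod>l\<in>{0..Suc p} - {Suc i, Suc (Suc i)}. tht (offset \<eta> x l)) = tht (offset \<eta> x i) * P"
        unfolding s2 P_def by (rule prod.insert) (simp_all add: R_def)
      have e': "offset \<eta> x (Suc i) = 0" using e i by simp
      have "kern \<eta> i x = (e2pi (offset \<eta> x i) * tht (- offset \<eta> x i)) * (tht (offset \<eta> x (Suc (Suc i))) * P)"
        "kern \<eta> (Suc i) x = tht (offset \<eta> x (Suc (Suc i))) * (tht (offset \<eta> x i) * P)"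
        unfolding kern_def p1 p2 e' by simp_all
      moreover have "e2pi (offset \<eta> x i) * tht (- offset \<eta> x i) = - tht (offset \<eta> x i)"
        using theta_uminus[of \<tau> "offset \<eta> x i"] by (simp add: e2pi_minus)
      ultimately show ?thesis by simp
    qed
    ultimately show ?thesis by simp
  qed
  finally show ?thesis by (simp add: numer_def)
qed

lemma numer_lattice:
  assumes j: "j \<in> {1..p}" and x: "x j \<in> period_lattice \<tau>"
  shows "numer \<eta> Y a b x = 0"
proof -
  have "numer \<eta> Y a b (x(j := v)) = 0" if "v \<in> period_lattice \<tau>" for v
    using that
  proof (induction rule: lattice_induct)
    case zero
    show ?case by (rule numer_zero[OF j]) simp
  next
    case (one z)
    have "numer \<eta> Y a b (x(j := z + 1)) = numer \<eta> Y a b (x(j := z))"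
      using numer_plus_1[OF j, of \<eta> Y a b "x(j := z)"] by (simp only: fun_upd_upd fun_upd_same)
    then show ?case by (simp only:)
  next
    case (tau z)
    have "numer \<eta> Y a b (x(j := z + \<tau>)) = - e2pi (- z) *
        theta_mult \<tau> ns j (coord0 p (ycoord \<eta> Y (x(j := z)))) * numer \<eta> Y a b (x(j := z))"
      using numer_plus_tau[OF j, of \<eta> Y a b "x(j := z)"] by (simp only: fun_upd_upd fun_upd_same)
    moreover have "- e2pi (- z) * theta_mult \<tau> ns j (coord0 p (ycoord \<eta> Y (x(j := z)))) \<noteq> 0"
      by (simp add: theta_mult_def)
    ultimately obtain c where "c \<noteq> 0" "numer \<eta> Y a b (x(j := z + \<tau>)) = c * numer \<eta> Y a b (x(j := z))"
      by blast
    then show ?case by (simp only: mult_eq_0_iff simp_thms)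
  qed
  from this[OF x] show ?thesis by simp
qed

text \<open>The shift of \<open>z\<close> with \<open>s\<^sub>1, \<dots>, s\<^sub>p\<close> fixed leaves \<open>arg1\<close> alone and acts on \<open>arg2\<close> as a torsion translation. The same
  happens in \<open>numer_shift_tau\<close>.\<close>

lemma numer_shift_one:
  "numer \<eta> Y a b (x(0 := x 0 + 1 / of_nat n)) = e2pi ((of_nat n - of_nat k) / of_nat n * of_int b) * numer \<eta> Y a b x"
  unfolding numer_def sum_distrib_left
proof (rule sum.cong)
  fix t assume "t \<in> {..p}"
  let ?x = "x(0 := x 0 + 1 / of_nat n)"
  have e: "offset \<eta> ?x = (offset \<eta> x)(0 := offset \<eta> x 0 - 1)"
    using n_pos by (auto simp: offset_def fun_eq_iff distrib_left)
  have "tht (((offset \<eta> x)(0 := offset \<eta> x 0 - 1)) i) = tht (offset \<eta> x i)" for i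
    by (simp add: theta_minus_1)
  moreover have "tht (((offset \<eta> x)(0 := offset \<eta> x 0 - 1)) (Suc t) - ((offset \<eta> x)(0 := offset \<eta> x 0 - 1)) t)
      = tht (offset \<eta> x (Suc t) - offset \<eta> x t)"
    using theta_plus_1[of \<tau> "offset \<eta> x (Suc t) - offset \<eta> x t"] by (auto simp: algebra_simps)
  moreover have "e2pi (((offset \<eta> x)(0 := offset \<eta> x 0 - 1)) t) = e2pi (offset \<eta> x t)"
    by (simp add: e2pi_diff)
  ultimately have "kern \<eta> t ?x = kern \<eta> t x"
    unfolding kern_def e by simp
  moreover have "w a (arg1 \<eta> Y t ?x) = w a (arg1 \<eta> Y t x)"
    by (rule w_cong) (auto simp: arg1_def)
  moreover have "w b (arg2 Y t ?x) = e2pi ((of_nat n - of_nat k) / of_nat n * of_int b) * w b (arg2 Y t x)"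
    unfolding w_shift_one[symmetric] by (rule w_cong) (auto simp: arg2_def algebra_simps)
  ultimately show "kern \<eta> t ?x * (w a (arg1 \<eta> Y t ?x) * w b (arg2 Y t ?x)) =
      e2pi ((of_nat n - of_nat k) / of_nat n * of_int b) * (kern \<eta> t x * (w a (arg1 \<eta> Y t x) * w b (arg2 Y t x)))"
    by simp
qed simp

lemma numer_shift_tau:
  "numer \<eta> Y a b (x(0 := x 0 + \<tau> / of_nat n)) =
    - e2pi (- of_nat n * x 0 - \<tau> - ycoord \<eta> Y x 1 - \<eta> - \<phi>) * numer \<eta> Y a (b + 1) x"
  unfolding numer_def sum_distrib_left
proof (rule sum.cong)
  fix t assume t: "t \<in> {..p}"
  let ?x = "x(0 := x 0 + \<tau> / of_nat n)"
  let ?e = "offset \<eta> x"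
  note p1 = one_le_p
  have e: "offset \<eta> ?x = ?e(0 := ?e 0 - \<tau>)"
    using n_pos by (auto simp: offset_def fun_eq_iff distrib_left)
  have e0: "?e 0 = - of_nat n * x 0" "?e 1 = x 1" using p1 by (simp_all add: offset_def)
  have 1: "w a (arg1 \<eta> Y t ?x) = w a (arg1 \<eta> Y t x)"
    by (rule w_cong) (auto simp: arg1_def)
  have 2: "w b (arg2 Y t ?x) = e2pi (- (arg2 Y t x 1 + \<phi>)) * w (b + 1) (arg2 Y t x)"
    unfolding w_shift_tau[symmetric] by (rule w_cong) (auto simp: arg2_def algebra_simps)
  have 3: "kern \<eta> t ?x = - e2pi (?e 0 - \<tau> - (if t = 0 then x 1 else 0)) * kern \<eta> t x"
  proof (cases "t = 0")
    case True
    have "(\<Prod>i\<in>{0..Suc p} - {t, Suc t}. tht ((?e(0 := ?e 0 - \<tau>)) i)) = (\<Prod>i\<in>{0..Suc p} - {t, Suc t}. tht (?e i))"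
      using True by (intro prod.cong) auto
    moreover have "e2pi (?e 0 - \<tau>) * tht (?e 1 - (?e 0 - \<tau>)) = - e2pi (?e 0 - \<tau> - x 1) * (e2pi (?e 0) * tht (?e 1 - ?e 0))"
    proof -
      have "?e 1 - (?e 0 - \<tau>) = (?e 1 - ?e 0) + \<tau>" by simp
      then have "e2pi (?e 0 - \<tau>) * tht (?e 1 - (?e 0 - \<tau>)) = - (e2pi (?e 0 - \<tau>) * e2pi (- (?e 1 - ?e 0))) * tht (?e 1 - ?e 0)"
        by (simp only: theta_plus_tau) simp
      also have "e2pi (?e 0 - \<tau>) * e2pi (- (?e 1 - ?e 0)) = e2pi (?e 0 - \<tau> - x 1) * e2pi (?e 0)"
        unfolding e0(2) by (simp flip: e2pi_add)
      finally show ?thesis by simp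
    qed
    ultimately show ?thesis using True unfolding kern_def e by simp
  next
    case False
    have "(\<Prod>i\<in>{0..Suc p} - {t, Suc t}. tht ((?e(0 := ?e 0 - \<tau>)) i)) = - e2pi (?e 0 - \<tau>) * (\<Prod>i\<in>{0..Suc p} - {t, Suc t}. tht (?e i))"
      by (rule prod_upd_scale[of _ 0]) (use False in \<open>auto simp: theta_minus_tau\<close>)
    then show ?thesis using False unfolding kern_def e by simp
  qed
  have "arg2 Y t x 1 + (if t = 0 then x 1 else 0) = ycoord \<eta> Y x 1 + \<eta>"
    by (auto simp: arg2_def ycoord_def mu_coef_simps)
  then have "?e 0 - \<tau> - (if t = 0 then x 1 else 0) + - (arg2 Y t x 1 + \<phi>) = - of_nat n * x 0 - \<tau> - ycoord \<eta> Y x 1 - \<eta> - \<phi>"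
    unfolding e0 by (simp add: algebra_simps)
  then have eq: "e2pi (?e 0 - \<tau> - (if t = 0 then x 1 else 0)) * e2pi (- (arg2 Y t x 1 + \<phi>))
     = e2pi (- of_nat n * x 0 - \<tau> - ycoord \<eta> Y x 1 - \<eta> - \<phi>)"
    by (simp only: e2pi_add[symmetric])
  show "kern \<eta> t ?x * (w a (arg1 \<eta> Y t ?x) * w b (arg2 Y t ?x)) =
      - e2pi (- of_nat n * x 0 - \<tau> - ycoord \<eta> Y x 1 - \<eta> - \<phi>) * (kern \<eta> t x * (w a (arg1 \<eta> Y t x) * w (b + 1) (arg2 Y t x)))"
    unfolding 1 2 3 eq[symmetric] by (simp only: mult_ac mult_minus_left mult_minus_right)
qed simp

text \<open>For \<open>z = 0\<close> all terms but the one for \<open>t = 0\<close> contain the factor \<open>\<theta>(s\<^sub>0) = 0\<close>.\<close>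

lemma numer_at_0:
  assumes "x 0 = 0"
  shows "numer \<eta> Y a b x = (\<Prod>j\<in>{1..p}. tht (x j)) * (tht (of_nat n * \<eta>) * (w a (ycoord \<eta> Y x) * w b Y))"
proof -
  let ?f = "\<lambda>t. kern \<eta> t x * (w a (arg1 \<eta> Y t x) * w b (arg2 Y t x))"
  have e0: "offset \<eta> x 0 = 0" using assms by (simp add: offset_def)
  have "(\<Sum>t\<le>p. ?f t) = (\<Sum>t\<in>{0}. ?f t)"
  proof (rule sum.mono_neutral_right)
    show "\<forall>t\<in>{..p} - {0}. ?f t = 0"
    proof
      fix t assume t: "t \<in> {..p} - {0}"
      have "(\<Prod>j\<in>{0..Suc p} - {t, Suc t}. tht (offset \<eta> x j)) = 0"
        using t e0 by (intro prod_zero) (auto intro!: bexI[of _ 0])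
      then show "?f t = 0" by (simp add: kern_def)
    qed
  qed auto
  also have "\<dots> = kern \<eta> 0 x * (w a (arg1 \<eta> Y 0 x) * w b (arg2 Y 0 x))" by simp
  also have "w a (arg1 \<eta> Y 0 x) = w a (ycoord \<eta> Y x)"
    by (rule w_cong) (use assms in \<open>auto simp: arg1_def ycoord_def\<close>)
  also have "w b (arg2 Y 0 x) = w b Y"
    by (rule w_cong) (use assms in \<open>auto simp: arg2_def\<close>)
  also have "kern \<eta> 0 x = (\<Prod>j\<in>{1..p}. tht (x j)) * tht (of_nat n * \<eta>)"
  proof -
    have 1: "{0..Suc p} - {0, Suc 0} = insert (Suc p) {2..p}" using one_le_p by auto
    have 2: "{1..p} = insert 1 {2..p}" using one_le_p by auto
    have 3: "(\<Prod>j\<in>{2..p}. tht (offset \<eta> x j)) = (\<Prod>j\<in>{2..p}. tht (x j))"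
      by (intro prod.cong) (auto simp: offset_def)
    have 4: "offset \<eta> x (Suc 0) = x 1" "offset \<eta> x (Suc p) = of_nat n * \<eta>" using one_le_p by (auto simp: offset_def)
    show ?thesis
      unfolding kern_def 1 2 by (simp add: 3 4 e0)
  qed
  finally show ?thesis by (simp add: numer_def)
qed

end

section \<open>Functionals made of evaluations\<close>

text \<open>Functionals of this form preserve holomorphic dependence on a parameter, so the coordinates of an
  entire family with respect to a basis of functions are entire.\<close>

definition evaluation_functional :: "(('a \<Rightarrow> complex) \<Rightarrow> complex) \<Rightarrow> bool" where
  "evaluation_functional L \<longleftrightarrow> (\<exists>S m. finite S \<and> (\<forall>h. L h = (\<Sum>y\<in>S. m y * h y)))"

lemma evaluation_functional_eval: "evaluation_functional (\<lambda>h. h y)"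
  unfolding evaluation_functional_def by (intro exI[of _ "{y}"] exI[of _ "\<lambda>_. 1"]) simp

lemma evaluation_functional_0: "evaluation_functional (\<lambda>h. 0)"
  unfolding evaluation_functional_def by (intro exI[of _ "{}"]) simp

lemma evaluation_functional_scale:
  "evaluation_functional L \<Longrightarrow> evaluation_functional (\<lambda>h. c * L h)"
  unfolding evaluation_functional_def
proof (elim exE conjE)
  fix S m assume "finite S" "\<forall>h. L h = (\<Sum>y\<in>S. m y * h y)"
  then show "\<exists>S m. finite S \<and> (\<forall>h. c * L h = (\<Sum>y\<in>S. m y * h y))"
    by (intro exI[of _ S] exI[of _ "\<lambda>y. c * m y"]) (simp add: sum_distrib_left mult.assoc)
qed

lemma evaluation_functional_add:
  assumes "evaluation_functional L" "evaluation_functional M"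
  shows "evaluation_functional (\<lambda>h. L h + M h)"
proof -
  obtain S m where S: "finite S" "\<And>h. L h = (\<Sum>y\<in>S. m y * h y)"
    using assms(1) by (auto simp: evaluation_functional_def)
  obtain T l where T: "finite T" "\<And>h. M h = (\<Sum>y\<in>T. l y * h y)"
    using assms(2) by (auto simp: evaluation_functional_def)
  have "L h + M h = (\<Sum>y\<in>S \<union> T. ((if y \<in> S then m y else 0) + (if y \<in> T then l y else 0)) * h y)" for h
  proof -
    have "L h = (\<Sum>y\<in>S \<union> T. (if y \<in> S then m y else 0) * h y)"
      unfolding S(2) using S(1) T(1) by (intro sum.mono_neutral_cong_left) auto
    moreover have "M h = (\<Sum>y\<in>S \<union> T. (if y \<in> T then l y else 0) * h y)"
      unfolding T(2) using S(1) T(1) by (intro sum.mono_neutral_cong_left) auto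
    ultimately show ?thesis by (simp add: distrib_right sum.distrib)
  qed
  then show ?thesis
    unfolding evaluation_functional_def using S(1) T(1)
    by (intro exI[of _ "S \<union> T"] exI[of _ "\<lambda>y. (if y \<in> S then m y else 0) + (if y \<in> T then l y else 0)"]) simp
qed

lemma evaluation_functional_sum:
  "(\<And>i. i \<in> I \<Longrightarrow> evaluation_functional (L i)) \<Longrightarrow> evaluation_functional (\<lambda>h. \<Sum>i\<in>I. L i h)"
  by (induction I rule: infinite_finite_induct) (auto intro: evaluation_functional_0 evaluation_functional_add)

lemma evaluation_functional_linear:
  assumes "evaluation_functional L"
  shows "L (\<lambda>y. \<Sum>i\<in>I. c i * h i y) = (\<Sum>i\<in>I. c i * L (h i))"
proof -
  obtain S m where S: "finite S" "\<And>h. L h = (\<Sum>y\<in>S. m y * h y)"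
    using assms by (auto simp: evaluation_functional_def)
  have "L (\<lambda>y. \<Sum>i\<in>I. c i * h i y) = (\<Sum>y\<in>S. \<Sum>i\<in>I. c i * (m y * h i y))"
    unfolding S(2) by (simp add: sum_distrib_left mult_ac)
  also have "\<dots> = (\<Sum>i\<in>I. c i * L (h i))"
    unfolding S(2) by (subst sum.swap) (simp add: sum_distrib_left)
  finally show ?thesis .
qed

lemma evaluation_functional_holomorphic:
  assumes "evaluation_functional L" "\<And>y. (\<lambda>z. h z y) holomorphic_on UNIV"
  shows "(\<lambda>z. L (h z)) holomorphic_on UNIV"
proof -
  obtain S m where S: "finite S" "\<And>h. L h = (\<Sum>y\<in>S. m y * h y)"
    using assms(1) by (auto simp: evaluation_functional_def)
  show ?thesis unfolding S(2) by (intro holomorphic_intros assms(2))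
qed

text \<open>Induction on the number of functions. The new function minus its projection to the old ones is nonzero at
  some point \<open>y0\<close>; evaluating this remainder at \<open>y0\<close> gives the new functional, which is then used to correct
  the old ones.\<close>

lemma dual_evaluations:
  fixes f :: "'i \<Rightarrow> 'a \<Rightarrow> complex"
  assumes "finite I" "\<forall>c. (\<forall>y. (\<Sum>i\<in>I. c i * f i y) = 0) \<longrightarrow> (\<forall>i\<in>I. c i = 0)"
  shows "\<exists>L. (\<forall>i. evaluation_functional (L i)) \<and> (\<forall>i\<in>I. \<forall>j\<in>I. L i (f j) = (if i = j then 1 else 0))"
  using assms
proof (induction I)
  case empty
  show ?case by (intro exI[of _ "\<lambda>_ _. 0"]) (simp add: evaluation_functional_0)
next
  case (insert a I)
  have indep: "c i = 0" if "\<forall>y. (\<Sum>i\<in>insert a I. c i * f i y) = 0" "i \<in> insert a I" for c i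
    using insert.prems that by blast
  have "\<forall>c. (\<forall>y. (\<Sum>i\<in>I. c i * f i y) = 0) \<longrightarrow> (\<forall>i\<in>I. c i = 0)"
  proof (intro allI impI ballI)
    fix c i assume c: "\<forall>y. (\<Sum>i\<in>I. c i * f i y) = 0" and i: "i \<in> I"
    have "\<forall>y. (\<Sum>i\<in>insert a I. (c(a := 0)) i * f i y) = 0"
    proof
      fix y
      have "(\<Sum>i\<in>I. (c(a := 0)) i * f i y) = (\<Sum>i\<in>I. c i * f i y)"
        using insert.hyps by (intro sum.cong) auto
      then show "(\<Sum>i\<in>insert a I. (c(a := 0)) i * f i y) = 0"
        using insert.hyps c by simp
    qed
    from indep[OF this, of i] i insert.hyps show "c i = 0" by (auto split: if_splits)
  qed
  from insert.IH[OF this] obtain L where L0: "\<forall>i. evaluation_functional (L i)"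
      "\<forall>i\<in>I. \<forall>j\<in>I. L i (f j) = (if i = j then 1 else 0)"
    by (elim exE conjE) (rule that)
  note L = L0(1)[rule_format] L0(2)[rule_format]
  define g where "g y = f a y - (\<Sum>i\<in>I. L i (f a) * f i y)" for y
  have "\<exists>y. g y \<noteq> 0"
  proof (rule ccontr)
    assume no: "\<nexists>y. g y \<noteq> 0"
    define c where "c i = (if i = a then 1 else - L i (f a))" for i
    have "(\<Sum>i\<in>insert a I. c i * f i y) = 0" for y
    proof -
      have "(\<Sum>i\<in>I. c i * f i y) = (\<Sum>i\<in>I. - (L i (f a) * f i y))"
        using insert.hyps by (intro sum.cong) (auto simp: c_def)
      then have "(\<Sum>i\<in>insert a I. c i * f i y) = g y"
        using insert.hyps by (simp add: c_def g_def sum_negf)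
      then show ?thesis using no by simp
    qed
    then have "\<forall>y. (\<Sum>i\<in>insert a I. c i * f i y) = 0" by blast
    from indep[OF this, of a] show False by (simp add: c_def)
  qed
  then obtain y0 where y0: "g y0 \<noteq> 0" by blast
  define M where "M h = inverse (g y0) * (h y0 + (\<Sum>i\<in>I. (- f i y0) * L i h))" for h
  have M: "evaluation_functional M"
    unfolding M_def
    by (intro evaluation_functional_scale evaluation_functional_add evaluation_functional_eval
        evaluation_functional_sum L)
  have Mj: "M (f j) = 0" if "j \<in> I" for j
  proof -
    have "(\<Sum>i\<in>I. (- f i y0) * L i (f j)) = (\<Sum>i\<in>I. if i = j then - f j y0 else 0)"
      using that L(2) by (intro sum.cong) auto
    then show ?thesis using that insert.hyps by (simp add: M_def)
  qed
  have Ma: "M (f a) = 1"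
  proof -
    have "f a y0 + (\<Sum>i\<in>I. (- f i y0) * L i (f a)) = g y0"
      by (simp add: g_def sum_negf mult.commute)
    then show ?thesis using y0 by (simp add: M_def)
  qed
  define L' where "L' i = (if i = a then M else (\<lambda>h. L i h + (- L i (f a)) * M h))" for i
  have "evaluation_functional (L' i)" for i
  proof (cases "i = a")
    case True
    then show ?thesis using M by (simp add: L'_def)
  next
    case False
    have "evaluation_functional (\<lambda>h. L i h + (- L i (f a)) * M h)"
      by (rule evaluation_functional_add[OF L(1) evaluation_functional_scale[OF M]])
    then show ?thesis by (simp only: L'_def False if_False)
  qed
  moreover have "\<forall>i\<in>insert a I. \<forall>j\<in>insert a I. L' i (f j) = (if i = j then 1 else 0)"
    using insert.hyps L(2) Mj Ma by (auto simp: L'_def)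
  ultimately show ?case by (intro exI[of _ L']) blast
qed

section \<open>Division by the theta factors\<close>

context theta_basis_data
begin

lemma theta_spaceI:
  assumes "entire_in p f" "\<And>j z. j \<in> {1..p} \<Longrightarrow> f (z(j := z j + 1)) = f z"
    "\<And>j z. j \<in> {1..p} \<Longrightarrow> f (z(j := z j + \<tau>)) = theta_mult \<tau> ns j (coord0 p z) * f z"
  shows "f \<in> theta_space \<tau> ns"
  unfolding theta_space_def
proof (intro CollectI conjI ballI allI assms(1,2))
  fix j z assume j: "j \<in> {1..p}"
  then have "coord0 p z j = z j" by (simp add: coord0_def)
  then show "f (z(j := z j + \<tau>)) = (-1) powi (ns ! (j - 1)) *
          e2pi (- (of_int (ns ! (j - 1)) * z j - coord0 p z (j - 1) - coord0 p z (j + 1)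
                   - ((if j = 1 then 1 else 0) - 1) * \<tau>)) * f z"
    unfolding assms(3)[OF j] theta_mult_def by simp
qed

lemma theta_space_plus_tau:
  assumes "f \<in> theta_space \<tau> ns" "j \<in> {1..p}"
  shows "f (z(j := z j + \<tau>)) = theta_mult \<tau> ns j (coord0 p z) * f z"
proof -
  have "coord0 p z j = z j" using assms by (simp add: coord0_def)
  then show ?thesis
    using assms unfolding theta_space_def theta_mult_def by simp
qed

lemma theta_space_plus_1:
  assumes "f \<in> theta_space \<tau> ns" "j \<in> {1..p}"
  shows "f (z(j := z j + 1)) = f z"
  using assms unfolding theta_space_def by blast

lemma theta_space_entire: "f \<in> theta_space \<tau> ns \<Longrightarrow> entire_in p f"
  unfolding theta_space_def by blast

lemma entire_in_cong: "entire_in p f \<Longrightarrow> (\<And>j. j \<in> {1..p} \<Longrightarrow> z j = z' j) \<Longrightarrow> f z = f z'"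
  unfolding entire_in_def by blast

lemma theta_space_diff:
  assumes "f \<in> theta_space \<tau> ns" "g \<in> theta_space \<tau> ns"
  shows "(\<lambda>y. f y - g y) \<in> theta_space \<tau> ns"
proof (rule theta_spaceI)
  note e = assms[THEN theta_space_entire]
  show "entire_in p (\<lambda>y. f y - g y)"
  proof (rule entire_inI)
    show "sep_entire (\<lambda>y. f y - g y)"
      by (intro sep_entire_diff entire_in_sep_entire[OF e(1)] entire_in_sep_entire[OF e(2)])
    show "f z - g z = f z' - g z'" if "\<And>j. j \<in> {1..p} \<Longrightarrow> z j = z' j" for z z'
      using entire_in_cong[OF e(1), of z z'] entire_in_cong[OF e(2), of z z'] that by simp
  qed
qed (simp_all add: theta_space_plus_1[OF assms(1)] theta_space_plus_1[OF assms(2)]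
    theta_space_plus_tau[OF assms(1)] theta_space_plus_tau[OF assms(2)] right_diff_distrib)

lemma theta_space_sum_w: "(\<lambda>y. \<Sum>i\<in>I. c i * w (f i) y) \<in> theta_space \<tau> ns"
proof (rule theta_spaceI)
  show "entire_in p (\<lambda>y. \<Sum>i\<in>I. c i * w (f i) y)"
  proof (rule entire_inI)
    show "sep_entire (\<lambda>y. \<Sum>i\<in>I. c i * w (f i) y)"
      by (intro sep_entire_sum sep_entire_mult sep_entire_const w_sep_entire)
    show "(\<Sum>i\<in>I. c i * w (f i) z) = (\<Sum>i\<in>I. c i * w (f i) z')"
      if "\<And>j. j \<in> {1..p} \<Longrightarrow> z j = z' j" for z z'
      using w_cong[of z z'] that by simp
  qed
qed (simp_all add: w_plus_1 w_plus_tau sum_distrib_left mult_ac)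

lemma w_independent:
  "(\<And>y. (\<Sum>\<alpha>\<in>{0..<int n}. c \<alpha> * w \<alpha> y) = 0) \<Longrightarrow> \<alpha> \<in> {0..<int n} \<Longrightarrow> c \<alpha> = 0"
  using basis unfolding theta_basis_def by blast

lemma w_span:
  assumes "f \<in> theta_space \<tau> ns"
  obtains c where "\<And>y. f y = (\<Sum>\<alpha>\<in>{0..<int n}. c \<alpha> * w \<alpha> y)"
  using basis assms unfolding theta_basis_def by blast

text \<open>The last conjunct confines the dependence to the coordinates \<open>0, \<dots>, p\<close>, without which the quotient could not be
  composed with entire changes of coordinates.\<close>

definition quot_spec :: "complex \<Rightarrow> (nat \<Rightarrow> complex) \<Rightarrow> int \<Rightarrow> int \<Rightarrow> ((nat \<Rightarrow> complex) \<Rightarrow> complex) \<Rightarrow> bool" where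
  "quot_spec \<eta> Y a b q \<longleftrightarrow> sep_entire q \<and> (\<forall>x. numer \<eta> Y a b x = (\<Prod>j\<in>{1..p}. tht (x j)) * q x) \<and>
    (\<forall>x x'. (\<forall>j\<in>{0..p}. x j = x' j) \<longrightarrow> q x = q x')"

lemma numer_cong:
  assumes "\<And>j. j \<in> {0..p} \<Longrightarrow> x j = x' j"
  shows "numer \<eta> Y a b x = numer \<eta> Y a b x'"
proof -
  have "offset \<eta> x = offset \<eta> x'" using assms by (auto simp: offset_def fun_eq_iff)
  then have "kern \<eta> t x = kern \<eta> t x'" for t by (simp add: kern_def)
  moreover have "w a (arg1 \<eta> Y t x) = w a (arg1 \<eta> Y t x')" for t
    by (rule w_cong) (use assms in \<open>auto simp: arg1_def\<close>)
  moreover have "w b (arg2 Y t x) = w b (arg2 Y t x')" for t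
    by (rule w_cong) (use assms in \<open>auto simp: arg2_def\<close>)
  ultimately show ?thesis by (simp add: numer_def)
qed

definition quot :: "complex \<Rightarrow> (nat \<Rightarrow> complex) \<Rightarrow> int \<Rightarrow> int \<Rightarrow> (nat \<Rightarrow> complex) \<Rightarrow> complex" where
  "quot \<eta> Y a b = (SOME q. quot_spec \<eta> Y a b q)"

lemma quot_spec: "quot_spec \<eta> Y a b (quot \<eta> Y a b)"
  unfolding quot_def
proof (rule someI_ex[of "quot_spec \<eta> Y a b"])
  obtain q where q: "sep_entire q" "\<And>x. numer \<eta> Y a b x = (\<Prod>j\<in>{1..p}. tht (x j)) * q x"
  proof -
    have v: "\<And>z j. j \<in> {1..p} \<Longrightarrow> z j \<in> period_lattice \<tau> \<Longrightarrow> numer \<eta> Y a b z = 0"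
      by (rule numer_lattice)
    show thesis
      by (rule sep_entire_divide_thetas[OF \<tau> sep_entire_numer[of \<eta> Y a b] finite_atLeastAtMost[of 1 p] v])
        (assumption, assumption, rule that)
  qed
  define r where "r x = (\<lambda>i. if i \<in> {0..p} then x i else 0)" for x :: "nat \<Rightarrow> complex"
  have 1: "numer \<eta> Y a b x = (\<Prod>j\<in>{1..p}. tht (x j)) * q (r x)" for x
  proof -
    have "numer \<eta> Y a b x = numer \<eta> Y a b (r x)" by (rule numer_cong) (simp add: r_def)
    moreover have "(\<Prod>j\<in>{1..p}. tht (r x j)) = (\<Prod>j\<in>{1..p}. tht (x j))"
      by (intro prod.cong) (auto simp: r_def)
    ultimately show ?thesis using q(2)[of "r x"] by simp
  qed
  have 2: "sep_entire (\<lambda>x. q (r x))"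
    unfolding r_def by (rule sep_entire_restrict[OF q(1)])
  have 3: "r x = r x'" if "\<forall>j\<in>{0..p}. x j = x' j" for x x'
    using that by (auto simp: r_def fun_eq_iff)
  have "quot_spec \<eta> Y a b (\<lambda>x. q (r x))"
    unfolding quot_spec_def using 1 2 3 by (intro conjI allI impI) (blast, blast, simp only:)
  then show "\<exists>q. quot_spec \<eta> Y a b q" by blast
qed

lemma quot_sep_entire: "sep_entire (quot \<eta> Y a b)"
  using quot_spec unfolding quot_spec_def by blast

lemma numer_quot: "numer \<eta> Y a b x = (\<Prod>j\<in>{1..p}. tht (x j)) * quot \<eta> Y a b x"
  using quot_spec unfolding quot_spec_def by blast

lemma quot_cong: "\<forall>j\<in>{0..p}. x j = x' j \<Longrightarrow> quot \<eta> Y a b x = quot \<eta> Y a b x'"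
  using quot_spec unfolding quot_spec_def by blast

text \<open>Identities for \<open>quot\<close> are inherited from \<open>numer\<close> by cancelling the theta factors; coordinates outside \<open>1, \<dots>, p\<close> are held
  fixed, which permits identities valid for \<open>z = 0\<close> only.\<close>

lemma quot_eqI:
  assumes "sep_entire F" "sep_entire G"
    "\<And>x. (\<And>i. i \<notin> {1..p} \<Longrightarrow> x i = x0 i) \<Longrightarrow> (\<Prod>j\<in>{1..p}. tht (x j)) * F x = (\<Prod>j\<in>{1..p}. tht (x j)) * G x"
  shows "F x0 = G x0"
proof -
  have "F x0 - G x0 = 0"
  proof (rule sep_entire_theta_cancel[OF \<tau> sep_entire_diff[OF assms(1,2)] finite_atLeastAtMost])
    show "(\<Prod>j\<in>{1..p}. tht (x j)) * (F x - G x) = 0" if "\<And>i. i \<notin> {1..p} \<Longrightarrow> x i = x0 i" for x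
      using assms(3)[OF that] by (simp add: right_diff_distrib)
  qed
  then show ?thesis by simp
qed

lemma prod_theta_plus_1:
  "(\<Prod>i\<in>{1..p}. tht ((x(j := x j + 1)) i)) = (\<Prod>i\<in>{1..p}. tht (x i))"
  by (intro prod.cong) (auto simp: theta_plus_1)

lemma prod_theta_plus_tau:
  "j \<in> {1..p} \<Longrightarrow> (\<Prod>i\<in>{1..p}. tht ((x(j := x j + \<tau>)) i)) = - e2pi (- x j) * (\<Prod>i\<in>{1..p}. tht (x i))"
  by (rule prod_upd_scale[of _ j]) (auto simp: theta_plus_tau)

lemma prod_theta_upd_0: "(\<Prod>i\<in>{1..p}. tht ((x(0 := v)) i)) = (\<Prod>i\<in>{1..p}. tht (x i))"
  by (intro prod.cong) auto

lemma sep_entire_e2pi: "sep_entire f \<Longrightarrow> sep_entire (\<lambda>x. e2pi (f x))"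
  by (rule sep_entire_compose1) (intro holomorphic_intros)

lemma sep_entire_ycoord: "sep_entire (\<lambda>x. ycoord \<eta> Y x i)"
  unfolding ycoord_def by (intro sep_entire_diff sep_entire_add sep_entire_mult sep_entire_coord sep_entire_const)

lemma sep_entire_coord0: "(\<And>i. sep_entire (\<lambda>x. f x i)) \<Longrightarrow> sep_entire (\<lambda>x. coord0 p (f x) i)"
  by (cases "i \<in> {1..p}") (auto simp: coord0_def)

lemma quot_plus_1:
  assumes "j \<in> {1..p}"
  shows "quot \<eta> Y a b (x(j := x j + 1)) = quot \<eta> Y a b x"
proof (rule quot_eqI[of "\<lambda>x. quot \<eta> Y a b (x(j := x j + 1))"])
  show "(\<Prod>i\<in>{1..p}. tht (x i)) * quot \<eta> Y a b (x(j := x j + 1)) = (\<Prod>i\<in>{1..p}. tht (x i)) * quot \<eta> Y a b x" for x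
    using numer_plus_1[OF assms, of \<eta> Y a b x] unfolding numer_quot prod_theta_plus_1 .
qed (rule sep_entire_shift[OF quot_sep_entire], rule quot_sep_entire)

lemma quot_plus_tau:
  assumes j: "j \<in> {1..p}"
  shows "quot \<eta> Y a b (x(j := x j + \<tau>)) = theta_mult \<tau> ns j (coord0 p (ycoord \<eta> Y x)) * quot \<eta> Y a b x"
proof (rule quot_eqI[of "\<lambda>x. quot \<eta> Y a b (x(j := x j + \<tau>))" "\<lambda>x. theta_mult \<tau> ns j (coord0 p (ycoord \<eta> Y x)) * quot \<eta> Y a b x"])
  show "(\<Prod>i\<in>{1..p}. tht (x i)) * quot \<eta> Y a b (x(j := x j + \<tau>)) =
      (\<Prod>i\<in>{1..p}. tht (x i)) * (theta_mult \<tau> ns j (coord0 p (ycoord \<eta> Y x)) * quot \<eta> Y a b x)" for x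
  proof -
    have "- e2pi (- x j) * ((\<Prod>i\<in>{1..p}. tht (x i)) * quot \<eta> Y a b (x(j := x j + \<tau>))) =
      - e2pi (- x j) * ((\<Prod>i\<in>{1..p}. tht (x i)) * (theta_mult \<tau> ns j (coord0 p (ycoord \<eta> Y x)) * quot \<eta> Y a b x))"
      using numer_plus_tau[OF j, of \<eta> Y a b x] unfolding numer_quot prod_theta_plus_tau[OF j]
      by (simp only: mult_ac)
    then show ?thesis by (simp only: mult_left_cancel neg_equal_0_iff_equal e2pi_nonzero not_False_eq_True)
  qed
  show "sep_entire (\<lambda>x. theta_mult \<tau> ns j (coord0 p (ycoord \<eta> Y x)) * quot \<eta> Y a b x)"
    unfolding theta_mult_def
    by (intro sep_entire_mult sep_entire_const sep_entire_e2pi sep_entire_minus sep_entire_diff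
        sep_entire_coord0 sep_entire_ycoord quot_sep_entire)
qed (rule sep_entire_shift[OF quot_sep_entire])

lemma quot_shift_one:
  "quot \<eta> Y a b (x(0 := x 0 + 1 / of_nat n)) = e2pi ((of_nat n - of_nat k) / of_nat n * of_int b) * quot \<eta> Y a b x"
proof (rule quot_eqI[of "\<lambda>x. quot \<eta> Y a b (x(0 := x 0 + 1 / of_nat n))" "\<lambda>x. e2pi ((of_nat n - of_nat k) / of_nat n * of_int b) * quot \<eta> Y a b x"])
  show "(\<Prod>i\<in>{1..p}. tht (x i)) * quot \<eta> Y a b (x(0 := x 0 + 1 / of_nat n)) =
      (\<Prod>i\<in>{1..p}. tht (x i)) * (e2pi ((of_nat n - of_nat k) / of_nat n * of_int b) * quot \<eta> Y a b x)" for x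
    using numer_shift_one[of \<eta> Y a b x] unfolding numer_quot prod_theta_upd_0 by (simp only: mult_ac)
qed (rule sep_entire_shift[OF quot_sep_entire], rule sep_entire_mult[OF sep_entire_const quot_sep_entire])

lemma quot_shift_tau:
  "quot \<eta> Y a b (x(0 := x 0 + \<tau> / of_nat n)) =
    - e2pi (- of_nat n * x 0 - \<tau> - ycoord \<eta> Y x 1 - \<eta> - \<phi>) * quot \<eta> Y a (b + 1) x"
proof (rule quot_eqI[of "\<lambda>x. quot \<eta> Y a b (x(0 := x 0 + \<tau> / of_nat n))" "\<lambda>x. - e2pi (- of_nat n * x 0 - \<tau> - ycoord \<eta> Y x 1 - \<eta> - \<phi>) * quot \<eta> Y a (b + 1) x"])
  show "(\<Prod>i\<in>{1..p}. tht (x i)) * quot \<eta> Y a b (x(0 := x 0 + \<tau> / of_nat n)) =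
      (\<Prod>i\<in>{1..p}. tht (x i)) * (- e2pi (- of_nat n * x 0 - \<tau> - ycoord \<eta> Y x 1 - \<eta> - \<phi>) * quot \<eta> Y a (b + 1) x)" for x
    using numer_shift_tau[of \<eta> Y a b x] unfolding numer_quot prod_theta_upd_0 by (simp only: mult_ac)
qed (rule sep_entire_shift[OF quot_sep_entire], intro sep_entire_mult sep_entire_minus sep_entire_diff
    sep_entire_const sep_entire_e2pi sep_entire_coord sep_entire_ycoord quot_sep_entire)

lemma quot_at_0:
  assumes "x 0 = 0"
  shows "quot \<eta> Y a b x = tht (of_nat n * \<eta>) * (w a (ycoord \<eta> Y x) * w b Y)"
proof (rule quot_eqI[of "quot \<eta> Y a b" "\<lambda>x. tht (of_nat n * \<eta>) * (w a (ycoord \<eta> Y x) * w b Y)"])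
  show "(\<Prod>i\<in>{1..p}. tht (x' i)) * quot \<eta> Y a b x' =
      (\<Prod>i\<in>{1..p}. tht (x' i)) * (tht (of_nat n * \<eta>) * (w a (ycoord \<eta> Y x') * w b Y))"
    if "\<And>i. i \<notin> {1..p} \<Longrightarrow> x' i = x i" for x'
  proof -
    have "x' 0 = 0" using that[of 0] assms by simp
    then show ?thesis
      using numer_at_0[of x' \<eta> Y a b] unfolding numer_quot by blast
  qed
  show "sep_entire (\<lambda>x. tht (of_nat n * \<eta>) * (w a (ycoord \<eta> Y x) * w b Y))"
    by (rule sep_entire_mult[OF sep_entire_const sep_entire_mult[OF
          w_compose[of "\<lambda>j x. ycoord \<eta> Y x j", OF sep_entire_ycoord] sep_entire_const]])
qed (rule quot_sep_entire)

text \<open>The inverse of \<open>ycoord\<close>: it recovers \<open>s\<^sub>j\<close> from \<open>y\<close> and \<open>z\<close>.\<close>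

definition xcoord :: "complex \<Rightarrow> (nat \<Rightarrow> complex) \<Rightarrow> complex \<Rightarrow> (nat \<Rightarrow> complex) \<Rightarrow> nat \<Rightarrow> complex" where
  "xcoord \<eta> Y z y j = (if j = 0 then z else y j - Y j + of_int (gamma_coef j) * z + of_int (mu_coef j) * \<eta>)"

lemma xcoord_0 [simp]: "xcoord \<eta> Y z y 0 = z"
  by (simp add: xcoord_def)

lemma ycoord_xcoord: "j \<noteq> 0 \<Longrightarrow> ycoord \<eta> Y (xcoord \<eta> Y z y) j = y j"
  by (simp add: ycoord_def xcoord_def)

lemma coord0_ycoord_xcoord: "coord0 p (ycoord \<eta> Y (xcoord \<eta> Y z y)) = coord0 p y"
  by (auto simp: coord0_def ycoord_xcoord fun_eq_iff)

lemma xcoord_upd: "j \<noteq> 0 \<Longrightarrow> xcoord \<eta> Y z (y(j := y j + c)) = (xcoord \<eta> Y z y)(j := xcoord \<eta> Y z y j + c)"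
  by (auto simp: xcoord_def fun_eq_iff)

lemma quot_theta_space: "(\<lambda>y. quot \<eta> Y a b (xcoord \<eta> Y z y)) \<in> theta_space \<tau> ns"
proof (rule theta_spaceI)
  show "entire_in p (\<lambda>y. quot \<eta> Y a b (xcoord \<eta> Y z y))"
  proof (rule entire_inI)
    have x: "sep_entire (\<lambda>y. xcoord \<eta> Y z y j)" for j
    proof (cases "j = 0")
      case False
      have "sep_entire (\<lambda>y. y j - Y j + of_int (gamma_coef j) * z + of_int (mu_coef j) * \<eta>)"
        by (intro sep_entire_add sep_entire_diff sep_entire_coord sep_entire_const)
      with False show ?thesis by (simp only: xcoord_def if_False)
    qed simp
    show "sep_entire (\<lambda>y. quot \<eta> Y a b (xcoord \<eta> Y z y))"
      by (rule sep_entire_compose[OF quot_sep_entire finite_atLeastAtMost quot_cong x])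
    show "quot \<eta> Y a b (xcoord \<eta> Y z y) = quot \<eta> Y a b (xcoord \<eta> Y z y')"
      if "\<And>j. j \<in> {1..p} \<Longrightarrow> y j = y' j" for y y'
      by (rule quot_cong) (use that in \<open>auto simp: xcoord_def\<close>)
  qed
  fix j y assume j: "j \<in> {1..p}"
  then have j0: "j \<noteq> 0" by auto
  show "quot \<eta> Y a b (xcoord \<eta> Y z (y(j := y j + 1))) = quot \<eta> Y a b (xcoord \<eta> Y z y)"
    unfolding xcoord_upd[OF j0] by (rule quot_plus_1[OF j])
  show "quot \<eta> Y a b (xcoord \<eta> Y z (y(j := y j + \<tau>))) =
      theta_mult \<tau> ns j (coord0 p y) * quot \<eta> Y a b (xcoord \<eta> Y z y)"
    unfolding xcoord_upd[OF j0] quot_plus_tau[OF j] coord0_ycoord_xcoord ..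
qed

section \<open>The exchange identity\<close>

abbreviation thi where "thi \<equiv> theta_idx \<tau> n"

abbreviation cof where "cof \<equiv> theta_cofactor \<tau> n"

definition theta_P0 :: complex where
  "theta_P0 = (\<Prod>i\<in>{1..<int n}. theta_idx \<tau> n i 0)"

lemma theta_P0_nonzero: "theta_P0 \<noteq> 0"
  unfolding theta_P0_def by (rule theta_idx_prod_nonzero_at_0[OF \<tau> n_pos])

text \<open>The structure constant of \<open>Z\<close> in front of \<open>w\<^sub>b\<^sub>+\<^sub>r(y)\<close>, with denominators cleared by \<open>\<theta>(n z)\<close> and \<open>\<theta>(n \<eta>)\<close>, times
  \<open>w\<^sub>a\<^sub>-\<^sub>r(Y)\<close>. The exponential turns \<open>\<theta>(n z)\<close> into \<open>- \<theta>(s\<^sub>0)\<close>, the factor by which \<open>numer\<close> was cleared.\<close>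

definition rhs_coef :: "complex \<Rightarrow> (nat \<Rightarrow> complex) \<Rightarrow> int \<Rightarrow> int \<Rightarrow> int \<Rightarrow> complex \<Rightarrow> complex" where
  "rhs_coef \<eta> Y a b r z = e2pi (- of_nat n * z) * (theta_const \<tau> n / theta_P0) *
     (thi (b - a + r * (int k + 1)) (z + \<eta>) * cof (int k * r) \<eta> * cof (b - a + r) z) * w (a - r) Y"

lemma thi_holomorphic: "f holomorphic_on UNIV \<Longrightarrow> (\<lambda>z. thi j (f z)) holomorphic_on UNIV"
  using holomorphic_on_compose_gen[OF _ theta_idx_holomorphic[OF \<tau> n_pos], of f UNIV j] by (simp add: o_def)

lemma cof_holomorphic: "f holomorphic_on UNIV \<Longrightarrow> (\<lambda>z. cof j (f z)) holomorphic_on UNIV"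
  using holomorphic_on_compose_gen[OF _ theta_cofactor_holomorphic[OF \<tau> n_pos], of f UNIV j] by (simp add: o_def)

lemma rhs_coef_holomorphic: "(\<lambda>z. rhs_coef \<eta> Y a b r z) holomorphic_on UNIV"
  unfolding rhs_coef_def
  by (intro holomorphic_on_mult holomorphic_on_const e2pi_holomorphic thi_holomorphic cof_holomorphic
      holomorphic_on_add holomorphic_on_ident)

lemma rhs_coef_holomorphic_eta: "(\<lambda>\<eta>. rhs_coef \<eta> Y a b r z) holomorphic_on UNIV"
  unfolding rhs_coef_def
  by (intro holomorphic_on_mult holomorphic_on_const thi_holomorphic cof_holomorphic
      holomorphic_on_add holomorphic_on_ident)

text \<open>Together with the eigenvalue of \<open>w\<^sub>b\<^sub>+\<^sub>r\<close> under the translation the factors depending on \<open>r\<close> cancel; the shift of the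
  index by \<open>r (k + 1)\<close> in \<open>rhs_coef\<close> is what makes this work.\<close>

lemma rhs_coef_plus_inverse:
  "rhs_coef \<eta> Y a b r (z + 1 / of_nat n) * e2pi ((of_nat n - of_nat k) / of_nat n * of_int (b + r))
    = e2pi ((of_nat n - of_nat k) / of_nat n * of_int b) * rhs_coef \<eta> Y a b r z"
proof -
  have n0: "(of_nat n :: complex) \<noteq> 0" using n_pos by simp
  let ?j = "b - a + r * (int k + 1)" and ?l = "b - a + r"
  have 1: "thi ?j (z + 1 / of_nat n + \<eta>) = e2pi (of_int ?j / of_nat n) * thi ?j (z + \<eta>)"
    using theta_idx_plus_inverse[OF \<tau> n_pos, of ?j "z + \<eta>"] by (simp only: add_ac)
  have 2: "cof ?l (z + 1 / of_nat n) = e2pi (- of_int ?l / of_nat n) * cof ?l z"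
    by (rule theta_cofactor_plus_inverse[OF \<tau> n_pos])
  have 3: "e2pi (- of_nat n * (z + 1 / of_nat n)) = e2pi (- of_nat n * z)"
  proof -
    have "- of_nat n * (z + 1 / of_nat n) = - of_nat n * z - 1" using n0 by (simp add: distrib_left)
    then show ?thesis by (simp only: e2pi_diff e2pi_1 div_by_1)
  qed
  have "of_int ?j / of_nat n + - of_int ?l / of_nat n + (of_nat n - of_nat k) / of_nat n * of_int (b + r)
     = (of_nat n - of_nat k) / of_nat n * of_int b + (of_int r :: complex)"
    using n0 by (simp add: divide_simps) (simp add: algebra_simps)
  then have 4: "e2pi (of_int ?j / of_nat n) * e2pi (- of_int ?l / of_nat n) * e2pi ((of_nat n - of_nat k) / of_nat n * of_int (b + r))
     = e2pi ((of_nat n - of_nat k) / of_nat n * of_int b)"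
    by (simp only: e2pi_add[symmetric]) (simp only: e2pi_add e2pi_of_int mult_1_right)
  show ?thesis
    unfolding rhs_coef_def 1 2 3 4[symmetric] by (simp only: mult_ac)
qed

lemma rhs_coef_plus_tau:
  "rhs_coef \<eta> Y a b r (z + \<tau> / of_nat n) = - e2pi (- of_nat n * z - \<tau> - \<eta>) * rhs_coef \<eta> Y a (b + 1) r z"
proof -
  have n0: "(of_nat n :: complex) \<noteq> 0" using n_pos by simp
  let ?j = "b - a + r * (int k + 1)" and ?l = "b - a + r"
  let ?X = "\<lambda>u. - u + (of_nat n - 1) / (2 * of_nat n) * \<tau> - 1 / (2 * of_nat n)"
  have j: "?j + 1 = b + 1 - a + r * (int k + 1)" "?l + 1 = b + 1 - a + r" by simp_all
  have 1: "thi ?j (z + \<tau> / of_nat n + \<eta>) = e2pi (?X (z + \<eta>)) * thi (b + 1 - a + r * (int k + 1)) (z + \<eta>)"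
    using theta_idx_plus_tau_div[OF \<tau> n_pos, of ?j "z + \<eta>"] unfolding j by (simp only: add_ac)
  have 2: "cof ?l (z + \<tau> / of_nat n) = - e2pi (- of_nat n * z - ?X z) * cof (b + 1 - a + r) z"
    using theta_cofactor_plus_tau_div[OF \<tau> n_pos, of ?l z] unfolding j .
  have 3: "- of_nat n * (z + \<tau> / of_nat n) = - of_nat n * z - \<tau>" using n0 by (simp add: distrib_left)
  have "- of_nat n * z - \<tau> + ?X (z + \<eta>) + (- of_nat n * z - ?X z) = (- of_nat n * z - \<tau> - \<eta>) + - of_nat n * z"
    by simp
  then have 4: "e2pi (- of_nat n * z - \<tau>) * e2pi (?X (z + \<eta>)) * e2pi (- of_nat n * z - ?X z)
     = e2pi (- of_nat n * z - \<tau> - \<eta>) * e2pi (- of_nat n * z)"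
    by (simp only: e2pi_add[symmetric])
  have gen: "A * C * (B * P * R * (- G * S)) * W = - (A * B * G) * (C * (P * R * S) * W)"
    for A B C G P R S W :: complex by simp
  have gen': "- (U * V) * (C * Q * W) = - U * (V * C * Q * W)" for U V C Q W :: complex by simp
  show ?thesis
    unfolding rhs_coef_def 1 2 3 gen 4 gen' ..
qed

lemma rhs_coef_periodic: "rhs_coef \<eta> Y a (b + int n) r z = rhs_coef \<eta> Y a b r z"
proof -
  have "thi (b + int n - a + r * (int k + 1)) u = thi (b - a + r * (int k + 1)) u" for u
    using theta_idx_periodic[OF \<tau> n_pos, of "b - a + r * (int k + 1)" u] by (simp add: algebra_simps)
  moreover have "cof (b + int n - a + r) z = cof (b - a + r) z"
  proof (rule theta_cofactor_cong[OF \<tau> n_pos])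
    have "b + int n - a + r = (b - a + r) + int n" by simp
    then show "(b + int n - a + r) mod int n = (b - a + r) mod int n" by (simp only: mod_add_self2)
  qed
  ultimately show ?thesis by (simp only: rhs_coef_def)
qed

lemma w_eqI: "int n dvd \<alpha> - \<beta> \<Longrightarrow> w \<alpha> = w \<beta>"
  using w_mod[of \<alpha>] w_mod[of \<beta>] by (metis mod_eq_dvd_iff)

text \<open>At \<open>z = 0\<close> only the \<open>r\<close> congruent to \<open>a - b\<close> contributes, since the cofactor vanishes otherwise.\<close>

lemma rhs_coef_sum_at_0:
  "(\<Sum>r\<in>{0..<int n}. rhs_coef \<eta> Y a b r 0 * w (b + r) y) = tht (of_nat n * \<eta>) * (w a y * w b Y)"
proof -
  define r0 where "r0 = (a - b) mod int n"
  have r0: "r0 \<in> {0..<int n}" using n_pos by (simp add: r0_def)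
  have dv: "int n dvd (a - b) - r0" unfolding r0_def by (rule dvd_minus_mod)
  then have dv0: "int n dvd b - a + r0"
    by (metis dvd_minus_iff minus_diff_eq add.commute diff_diff_eq2 diff_add_eq)
  have "(\<Sum>r\<in>{0..<int n}. rhs_coef \<eta> Y a b r 0 * w (b + r) y) = (\<Sum>r\<in>{r0}. rhs_coef \<eta> Y a b r 0 * w (b + r) y)"
  proof (rule sum.mono_neutral_right)
    show "\<forall>r\<in>{0..<int n} - {r0}. rhs_coef \<eta> Y a b r 0 * w (b + r) y = 0"
    proof
      fix r assume r: "r \<in> {0..<int n} - {r0}"
      have "\<not> int n dvd b - a + r"
      proof
        assume "int n dvd b - a + r"
        with dv0 have "int n dvd r - r0"
          by (metis add_diff_cancel_left dvd_diff)
        then have "r mod int n = r0 mod int n" by (simp add: mod_eq_dvd_iff)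
        with r r0 show False by simp
      qed
      then have "cof (b - a + r) 0 = 0" by (simp add: theta_cofactor_at_0[OF \<tau> n_pos])
      then show "rhs_coef \<eta> Y a b r 0 * w (b + r) y = 0" by (simp add: rhs_coef_def)
    qed
  qed (use r0 in auto)
  also have "\<dots> = rhs_coef \<eta> Y a b r0 0 * w (b + r0) y" by simp
  also have "w (b + r0) = w a"
    by (rule w_eqI) (use dv0 in \<open>simp add: algebra_simps\<close>)
  also have "rhs_coef \<eta> Y a b r0 0 = tht (of_nat n * \<eta>) * w b Y"
  proof -
    have 1: "w (a - r0) = w b"
      by (rule w_eqI) (use dv in \<open>simp add: algebra_simps\<close>)
    have 2: "thi (b - a + r0 * (int k + 1)) \<eta> = thi (int k * r0) \<eta>"
    proof (rule theta_idx_cong[OF \<tau> n_pos])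
      have "(b - a + r0 * (int k + 1)) - int k * r0 = b - a + r0" by (simp add: algebra_simps)
      then show "(b - a + r0 * (int k + 1)) mod int n = (int k * r0) mod int n"
        unfolding mod_eq_dvd_iff using dv0 by (simp only:)
    qed
    have 3: "cof (b - a + r0) 0 = theta_P0 / theta_const \<tau> n"
      using dv0 by (simp add: theta_cofactor_at_0[OF \<tau> n_pos] theta_P0_def)
    have "rhs_coef \<eta> Y a b r0 0 = (theta_const \<tau> n / theta_P0 * (theta_P0 / theta_const \<tau> n)) *
        (thi (int k * r0) \<eta> * cof (int k * r0) \<eta>) * w b Y"
      unfolding rhs_coef_def 1 3 using 2 by simp
    also have "theta_const \<tau> n / theta_P0 * (theta_P0 / theta_const \<tau> n) = 1"
      using theta_P0_nonzero theta_const_nonzero[OF \<tau> n_pos] by simp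
    finally show ?thesis by (simp add: theta_idx_times_cofactor[OF \<tau> n_pos])
  qed
  finally show ?thesis by (simp add: mult_ac)
qed

lemma quot_periodic: "quot \<eta> Y a (b + int n) = quot \<eta> Y a b"
proof -
  have "numer \<eta> Y a (b + int n) = numer \<eta> Y a b"
    by (intro ext) (simp add: numer_def w_periodic)
  then have "quot_spec \<eta> Y a (b + int n) = quot_spec \<eta> Y a b"
    by (intro ext) (simp add: quot_spec_def)
  then show ?thesis by (simp add: quot_def)
qed

lemma w_dual:
  "\<exists>L. (\<forall>i. evaluation_functional (L i)) \<and>
    (\<forall>\<alpha>\<in>{0..<int n}. \<forall>\<beta>\<in>{0..<int n}. L \<alpha> (w \<beta>) = (if \<alpha> = \<beta> then 1 else 0))"
proof (rule dual_evaluations[OF finite_atLeastLessThan_int])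
  show "\<forall>c. (\<forall>y. (\<Sum>\<alpha>\<in>{0..<int n}. c \<alpha> * w \<alpha> y) = 0) \<longrightarrow> (\<forall>\<alpha>\<in>{0..<int n}. c \<alpha> = 0)"
    using basis unfolding theta_basis_def by (elim conjE)
qed

lemma coef_exchange:
  assumes d: "\<And>y. (\<Sum>\<alpha>\<in>{0..<int n}. c \<alpha> * w \<alpha> y) = (\<Sum>\<alpha>\<in>{0..<int n}. c' \<alpha> * w \<alpha> y)"
    and \<alpha>: "\<alpha> \<in> {0..<int n}"
  shows "c \<alpha> = c' \<alpha>"
proof -
  have "c \<alpha> - c' \<alpha> = 0"
  proof (rule w_independent[OF _ \<alpha>])
    show "(\<Sum>\<alpha>\<in>{0..<int n}. (c \<alpha> - c' \<alpha>) * w \<alpha> y) = 0" for y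
      using d[of y] by (simp add: left_diff_distrib sum_subtractf)
  qed
  then show ?thesis by simp
qed

text \<open>The coefficients vanish on \<open>1/n \<Gamma>\<close>, so \<open>\<theta>(v)\<close> divides them as functions of \<open>v = n z\<close>. The quotients \<open>E\<close> are permuted by the
  translation by \<open>\<tau>\<close>; iterating \<open>n\<close> times returns to the same index, and \<open>entire_quasi_periodic\<close> applies.\<close>

lemma coefficient_zero:
  fixes d :: "int \<Rightarrow> int \<Rightarrow> complex \<Rightarrow> complex"
  assumes eta: "of_nat n * \<eta> \<notin> period_lattice \<tau>"
    and hol: "\<And>b \<alpha>. d b \<alpha> holomorphic_on UNIV"
    and d0: "\<And>b \<alpha>. d b \<alpha> 0 = 0"
    and one: "\<And>b \<alpha> z. d b \<alpha> (z + 1 / of_nat n) = e2pi ((of_nat n - of_nat k) / of_nat n * of_int (b - \<alpha>)) * d b \<alpha> z"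
    and tau: "\<And>b \<alpha> z. d b \<alpha> (z + \<tau> / of_nat n) = - e2pi (- of_nat n * z - \<tau> - \<eta>) * d (b + 1) (\<alpha> + 1) z"
    and per: "\<And>b \<alpha> z. d (b + int n) (\<alpha> + int n) z = d b \<alpha> z"
  shows "d b \<alpha> z = 0"
proof -
  have n0: "(of_nat n :: complex) \<noteq> 0" using n_pos by simp
  have vanish: "\<forall>b \<alpha>. d b \<alpha> (v / of_nat n) = 0" if "v \<in> period_lattice \<tau>" for v
    using that
  proof (induction rule: lattice_induct)
    case zero
    show ?case by (simp add: d0)
  next
    case (one v)
    show ?case unfolding add_divide_distrib assms(4) by simp
  next
    case (tau v)
    have "(\<forall>b \<alpha>. d (b + 1) (\<alpha> + 1) u = 0) \<longleftrightarrow> (\<forall>b \<alpha>. d b \<alpha> u = 0)" for u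
      by (metis diff_add_cancel)
    then show ?case unfolding add_divide_distrib assms(5) by simp
  qed
  have holn: "(\<lambda>v. d b \<alpha> (v / of_nat n)) holomorphic_on UNIV" for b \<alpha>
    using holomorphic_on_compose_gen[OF _ hol, of "\<lambda>v. v / of_nat n" UNIV] n0
    by (simp add: o_def holomorphic_on_divide holomorphic_on_ident)
  have "\<exists>E. E holomorphic_on UNIV \<and> (\<forall>v. d b \<alpha> (v / of_nat n) = tht v * E v)" for b \<alpha>
    using entire_divide_theta[OF \<tau> holn] vanish by metis
  then obtain E where E: "\<And>b \<alpha>. E b \<alpha> holomorphic_on UNIV"
      "\<And>b \<alpha> v. d b \<alpha> (v / of_nat n) = tht v * E b \<alpha> v"
    by metis
  have Eh: "(\<lambda>v. E b \<alpha> (v + h)) holomorphic_on UNIV" for b \<alpha> h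
    using holomorphic_on_compose_gen[OF _ E(1), of "\<lambda>v. v + h" UNIV]
    by (simp add: o_def holomorphic_on_add holomorphic_on_ident)
  have E1: "E b \<alpha> (v + 1) = e2pi ((of_nat n - of_nat k) / of_nat n * of_int (b - \<alpha>)) * E b \<alpha> v" for b \<alpha> v
  proof (rule theta_mult_cancel[OF \<tau>, of "\<lambda>v. E b \<alpha> (v + 1)" "\<lambda>v. e2pi ((of_nat n - of_nat k) / of_nat n * of_int (b - \<alpha>)) * E b \<alpha> v"])
    show "tht v * E b \<alpha> (v + 1) = tht v * (e2pi ((of_nat n - of_nat k) / of_nat n * of_int (b - \<alpha>)) * E b \<alpha> v)" for v
      using one[of b \<alpha> "v / of_nat n"] unfolding add_divide_distrib[symmetric] E(2) theta_plus_1 by (simp only: mult_ac)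
  qed (rule Eh, intro holomorphic_on_mult holomorphic_on_const E(1))
  have E2: "E b \<alpha> (v + \<tau>) = e2pi (- \<tau> - \<eta>) * E (b + 1) (\<alpha> + 1) v" for b \<alpha> v
  proof (rule theta_mult_cancel[OF \<tau>, of "\<lambda>v. E b \<alpha> (v + \<tau>)" "\<lambda>v. e2pi (- \<tau> - \<eta>) * E (b + 1) (\<alpha> + 1) v"])
    fix v
    have x: "- of_nat n * (v / of_nat n) - \<tau> - \<eta> = - v + (- \<tau> - \<eta>)" using n0 by simp
    have "- e2pi (- v) * (tht v * E b \<alpha> (v + \<tau>)) = - e2pi (- v) * (tht v * (e2pi (- \<tau> - \<eta>) * E (b + 1) (\<alpha> + 1) v))"
      using tau[of b \<alpha> "v / of_nat n"] unfolding add_divide_distrib[symmetric] E(2) theta_plus_tau x e2pi_add[of "- v" "- \<tau> - \<eta>"]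
      by (simp only: mult_ac mult_minus_left mult_minus_right)
    then show "tht v * E b \<alpha> (v + \<tau>) = tht v * (e2pi (- \<tau> - \<eta>) * E (b + 1) (\<alpha> + 1) v)"
      by (simp only: mult_left_cancel neg_equal_0_iff_equal e2pi_nonzero not_False_eq_True)
  qed (rule Eh, intro holomorphic_on_mult holomorphic_on_const E(1))
  have Eper: "E (b + int n) (\<alpha> + int n) v = E b \<alpha> v" for b \<alpha> v
  proof (rule theta_mult_cancel[OF \<tau> E(1) E(1)])
    show "tht v * E (b + int n) (\<alpha> + int n) v = tht v * E b \<alpha> v" for v
      using per[of b \<alpha> "v / of_nat n"] unfolding E(2) .
  qed
  have E1m: "E b \<alpha> (v + of_nat m) = e2pi ((of_nat n - of_nat k) / of_nat n * of_int (b - \<alpha>)) ^ m * E b \<alpha> v" for m v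
  proof (induction m)
    case (Suc m)
    have "v + of_nat (Suc m) = (v + of_nat m) + 1" by simp
    then show ?case using E1[of b \<alpha> "v + of_nat m"] Suc by (simp only: power_Suc mult.assoc)
  qed simp
  have E2m: "E b \<alpha> (v + of_nat m * \<tau>) = e2pi (of_nat m * (- \<tau> - \<eta>)) * E (b + int m) (\<alpha> + int m) v" for m v
  proof (induction m arbitrary: v)
    case (Suc m)
    have x: "v + of_nat (Suc m) * \<tau> = (v + \<tau>) + of_nat m * \<tau>" by (simp add: distrib_right)
    have y: "of_nat (Suc m) * (- \<tau> - \<eta>) = of_nat m * (- \<tau> - \<eta>) + (- \<tau> - \<eta>)"
      by (simp add: algebra_simps)
    have i: "b + int (Suc m) = b + int m + 1" "\<alpha> + int (Suc m) = \<alpha> + int m + 1" by simp_all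
    show ?case unfolding x y i Suc E2 e2pi_add[of "of_nat m * (- \<tau> - \<eta>)"] by (simp only: mult.assoc)
  qed simp
  define F where "F v = E b \<alpha> (of_nat n * v)" for v
  have F_hol: "F holomorphic_on UNIV"
    using holomorphic_on_compose_gen[OF _ E(1), of "\<lambda>v. of_nat n * v" UNIV]
    by (simp add: o_def F_def[abs_def] holomorphic_on_mult holomorphic_on_ident)
  have F1: "F (v + 1) = F v" for v
  proof -
    have "e2pi ((of_nat n - of_nat k) / of_nat n * of_int (b - \<alpha>)) ^ n = e2pi (of_int ((int n - int k) * (b - \<alpha>)))"
      unfolding e2pi_power using n0 by (intro arg_cong[of _ _ e2pi]) simp
    then have "e2pi ((of_nat n - of_nat k) / of_nat n * of_int (b - \<alpha>)) ^ n = 1"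
      by (simp only: e2pi_of_int)
    then show ?thesis
      using E1m[of "of_nat n * v" n] by (simp only: F_def distrib_left mult_1_right mult_1)
  qed
  have F2: "F (v + \<tau>) = e2pi (of_nat n * (- \<tau> - \<eta>)) * F v" for v
    using E2m[of "of_nat n * v" n] by (simp only: F_def distrib_left Eper)
  obtain c and m :: int where c: "\<And>v. F v = c * e2pi (of_int m * v)"
      "c = 0 \<or> e2pi (of_nat n * (- \<tau> - \<eta>)) = e2pi (of_int m * \<tau>)"
    using entire_quasi_periodic[OF \<tau> F_hol F1 F2] by metis
  have "e2pi (of_nat n * (- \<tau> - \<eta>)) \<noteq> e2pi (of_int m * \<tau>)"
  proof
    assume "e2pi (of_nat n * (- \<tau> - \<eta>)) = e2pi (of_int m * \<tau>)"
    then obtain j :: int where "of_nat n * (- \<tau> - \<eta>) - of_int m * \<tau> = of_int j"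
      unfolding e2pi_eq_iff by (auto elim: Ints_cases)
    then have "of_nat n * \<eta> = of_int (- j) + of_int (- int n - m) * \<tau>"
      by (simp add: algebra_simps)
    then show False using eta period_lattice_eqI by blast
  qed
  with c(2) have "c = 0" by blast
  then have "E b \<alpha> v = 0" for v
    using c(1)[of "v / of_nat n"] n0 by (simp add: F_def)
  then show ?thesis using E(2)[of b \<alpha> "of_nat n * z"] n0 by simp
qed

text \<open>The difference \<open>D\<close> of the two sides is expanded in the basis by dual functionals. The families for all indices \<open>b\<close> are
  treated at once, because the translation by \<open>\<tau> / n\<close> raises \<open>b\<close>.\<close>

lemma quot_eq_generic:
  assumes eta: "of_nat n * \<eta> \<notin> period_lattice \<tau>"
  shows "quot \<eta> Y a b (xcoord \<eta> Y z y) = (\<Sum>r\<in>{0..<int n}. rhs_coef \<eta> Y a b r z * w (b + r) y)"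
proof -
  define D where "D b z y = quot \<eta> Y a b (xcoord \<eta> Y z y) - (\<Sum>r\<in>{0..<int n}. rhs_coef \<eta> Y a b r z * w (b + r) y)" for b z y
  have space: "D b z \<in> theta_space \<tau> ns" for b z
    unfolding D_def by (intro theta_space_diff quot_theta_space theta_space_sum_w)
  have D_hol: "(\<lambda>z. D b z y) holomorphic_on UNIV" for b y
  proof -
    have xh: "(\<lambda>z. xcoord \<eta> Y z y j) holomorphic_on UNIV" for j
      unfolding xcoord_def
      by (cases "j = 0") (simp_all add: holomorphic_on_add holomorphic_on_mult holomorphic_on_ident)
    have "(\<lambda>z. quot \<eta> Y a b (xcoord \<eta> Y z y)) holomorphic_on UNIV"
      by (rule sep_entire_along[of _ _ "\<lambda>j z. xcoord \<eta> Y z y j", OF quot_sep_entire finite_atLeastAtMost quot_cong xh])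
    then show ?thesis
      unfolding D_def
      by (intro holomorphic_on_diff holomorphic_on_sum holomorphic_on_mult rhs_coef_holomorphic holomorphic_on_const)
  qed
  obtain L where L0: "\<forall>i. evaluation_functional (L i)"
    "\<forall>\<alpha>\<in>{0..<int n}. \<forall>\<beta>\<in>{0..<int n}. L \<alpha> (w \<beta>) = (if \<alpha> = \<beta> then 1 else 0)"
    using w_dual by (elim exE conjE)
  note L = L0(1)[rule_format] L0(2)[rule_format]
  define d where "d b \<alpha> z = L (\<alpha> mod int n) (D b z)" for b \<alpha> z
  have d_mod: "d b (\<alpha> mod int n) z = d b \<alpha> z" for b \<alpha> z by (simp add: d_def)
  have expand: "D b z y = (\<Sum>\<alpha>\<in>{0..<int n}. d b \<alpha> z * w \<alpha> y)" for b z y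
  proof -
    obtain c where c: "\<And>y. D b z y = (\<Sum>\<alpha>\<in>{0..<int n}. c \<alpha> * w \<alpha> y)"
      using w_span[OF space] by blast
    have "d b \<alpha> z = c \<alpha>" if \<alpha>: "\<alpha> \<in> {0..<int n}" for \<alpha>
    proof -
      have "D b z = (\<lambda>y. \<Sum>\<beta>\<in>{0..<int n}. c \<beta> * w \<beta> y)" using c by blast
      then have "d b \<alpha> z = (\<Sum>\<beta>\<in>{0..<int n}. c \<beta> * L \<alpha> (w \<beta>))"
        using evaluation_functional_linear[OF L(1)] \<alpha> by (simp add: d_def)
      also have "\<dots> = (\<Sum>\<beta>\<in>{0..<int n}. if \<beta> = \<alpha> then c \<alpha> else 0)"
        using L(2)[OF \<alpha>] by (intro sum.cong) auto
      finally show ?thesis using \<alpha> by simp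
    qed
    then show ?thesis unfolding c by (intro sum.cong) auto
  qed
  have d_hol: "d b \<alpha> holomorphic_on UNIV" for b \<alpha>
    using evaluation_functional_holomorphic[OF L(1), of "D b"] D_hol by (simp add: d_def[abs_def])
  \<comment> \<open>The torsion translation of \<open>y\<close> offsets the shift of \<open>z\<close>: \<open>s\<^sub>1, \<dots>, s\<^sub>p\<close> do not change.\<close>
  have D_one: "D b (z + 1 / of_nat n) (\<lambda>j. y j - of_int (gamma_coef j) / of_nat n)
      = e2pi ((of_nat n - of_nat k) / of_nat n * of_int b) * D b z y" for b z y
  proof -
    have x: "xcoord \<eta> Y (z + 1 / of_nat n) (\<lambda>j. y j - of_int (gamma_coef j) / of_nat n)
      = (xcoord \<eta> Y z y)(0 := xcoord \<eta> Y z y 0 + 1 / of_nat n)"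
      by (auto simp: xcoord_def fun_eq_iff distrib_left)
    have r: "rhs_coef \<eta> Y a b r (z + 1 / of_nat n) * w (b + r) (\<lambda>j. y j - of_int (gamma_coef j) / of_nat n)
      = e2pi ((of_nat n - of_nat k) / of_nat n * of_int b) * (rhs_coef \<eta> Y a b r z * w (b + r) y)" for r
      unfolding w_shift_one mult.assoc[symmetric] rhs_coef_plus_inverse ..
    show ?thesis
      unfolding D_def x quot_shift_one r by (simp only: sum_distrib_left right_diff_distrib)
  qed
  have D_tau: "D b (z + \<tau> / of_nat n) (\<lambda>j. y j - of_int (gamma_coef j) / of_nat n * \<tau>)
      = - e2pi (- of_nat n * z - \<tau> - \<eta>) * e2pi (- (y 1 + \<phi>)) * D (b + 1) z y" for b z y
  proof -
    have x: "xcoord \<eta> Y (z + \<tau> / of_nat n) (\<lambda>j. y j - of_int (gamma_coef j) / of_nat n * \<tau>)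
      = (xcoord \<eta> Y z y)(0 := xcoord \<eta> Y z y 0 + \<tau> / of_nat n)"
      by (auto simp: xcoord_def fun_eq_iff distrib_left)
    have e: "- of_nat n * xcoord \<eta> Y z y 0 - \<tau> - ycoord \<eta> Y (xcoord \<eta> Y z y) 1 - \<eta> - \<phi>
      = (- of_nat n * z - \<tau> - \<eta>) + - (y 1 + \<phi>)"
      by (simp add: ycoord_xcoord)
    have i: "b + r + 1 = b + 1 + r" for r by simp
    have r: "rhs_coef \<eta> Y a b r (z + \<tau> / of_nat n) * w (b + r) (\<lambda>j. y j - of_int (gamma_coef j) / of_nat n * \<tau>)
      = - e2pi (- of_nat n * z - \<tau> - \<eta>) * e2pi (- (y 1 + \<phi>)) * (rhs_coef \<eta> Y a (b + 1) r z * w (b + 1 + r) y)" for r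
      unfolding w_shift_tau rhs_coef_plus_tau i by (simp only: mult_ac mult_minus_left mult_minus_right)
    show ?thesis
      unfolding D_def x quot_shift_tau r e e2pi_add[of "- of_nat n * z - \<tau> - \<eta>"]
      by (simp only: sum_distrib_left right_diff_distrib mult_minus_left)
  qed
  have one: "d b \<alpha> (z + 1 / of_nat n) = e2pi ((of_nat n - of_nat k) / of_nat n * of_int (b - \<alpha>)) * d b \<alpha> z" for b \<alpha> z
  proof -
    let ?e = "\<lambda>\<alpha>. e2pi ((of_nat n - of_nat k) / of_nat n * of_int \<alpha>)"
    have split: "?e (b - \<beta>) * ?e \<beta> = ?e b" for \<beta>
      unfolding e2pi_add[symmetric] distrib_left[symmetric] of_int_add[symmetric] by simp
    have *: "d b \<beta> (z + 1 / of_nat n) = ?e (b - \<beta>) * d b \<beta> z" if \<beta>: "\<beta> \<in> {0..<int n}" for \<beta>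
    proof -
      have "d b \<beta> (z + 1 / of_nat n) * ?e \<beta> = ?e b * d b \<beta> z"
      proof (rule coef_exchange[OF _ \<beta>, of "\<lambda>\<beta>. d b \<beta> (z + 1 / of_nat n) * ?e \<beta>" "\<lambda>\<beta>. ?e b * d b \<beta> z"])
        show "(\<Sum>\<alpha>\<in>{0..<int n}. d b \<alpha> (z + 1 / of_nat n) * ?e \<alpha> * w \<alpha> y) = (\<Sum>\<alpha>\<in>{0..<int n}. ?e b * d b \<alpha> z * w \<alpha> y)" for y
          using D_one[of b z y] unfolding expand w_shift_one sum_distrib_left by (simp only: mult.assoc)
      qed
      also have "\<dots> = ?e (b - \<beta>) * d b \<beta> z * ?e \<beta>"
        unfolding split[of \<beta>, symmetric] by (simp only: mult_ac)
      finally show ?thesis by (simp only: mult_right_cancel[OF e2pi_nonzero])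
    qed
    have "?e (b - \<alpha> mod int n) = ?e (b - \<alpha>)"
    proof -
      have "b - \<alpha> mod int n = (b - \<alpha>) + int n * (\<alpha> div int n)"
        using mult_div_mod_eq[of "int n" \<alpha>] by linarith
      moreover have "(of_nat n - of_nat k) / of_nat n * of_int (B + int n * q)
          = (of_nat n - of_nat k) / of_nat n * of_int B + (of_int ((int n - int k) * q) :: complex)" for B q
        using n_pos by (simp add: divide_simps) (simp add: algebra_simps)
      ultimately have "(of_nat n - of_nat k) / of_nat n * of_int (b - \<alpha> mod int n)
          = (of_nat n - of_nat k) / of_nat n * of_int (b - \<alpha>) + (of_int ((int n - int k) * (\<alpha> div int n)) :: complex)"
        by (simp only:)
      then show ?thesis by (simp only: e2pi_add e2pi_of_int mult_1_right)
    qed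
    then show ?thesis
      using *[of "\<alpha> mod int n"] n_pos by (simp add: d_mod)
  qed
  have tau: "d b \<alpha> (z + \<tau> / of_nat n) = - e2pi (- of_nat n * z - \<tau> - \<eta>) * d (b + 1) (\<alpha> + 1) z" for b \<alpha> z
  proof -
    let ?K = "- e2pi (- of_nat n * z - \<tau> - \<eta>)"
    have dp: "d b (\<alpha> + int n) z = d b \<alpha> z" for b \<alpha> z
      using d_mod[of b "\<alpha> + int n" z] d_mod[of b \<alpha> z] by simp
    have *: "d b (\<beta> - 1) (z + \<tau> / of_nat n) = ?K * d (b + 1) \<beta> z" if \<beta>: "\<beta> \<in> {0..<int n}" for \<beta>
    proof (rule coef_exchange[OF _ \<beta>, of "\<lambda>\<beta>. d b (\<beta> - 1) (z + \<tau> / of_nat n)" "\<lambda>\<beta>. ?K * d (b + 1) \<beta> z"])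
      fix y
      have sh: "(\<Sum>\<alpha>\<in>{0..<int n}. d b (\<alpha> + 1 - 1) (z + \<tau> / of_nat n) * w (\<alpha> + 1) y)
          = (\<Sum>\<alpha>\<in>{0..<int n}. d b (\<alpha> - 1) (z + \<tau> / of_nat n) * w \<alpha> y)"
      proof (rule sum_shift_periodic[OF n_pos, of "\<lambda>\<alpha>. d b (\<alpha> - 1) (z + \<tau> / of_nat n) * w \<alpha> y"])
        have "i + int n - 1 = i - 1 + int n" for i by simp
        then show "d b (i + int n - 1) (z + \<tau> / of_nat n) * w (i + int n) y = d b (i - 1) (z + \<tau> / of_nat n) * w i y" for i
          by (simp only: dp w_periodic)
      qed
      have "e2pi (- (y 1 + \<phi>)) * (\<Sum>\<alpha>\<in>{0..<int n}. d b \<alpha> (z + \<tau> / of_nat n) * w (\<alpha> + 1) y)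
        = e2pi (- (y 1 + \<phi>)) * (\<Sum>\<alpha>\<in>{0..<int n}. ?K * d (b + 1) \<alpha> z * w \<alpha> y)"
        using D_tau[of b z y] unfolding expand w_shift_tau sum_distrib_left by (simp only: mult_ac)
      then show "(\<Sum>\<alpha>\<in>{0..<int n}. d b (\<alpha> - 1) (z + \<tau> / of_nat n) * w \<alpha> y) = (\<Sum>\<alpha>\<in>{0..<int n}. ?K * d (b + 1) \<alpha> z * w \<alpha> y)"
        unfolding sh[symmetric] add_diff_cancel_right' by (simp only: mult_left_cancel[OF e2pi_nonzero])
    qed
    have m1: "d b ((\<alpha> + 1) mod int n - 1) u = d b \<alpha> u" for u
    proof -
      have "((\<alpha> + 1) mod int n - 1) mod int n = \<alpha> mod int n"
        by (metis add_diff_cancel_right' mod_diff_left_eq)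
      then show ?thesis using d_mod by metis
    qed
    have "(\<alpha> + 1) mod int n \<in> {0..<int n}" using n_pos by simp
    from *[OF this] show ?thesis unfolding m1 d_mod .
  qed
  have per: "d (b + int n) (\<alpha> + int n) z = d b \<alpha> z" for b \<alpha> z
  proof -
    have "D (b + int n) z = D b z"
    proof
      fix y
      have "w (b + int n + r) = w (b + r)" for r
        using w_periodic[of "b + r"] by (simp add: add_ac)
      then show "D (b + int n) z y = D b z y"
        by (simp only: D_def quot_periodic rhs_coef_periodic)
    qed
    then show ?thesis by (simp add: d_def)
  qed
  have d0: "d b \<alpha> 0 = 0" for b \<alpha>
  proof -
    have "D b 0 y = 0" for y
    proof -
      have "w a (ycoord \<eta> Y (xcoord \<eta> Y 0 y)) = w a y"
        by (rule w_cong) (simp add: ycoord_xcoord)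
      then show ?thesis
        using quot_at_0[of "xcoord \<eta> Y 0 y" \<eta> Y a b] by (simp add: D_def rhs_coef_sum_at_0)
    qed
    then have "d b (\<alpha> mod int n) 0 = 0"
      using w_independent[of "\<lambda>\<alpha>. d b \<alpha> 0" "\<alpha> mod int n"] n_pos by (simp add: expand)
    then show ?thesis by (simp add: d_mod)
  qed
  have "D b z y = 0"
    unfolding expand using coefficient_zero[of \<eta> d, OF eta d_hol d0 one tau per] by simp
  then show ?thesis by (simp add: D_def)
qed

text \<open>Both sides are entire in \<open>\<eta>\<close>, and agree when \<open>n \<eta>\<close> is not in the lattice.\<close>

theorem exchange_identity:
  "numer \<eta> Y a b x = (\<Prod>j\<in>{1..p}. tht (x j)) *
     (\<Sum>r\<in>{0..<int n}. rhs_coef \<eta> Y a b r (x 0) * w (b + r) (ycoord \<eta> Y x))"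
proof -
  define f where "f \<eta> = numer \<eta> Y a b x - (\<Prod>j\<in>{1..p}. tht (x j)) *
     (\<Sum>r\<in>{0..<int n}. rhs_coef \<eta> Y a b r (x 0) * w (b + r) (ycoord \<eta> Y x))" for \<eta>
  have n0: "(of_nat n :: complex) \<noteq> 0" using n_pos by simp
  \<comment> \<open>The factor \<open>\<theta>(n \<eta>)\<close> removes the excluded \<open>\<eta>\<close>; it is cancelled at the end by analytic continuation.\<close>
  have generic: "f \<eta> = 0" if eta: "of_nat n * \<eta> \<notin> period_lattice \<tau>" for \<eta>
  proof -
    have "quot \<eta> Y a b x = quot \<eta> Y a b (xcoord \<eta> Y (x 0) (ycoord \<eta> Y x))"
      by (rule quot_cong) (auto simp: xcoord_def ycoord_def)
    then show ?thesis
      unfolding f_def numer_quot using quot_eq_generic[OF eta] by simp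
  qed
  have offset_hol: "(\<lambda>\<eta>. offset \<eta> x j) holomorphic_on UNIV" for j
    unfolding offset_def
    by (cases "j = 0"; cases "j \<le> p") (simp_all add: holomorphic_on_mult holomorphic_on_ident)
  have kern_hol: "(\<lambda>\<eta>. kern \<eta> t x) holomorphic_on UNIV" for t
    unfolding kern_def
    by (intro holomorphic_on_mult holomorphic_on_prod e2pi_holomorphic theta_holomorphic'[OF \<tau>]
        holomorphic_on_diff offset_hol)
  have arg_hol: "(\<lambda>\<eta>. arg1 \<eta> Y t x j) holomorphic_on UNIV" for t j
    unfolding arg1_def
    by (intro holomorphic_on_add holomorphic_on_diff holomorphic_on_mult holomorphic_on_const holomorphic_on_ident)
  have y_hol: "(\<lambda>\<eta>. ycoord \<eta> Y x j) holomorphic_on UNIV" for j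
    unfolding ycoord_def
    by (intro holomorphic_on_diff holomorphic_on_mult holomorphic_on_const holomorphic_on_ident)
  have wa: "(\<lambda>\<eta>. w a (arg1 \<eta> Y t x)) holomorphic_on UNIV" for t
    by (rule w_along[of "\<lambda>j \<eta>. arg1 \<eta> Y t x j", OF arg_hol])
  have wy: "(\<lambda>\<eta>. w c (ycoord \<eta> Y x)) holomorphic_on UNIV" for c
    by (rule w_along[of "\<lambda>j \<eta>. ycoord \<eta> Y x j", OF y_hol])
  have f_hol: "f holomorphic_on UNIV"
    unfolding f_def[abs_def] numer_def
    by (intro holomorphic_on_diff holomorphic_on_sum holomorphic_on_mult holomorphic_on_const
        kern_hol wa wy rhs_coef_holomorphic_eta)
  obtain c where c: "tht c \<noteq> 0" using theta_not_identically_zero[OF \<tau>] by blast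
  have "f \<eta> = 0"
  proof (rule entire_mult_cancel[of "\<lambda>\<eta>. tht (of_nat n * \<eta>)" f "c / of_nat n"])
    show "(\<lambda>\<eta>. tht (of_nat n * \<eta>)) holomorphic_on UNIV"
      by (intro theta_holomorphic'[OF \<tau>] holomorphic_on_mult holomorphic_on_const holomorphic_on_ident)
    show "tht (of_nat n * (c / of_nat n)) \<noteq> 0" using c n0 by simp
    show "tht (of_nat n * \<eta>) * f \<eta> = 0" for \<eta>
      using generic[of \<eta>] theta_lattice[of "of_nat n * \<eta>" \<tau>] by auto
  qed (rule f_hol)
  then show ?thesis by (simp add: f_def)
qed

section \<open>The homomorphism\<close>

text \<open>A common rescaling \<open>K\<close> brings the two normalisations of the relations of \<open>Z\<close>, for \<open>n \<eta>\<close> outside and inside the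
  lattice, to the same form: the left coefficient becomes the one of the relation of \<open>Y\<close>, the right ones involve the
  cofactor at \<open>\<eta>\<close>.\<close>

lemma Z_coeffs:
  assumes z: "of_nat n * z \<notin> period_lattice \<tau>"
  obtains K where "K * Z_lhs_coeff \<tau> n \<eta> z = tht (of_nat n * z + of_nat n * \<eta>) / tht (of_nat n * z)"
    "\<And>\<delta> r. K * Z_rhs_coeff \<tau> n k \<eta> \<delta> r z =
       theta_const \<tau> n / theta_P0 * (thi (\<delta> + r * (int k - 1)) (z + \<eta>) * cof (int k * r) \<eta> / thi (\<delta> - r) z)"
proof -
  define C where "C = theta_const \<tau> n"
  have C: "C \<noteq> 0" unfolding C_def by (rule theta_const_nonzero[OF \<tau> n_pos])
  note P0 = theta_P0_nonzero
  define h :: complex where "h = of_nat n * (of_nat n - 1) / 2"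
  have Om: "(\<Prod>i\<in>{0..<int n}. thi i u) = C * tht (of_nat n * u) * e2pi (h * u)" for u
    using theta_Omega_theta[OF \<tau> n_pos, of u] unfolding theta_Omega_def[OF \<tau> n_pos] C_def h_def .
  have tz: "tht (of_nat n * z) \<noteq> 0" using z by (simp add: theta_eq_0_iff[OF \<tau>])
  have hadd: "e2pi (h * (z + \<eta>)) = e2pi (h * z) * e2pi (h * \<eta>)"
    by (simp only: distrib_left e2pi_add)
  show ?thesis
  proof (cases "of_nat n * \<eta> \<in> period_lattice \<tau>")
    case False
    then have te: "tht (of_nat n * \<eta>) \<noteq> 0" by (simp add: theta_eq_0_iff[OF \<tau>])
    show ?thesis
    proof (rule that[of "tht (of_nat n * \<eta>) * C / theta_P0"])
      show "tht (of_nat n * \<eta>) * C / theta_P0 * Z_lhs_coeff \<tau> n \<eta> z = tht (of_nat n * z + of_nat n * \<eta>) / tht (of_nat n * z)"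
        unfolding Z_lhs_coeff_def if_P[OF False] Om theta_P0_def[symmetric] hadd distrib_left[of "of_nat n"]
        using te tz C P0 by simp
      fix \<delta> r
      have ne: "thi (int k * r) \<eta> \<noteq> 0" using theta_idx_zero[OF \<tau> n_pos] False by blast
      have co: "tht (of_nat n * \<eta>) / thi (int k * r) \<eta> = cof (int k * r) \<eta>"
        unfolding theta_idx_times_cofactor[OF \<tau> n_pos, of "int k * r" \<eta>, symmetric] using ne by simp
      show "tht (of_nat n * \<eta>) * C / theta_P0 * Z_rhs_coeff \<tau> n k \<eta> \<delta> r z =
          theta_const \<tau> n / theta_P0 * (thi (\<delta> + r * (int k - 1)) (z + \<eta>) * cof (int k * r) \<eta> / thi (\<delta> - r) z)"
        unfolding Z_rhs_coeff_def if_P[OF False] C_def[symmetric] co[symmetric] by simp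
    qed
  next
    case True
    then have nn: "\<not> of_nat n * \<eta> \<notin> period_lattice \<tau>" by simp
    show ?thesis
    proof (rule that[of "e2pi (- (h * \<eta>)) / theta_P0"])
      show "e2pi (- (h * \<eta>)) / theta_P0 * Z_lhs_coeff \<tau> n \<eta> z = tht (of_nat n * z + of_nat n * \<eta>) / tht (of_nat n * z)"
        unfolding Z_lhs_coeff_def if_not_P[OF nn] Om theta_P0_def[symmetric] hadd distrib_left[of "of_nat n"] e2pi_minus
        using tz C P0 by simp
      fix \<delta> r
      show "e2pi (- (h * \<eta>)) / theta_P0 * Z_rhs_coeff \<tau> n k \<eta> \<delta> r z =
          theta_const \<tau> n / theta_P0 * (thi (\<delta> + r * (int k - 1)) (z + \<eta>) * cof (int k * r) \<eta> / thi (\<delta> - r) z)"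
        unfolding Z_rhs_coeff_def if_not_P[OF nn] C_def[symmetric] theta_cofactor_def[OF \<tau> n_pos] h_def[symmetric]
        using C by simp
    qed
  qed
qed

text \<open>The coefficients on the right of the relation of \<open>Y\<close>. The term \<open>t = p\<close> is the general one with the factor
  \<open>\<theta>(n \<eta>)\<close> cancelled, which matters when it is zero.\<close>

definition Y_coef :: "complex \<Rightarrow> (nat \<Rightarrow> complex) \<Rightarrow> nat \<Rightarrow> complex" where
  "Y_coef \<eta> x t = (if t = p then tht (- x p + of_nat n * \<eta>) / tht (- x p)
     else tht (of_nat n * \<eta>) * tht (offset \<eta> x (Suc t) - offset \<eta> x t) / (tht (- offset \<eta> x t) * tht (offset \<eta> x (Suc t))))"

lemma Y_coef_kern:
  assumes x0: "of_nat n * x 0 \<notin> period_lattice \<tau>" and xj: "\<And>j. j \<in> {1..p} \<Longrightarrow> x j \<notin> period_lattice \<tau>"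
    and t: "t \<le> p"
  shows "Y_coef \<eta> x t * (tht (- of_nat n * x 0) * (\<Prod>j\<in>{1..p}. tht (x j))) = - kern \<eta> t x"
proof -
  let ?S = "offset \<eta> x"
  have e0: "?S 0 = - of_nat n * x 0" "?S (Suc p) = of_nat n * \<eta>" by (simp_all add: offset_def)
  have ej: "?S j = x j" if "j \<in> {1..p}" for j using that by (auto simp: offset_def)
  have neg: "tht (- s) = - e2pi (- s) * tht s" for s by (rule theta_uminus)
  have nz: "tht (?S j) \<noteq> 0" if "j \<le> p" for j
  proof (cases "j = 0")
    case True
    have "tht (of_nat n * x 0) \<noteq> 0" using x0 by (simp add: theta_eq_0_iff[OF \<tau>])
    then show ?thesis using True neg[of "of_nat n * x 0"] by (simp add: e0)
  next
    case False
    then show ?thesis using that xj[of j] ej[of j] by (simp add: theta_eq_0_iff[OF \<tau>])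
  qed
  have s: "{0..p} = insert 0 {1..p}" by auto
  have full: "tht (- of_nat n * x 0) * (\<Prod>j\<in>{1..p}. tht (x j)) = (\<Prod>j\<in>{0..p}. tht (?S j))"
    unfolding s e0(1)[symmetric] using ej by simp
  have c: "e2pi (- s) * e2pi s = 1" for s by (simp flip: e2pi_add)
  show ?thesis
  proof (cases "t = p")
    case True
    have "{0..Suc p} - {p, Suc p} = {0..p} - {p}" by auto
    then have k: "kern \<eta> t x = e2pi (?S p) * tht (of_nat n * \<eta> - ?S p) * (\<Prod>j\<in>{0..p} - {p}. tht (?S j))"
      unfolding kern_def True e0(2)[symmetric] by simp
    have f: "(\<Prod>j\<in>{0..p}. tht (?S j)) = tht (?S p) * (\<Prod>j\<in>{0..p} - {p}. tht (?S j))"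
      by (rule prod.remove) auto
    have xp: "x p = ?S p" using ej[of p] one_le_p by simp
    have "Y_coef \<eta> x t = tht (of_nat n * \<eta> - ?S p) / tht (- ?S p)"
      unfolding Y_coef_def if_P[OF True] xp by (simp add: add.commute[of _ "of_nat n * \<eta>"])
    also have "\<dots> * tht (?S p) = - (e2pi (?S p) * tht (of_nat n * \<eta> - ?S p))"
      unfolding neg[of "?S p"] using nz[of p] c[of "?S p"] by (simp add: field_simps)
    finally show ?thesis
      unfolding full f k by (simp only: mult.assoc[symmetric]) simp
  next
    case False
    then have tp: "t \<le> p" "Suc t \<le> p" using t by auto
    define R where "R = {0..p} - {t, Suc t}"
    have "{0..Suc p} - {t, Suc t} = insert (Suc p) R" unfolding R_def using tp by auto
    moreover have "Suc p \<notin> R" "finite R" by (simp_all add: R_def)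
    ultimately have k: "kern \<eta> t x = e2pi (?S t) * tht (?S (Suc t) - ?S t) * (tht (of_nat n * \<eta>) * (\<Prod>j\<in>R. tht (?S j)))"
      unfolding kern_def e0(2)[symmetric] by simp
    have "{0..p} = insert t (insert (Suc t) R)" unfolding R_def using tp by auto
    moreover have "t \<notin> insert (Suc t) R" "Suc t \<notin> R" "finite R" by (auto simp: R_def)
    ultimately have f: "(\<Prod>j\<in>{0..p}. tht (?S j)) = tht (?S t) * (tht (?S (Suc t)) * (\<Prod>j\<in>R. tht (?S j)))"
      by (metis finite_insert prod.insert)
    have "Y_coef \<eta> x t * (tht (?S t) * tht (?S (Suc t))) = - (e2pi (?S t) * tht (?S (Suc t) - ?S t) * tht (of_nat n * \<eta>))"
      unfolding Y_coef_def if_not_P[OF False] neg[of "?S t"]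
      using nz[OF tp(1)] nz[OF tp(2)] c[of "?S t"] by (simp add: field_simps)
    then have "Y_coef \<eta> x t * (tht (?S t) * tht (?S (Suc t))) * (\<Prod>j\<in>R. tht (?S j))
      = - (e2pi (?S t) * tht (?S (Suc t) - ?S t) * tht (of_nat n * \<eta>)) * (\<Prod>j\<in>R. tht (?S j))"
      by (simp only:)
    then show ?thesis
      unfolding full f k by (simp only: mult.assoc mult_minus_left)
  qed
qed

text \<open>The exchange identity divided by the theta factors.\<close>

lemma coefficient_identity:
  assumes x0: "of_nat n * x 0 \<notin> period_lattice \<tau>" and xj: "\<And>j. j \<in> {1..p} \<Longrightarrow> x j \<notin> period_lattice \<tau>"
  shows "(\<Sum>t\<le>p. Y_coef \<eta> x t * (w a (arg1 \<eta> Y t x) * w b (arg2 Y t x))) =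
    (\<Sum>r\<in>{0..<int n}. theta_const \<tau> n / theta_P0 *
       (thi (b - a + r * (int k + 1)) (x 0 + \<eta>) * cof (int k * r) \<eta> / thi (b - a + r) (x 0)) *
       (w (b + r) (ycoord \<eta> Y x) * w (a - r) Y))" (is "?L = ?R")
proof -
  define F where "F = (\<Prod>j\<in>{1..p}. tht (x j))"
  have F: "F \<noteq> 0" unfolding F_def using xj by (auto simp: theta_eq_0_iff[OF \<tau>])
  have tz: "tht (of_nat n * x 0) \<noteq> 0" using x0 by (simp add: theta_eq_0_iff[OF \<tau>])
  have neg: "tht (- of_nat n * x 0) = - e2pi (- of_nat n * x 0) * tht (of_nat n * x 0)"
    using theta_uminus[of \<tau> "of_nat n * x 0"] by simp
  have "?L * (tht (- of_nat n * x 0) * F) = - numer \<eta> Y a b x"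
  proof -
    have "Y_coef \<eta> x t * (w a (arg1 \<eta> Y t x) * w b (arg2 Y t x)) * (tht (- of_nat n * x 0) * F)
        = - (kern \<eta> t x * (w a (arg1 \<eta> Y t x) * w b (arg2 Y t x)))" if "t \<in> {..p}" for t
    proof -
      have "Y_coef \<eta> x t * (tht (- of_nat n * x 0) * F) = - kern \<eta> t x"
        unfolding F_def by (rule Y_coef_kern[of x]) (use x0 xj that in auto)
      then have "Y_coef \<eta> x t * (tht (- of_nat n * x 0) * F) * (w a (arg1 \<eta> Y t x) * w b (arg2 Y t x))
        = - kern \<eta> t x * (w a (arg1 \<eta> Y t x) * w b (arg2 Y t x))" by (simp only:)
      then show ?thesis by (simp only: mult_ac mult_minus_left mult_minus_right)
    qed
    then show ?thesis
      unfolding numer_def sum_distrib_right sum_negf[symmetric] by (intro sum.cong) auto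
  qed
  also have "\<dots> = - F * (\<Sum>r\<in>{0..<int n}. rhs_coef \<eta> Y a b r (x 0) * w (b + r) (ycoord \<eta> Y x))"
    unfolding exchange_identity F_def by simp
  finally have "?L * (e2pi (- of_nat n * x 0) * tht (of_nat n * x 0)) =
     (\<Sum>r\<in>{0..<int n}. rhs_coef \<eta> Y a b r (x 0) * w (b + r) (ycoord \<eta> Y x))"
    unfolding neg using F by simp
  also have "\<dots> = ?R * (e2pi (- of_nat n * x 0) * tht (of_nat n * x 0))"
    unfolding sum_distrib_right
  proof (rule sum.cong)
    fix r assume "r \<in> {0..<int n}"
    have nz: "thi (b - a + r) (x 0) \<noteq> 0" using theta_idx_zero[OF \<tau> n_pos] x0 by blast
    then have c: "cof (b - a + r) (x 0) = tht (of_nat n * x 0) / thi (b - a + r) (x 0)"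
      using theta_idx_times_cofactor[OF \<tau> n_pos, of "b - a + r" "x 0"] by (simp add: field_simps)
    show "rhs_coef \<eta> Y a b r (x 0) * w (b + r) (ycoord \<eta> Y x) = theta_const \<tau> n / theta_P0 *
       (thi (b - a + r * (int k + 1)) (x 0 + \<eta>) * cof (int k * r) \<eta> / thi (b - a + r) (x 0)) *
       (w (b + r) (ycoord \<eta> Y x) * w (a - r) Y) * (e2pi (- of_nat n * x 0) * tht (of_nat n * x 0))"
      unfolding rhs_coef_def c by simp
  qed simp
  finally show ?thesis using tz by simp
qed

text \<open>The indexing \<open>1 - \<alpha>\<close> of the homomorphism is absorbed here.\<close>

definition Zx :: "int \<Rightarrow> complex \<Rightarrow> (int \<times> complex) nc_poly" where
  "Zx \<alpha> u = Z_x n (1 - \<alpha>) u"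

lemma Zx_periodic: "Zx (\<alpha> + int n) u = Zx \<alpha> u"
proof -
  have "(1 - (\<alpha> + int n)) mod int n = (1 - \<alpha>) mod int n"
    by (simp add: mod_eq_dvd_iff)
  then show ?thesis by (simp add: Zx_def Z_x_def)
qed

definition image_gen :: "complex \<Rightarrow> (nat \<Rightarrow> complex) \<Rightarrow> (int \<times> complex) nc_poly" where
  "image_gen u q = (\<Sum>\<alpha>\<in>{0..<int n}. scalar (w \<alpha> (\<lambda>j. q j + of_int (gamma_coef j) * u)) * Zx \<alpha> u)"

lemma image_gen_mult:
  "image_gen u q * image_gen v q' = (\<Sum>\<alpha>\<in>{0..<int n}. \<Sum>\<beta>\<in>{0..<int n}.
     scalar (w \<alpha> (\<lambda>j. q j + of_int (gamma_coef j) * u) * w \<beta> (\<lambda>j. q' j + of_int (gamma_coef j) * v)) * (Zx \<alpha> u * Zx \<beta> v))"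
proof -
  have "scalar c * P * (scalar d * Q) = scalar (c * d) * (P * Q)" for c d and P Q :: "(int \<times> complex) nc_poly"
    using scalar_commute[of d P] by (simp add: scalar_mult mult.assoc) (simp add: mult.assoc[symmetric])
  then show ?thesis
    unfolding image_gen_def sum_product by simp
qed

lemma Z_rel_scaled:
  "K \<bullet>\<^sub>n\<^sub>c Z_rel \<tau> n k \<eta> (1 - \<alpha>) (1 - \<beta>) u v =
    scalar (K * Z_lhs_coeff \<tau> n \<eta> (v - u)) * (Zx \<alpha> u * Zx \<beta> v) -
    (\<Sum>r\<in>{0..<int n}. scalar (K * Z_rhs_coeff \<tau> n k \<eta> (\<alpha> - \<beta>) r (v - u)) * (Zx (\<beta> + r) v * Zx (\<alpha> - r) u))"
proof -
  have i: "1 - \<beta> - (1 - \<alpha>) = \<alpha> - \<beta>" "1 - \<beta> - r = 1 - (\<beta> + r)" "1 - \<alpha> + r = 1 - (\<alpha> - r)" for r by simp_all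
  show ?thesis
    unfolding Z_rel_def i(1) unfolding i(2,3) Zx_def nc_scale_scalar right_diff_distrib sum_distrib_left
      scalar_mult mult.assoc ..
qed

text \<open>The left product is a combination of the left monomials of relations of \<open>Z\<close>. Subtracting the corresponding
  combination of relations leaves monomials in the opposite order, whose coefficients cancel by \<open>coefficient_identity\<close> after
  the indices \<open>(\<alpha>, \<beta>)\<close> are replaced by \<open>(b + r, a - r)\<close>.\<close>

lemma Y_relation_image:
  assumes z: "of_nat n * (v - u) \<notin> period_lattice \<tau>"
    and s: "\<And>j. j \<in> {1..p} \<Longrightarrow> us j - vs j \<notin> period_lattice \<tau>"
  defines "x \<equiv> \<lambda>j. if j = 0 then v - u else us j - vs j"
  shows "\<exists>K. scalar (tht (of_nat n * (v - u) + of_nat n * \<eta>) / tht (of_nat n * (v - u))) *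
        (image_gen u us * image_gen v (\<lambda>j. vs j + of_int (mu_coef j) * \<eta>)) -
      (\<Sum>t\<le>p. scalar (Y_coef \<eta> x t) *
         (image_gen v (\<lambda>j. if j \<le> t then vs j else us j) *
          image_gen u (\<lambda>j. (if j \<le> t then us j else vs j) + of_int (mu_coef j) * \<eta>))) =
      (\<Sum>\<alpha>\<in>{0..<int n}. \<Sum>\<beta>\<in>{0..<int n}. (K \<alpha> \<beta>) \<bullet>\<^sub>n\<^sub>c Z_rel \<tau> n k \<eta> (1 - \<alpha>) (1 - \<beta>) u v)"
proof -
  define Y where "Y = (\<lambda>j. vs j + of_int (mu_coef j) * \<eta> + of_int (gamma_coef j) * v)"
  define y where "y = (\<lambda>j. us j + of_int (gamma_coef j) * u)"
  have x0: "x 0 = v - u" by (simp add: x_def)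
  have xj: "x j = us j - vs j" if "j \<in> {1..p}" for j using that by (auto simp: x_def)
  have A1: "w a (\<lambda>j. (if j \<le> t then vs j else us j) + of_int (gamma_coef j) * v) = w a (arg1 \<eta> Y t x)" for a t
    by (rule w_cong) (auto simp: arg1_def Y_def xj)
  have A2: "w b (\<lambda>j. (if j \<le> t then us j else vs j) + of_int (mu_coef j) * \<eta> + of_int (gamma_coef j) * u) = w b (arg2 Y t x)" for b t
    by (rule w_cong) (auto simp: arg2_def Y_def xj x0 algebra_simps)
  have A3: "w c (ycoord \<eta> Y x) = w c y" for c
    by (rule w_cong) (auto simp: ycoord_def Y_def y_def xj x0 algebra_simps)
  obtain K where K: "K * Z_lhs_coeff \<tau> n \<eta> (v - u) = tht (of_nat n * (v - u) + of_nat n * \<eta>) / tht (of_nat n * (v - u))"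
    "\<And>\<delta> r. K * Z_rhs_coeff \<tau> n k \<eta> \<delta> r (v - u) =
       theta_const \<tau> n / theta_P0 * (thi (\<delta> + r * (int k - 1)) (v - u + \<eta>) * cof (int k * r) \<eta> / thi (\<delta> - r) (v - u))"
    using Z_coeffs[OF z, of \<eta>] by blast
  define R where "R \<delta> r = K * Z_rhs_coeff \<tau> n k \<eta> \<delta> r (v - u)" for \<delta> r
  let ?I = "{0..<int n}"
  have id: "(\<Sum>t\<le>p. Y_coef \<eta> x t * (w a (arg1 \<eta> Y t x) * w b (arg2 Y t x))) =
    (\<Sum>r\<in>?I. R (b - a + 2 * r) r * (w (b + r) y * w (a - r) Y))" for a b
  proof -
    have i: "b - a + 2 * r + r * (int k - 1) = b - a + r * (int k + 1)" "b - a + 2 * r - r = b - a + r" for r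
      by (simp_all add: algebra_simps)
    have "of_nat n * x 0 \<notin> period_lattice \<tau>" using z by (simp add: x0)
    moreover have "x j \<notin> period_lattice \<tau>" if "j \<in> {1..p}" for j using s[OF that] xj[OF that] by simp
    ultimately show ?thesis
      using coefficient_identity[of x \<eta> a Y b] unfolding R_def K(2) i A3 x0 by blast
  qed
  have lhs: "scalar (tht (of_nat n * (v - u) + of_nat n * \<eta>) / tht (of_nat n * (v - u))) *
        (image_gen u us * image_gen v (\<lambda>j. vs j + of_int (mu_coef j) * \<eta>))
      = (\<Sum>\<alpha>\<in>?I. \<Sum>\<beta>\<in>?I. scalar (w \<alpha> y * w \<beta> Y * (K * Z_lhs_coeff \<tau> n \<eta> (v - u))) * (Zx \<alpha> u * Zx \<beta> v))"
  proof -
    have "scalar c * (scalar d * P) = scalar (d * c) * P" for c d and P :: "(int \<times> complex) nc_poly"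
      by (simp only: scalar_mult[symmetric] mult.assoc[symmetric] mult.commute[of c d])
    then show ?thesis
      unfolding image_gen_mult sum_distrib_left K(1) y_def Y_def by simp
  qed
  have rhs: "(\<Sum>t\<le>p. scalar (Y_coef \<eta> x t) *
         (image_gen v (\<lambda>j. if j \<le> t then vs j else us j) *
          image_gen u (\<lambda>j. (if j \<le> t then us j else vs j) + of_int (mu_coef j) * \<eta>)))
      = (\<Sum>a\<in>?I. \<Sum>b\<in>?I. scalar (\<Sum>t\<le>p. Y_coef \<eta> x t * (w a (arg1 \<eta> Y t x) * w b (arg2 Y t x))) * (Zx a v * Zx b u))"
  proof -
    have "scalar (Y_coef \<eta> x t) *
         (image_gen v (\<lambda>j. if j \<le> t then vs j else us j) *
          image_gen u (\<lambda>j. (if j \<le> t then us j else vs j) + of_int (mu_coef j) * \<eta>))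
      = (\<Sum>a\<in>?I. \<Sum>b\<in>?I. scalar (Y_coef \<eta> x t * (w a (arg1 \<eta> Y t x) * w b (arg2 Y t x))) * (Zx a v * Zx b u))" for t
      unfolding image_gen_mult A1 A2 sum_distrib_left scalar_mult mult.assoc ..
    then have "(\<Sum>t\<le>p. scalar (Y_coef \<eta> x t) *
         (image_gen v (\<lambda>j. if j \<le> t then vs j else us j) *
          image_gen u (\<lambda>j. (if j \<le> t then us j else vs j) + of_int (mu_coef j) * \<eta>)))
      = (\<Sum>t\<le>p. \<Sum>a\<in>?I. \<Sum>b\<in>?I. scalar (Y_coef \<eta> x t * (w a (arg1 \<eta> Y t x) * w b (arg2 Y t x))) * (Zx a v * Zx b u))"
      by simp
    also have "\<dots> = (\<Sum>a\<in>?I. \<Sum>t\<le>p. \<Sum>b\<in>?I. scalar (Y_coef \<eta> x t * (w a (arg1 \<eta> Y t x) * w b (arg2 Y t x))) * (Zx a v * Zx b u))"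
      by (rule sum.swap)
    also have "\<dots> = (\<Sum>a\<in>?I. \<Sum>b\<in>?I. \<Sum>t\<le>p. scalar (Y_coef \<eta> x t * (w a (arg1 \<eta> Y t x) * w b (arg2 Y t x))) * (Zx a v * Zx b u))"
      by (intro sum.cong refl sum.swap)
    finally show ?thesis unfolding scalar_sum sum_distrib_right .
  qed
  \<comment> \<open>The summand is periodic in both indices, so they may be shifted by \<open>r\<close> in opposite directions.\<close>
  have reindex: "(\<Sum>a\<in>?I. \<Sum>b\<in>?I. scalar (R (b - a + 2 * r) r * (w (b + r) y * w (a - r) Y)) * (Zx a v * Zx b u))
     = (\<Sum>\<alpha>\<in>?I. \<Sum>\<beta>\<in>?I. scalar (w \<alpha> y * w \<beta> Y * R (\<alpha> - \<beta>) r) * (Zx (\<beta> + r) v * Zx (\<alpha> - r) u))" for r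
  proof -
    define f where "f \<alpha> \<beta> = scalar (w \<alpha> y * w \<beta> Y * R (\<alpha> - \<beta>) r) * (Zx (\<beta> + r) v * Zx (\<alpha> - r) u)" for \<alpha> \<beta>
    have R_per: "R (\<delta> + int n) r = R \<delta> r" for \<delta>
    proof -
      have "\<delta> + int n + r * (int k - 1) = \<delta> + r * (int k - 1) + int n" "\<delta> + int n - r = \<delta> - r + int n" by simp_all
      then show ?thesis unfolding R_def K(2) by (simp only: theta_idx_periodic[OF \<tau> n_pos])
    qed
    have R_per': "R (\<delta> - int n) r = R \<delta> r" for \<delta>
      using R_per[of "\<delta> - int n"] by simp
    have f1: "f (\<alpha> + int n) \<beta> = f \<alpha> \<beta>" for \<alpha> \<beta>
    proof -
      have "\<alpha> + int n - \<beta> = \<alpha> - \<beta> + int n" "\<alpha> + int n - r = \<alpha> - r + int n" by simp_all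
      then show ?thesis unfolding f_def by (simp only: R_per w_periodic Zx_periodic)
    qed
    have f2: "f \<alpha> (\<beta> + int n) = f \<alpha> \<beta>" for \<alpha> \<beta>
    proof -
      have "\<alpha> - (\<beta> + int n) = \<alpha> - \<beta> - int n" "\<beta> + int n + r = \<beta> + r + int n" by simp_all
      then show ?thesis unfolding f_def by (simp only: R_per' w_periodic Zx_periodic)
    qed
    have "scalar (R (b - a + 2 * r) r * (w (b + r) y * w (a - r) Y)) * (Zx a v * Zx b u) = f (b + r) (a + - r)" for a b
    proof -
      have "b + r - (a + - r) = b - a + 2 * r" "a + - r + r = a" "b + r - r = b" "a + - r = a - r" by simp_all
      then show ?thesis unfolding f_def by (simp only: mult_ac)
    qed
    then have "(\<Sum>a\<in>?I. \<Sum>b\<in>?I. scalar (R (b - a + 2 * r) r * (w (b + r) y * w (a - r) Y)) * (Zx a v * Zx b u))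
      = (\<Sum>a\<in>?I. \<Sum>b\<in>?I. f (b + r) (a + - r))" by (simp only:)
    also have "\<dots> = (\<Sum>a\<in>?I. \<Sum>b\<in>?I. f b (a + - r))"
      by (intro sum.cong refl sum_shift_periodic n_pos f1)
    also have "\<dots> = (\<Sum>a\<in>?I. \<Sum>b\<in>?I. f b a)"
      by (rule sum_shift_periodic[OF n_pos, of "\<lambda>a. \<Sum>b\<in>?I. f b a"]) (simp only: f2)
    also have "\<dots> = (\<Sum>\<alpha>\<in>?I. \<Sum>\<beta>\<in>?I. f \<alpha> \<beta>)"
      by (rule sum.swap)
    finally show ?thesis unfolding f_def .
  qed
  have "(\<Sum>\<alpha>\<in>?I. \<Sum>\<beta>\<in>?I. (w \<alpha> y * w \<beta> Y * K) \<bullet>\<^sub>n\<^sub>c Z_rel \<tau> n k \<eta> (1 - \<alpha>) (1 - \<beta>) u v)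
    = (\<Sum>\<alpha>\<in>?I. \<Sum>\<beta>\<in>?I. scalar (w \<alpha> y * w \<beta> Y * (K * Z_lhs_coeff \<tau> n \<eta> (v - u))) * (Zx \<alpha> u * Zx \<beta> v))
      - (\<Sum>\<alpha>\<in>?I. \<Sum>\<beta>\<in>?I. \<Sum>r\<in>?I. scalar (w \<alpha> y * w \<beta> Y * R (\<alpha> - \<beta>) r) * (Zx (\<beta> + r) v * Zx (\<alpha> - r) u))"
    unfolding Z_rel_scaled R_def by (simp only: sum_subtractf mult.assoc)
  also have "(\<Sum>\<alpha>\<in>?I. \<Sum>\<beta>\<in>?I. \<Sum>r\<in>?I. scalar (w \<alpha> y * w \<beta> Y * R (\<alpha> - \<beta>) r) * (Zx (\<beta> + r) v * Zx (\<alpha> - r) u))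
    = (\<Sum>\<alpha>\<in>?I. \<Sum>r\<in>?I. \<Sum>\<beta>\<in>?I. scalar (w \<alpha> y * w \<beta> Y * R (\<alpha> - \<beta>) r) * (Zx (\<beta> + r) v * Zx (\<alpha> - r) u))"
    by (intro sum.cong refl sum.swap)
  also have "\<dots> = (\<Sum>r\<in>?I. \<Sum>\<alpha>\<in>?I. \<Sum>\<beta>\<in>?I. scalar (w \<alpha> y * w \<beta> Y * R (\<alpha> - \<beta>) r) * (Zx (\<beta> + r) v * Zx (\<alpha> - r) u))"
    by (rule sum.swap)
  also have "\<dots> = (\<Sum>r\<in>?I. \<Sum>a\<in>?I. \<Sum>b\<in>?I. scalar (R (b - a + 2 * r) r * (w (b + r) y * w (a - r) Y)) * (Zx a v * Zx b u))"
    unfolding reindex ..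
  also have "\<dots> = (\<Sum>a\<in>?I. \<Sum>r\<in>?I. \<Sum>b\<in>?I. scalar (R (b - a + 2 * r) r * (w (b + r) y * w (a - r) Y)) * (Zx a v * Zx b u))"
    by (rule sum.swap)
  also have "\<dots> = (\<Sum>a\<in>?I. \<Sum>b\<in>?I. \<Sum>r\<in>?I. scalar (R (b - a + 2 * r) r * (w (b + r) y * w (a - r) Y)) * (Zx a v * Zx b u))"
    by (intro sum.cong refl sum.swap)
  also have "\<dots> = (\<Sum>a\<in>?I. \<Sum>b\<in>?I. scalar (\<Sum>t\<le>p. Y_coef \<eta> x t * (w a (arg1 \<eta> Y t x) * w b (arg2 Y t x))) * (Zx a v * Zx b u))"
    unfolding id scalar_sum sum_distrib_right ..
  finally show ?thesis
    unfolding lhs rhs by (intro exI[of _ "\<lambda>\<alpha> \<beta>. w \<alpha> y * w \<beta> Y * K"]) (simp only:)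
qed

lemma Y_e_image:
  "nc_subst (\<lambda>(u, q). image_gen (u / of_nat n) q) (Y_e p (of_nat n * u) q) = image_gen u q"
proof -
  have "w \<alpha> (\<lambda>j. restrict q {1..p} j + of_int (gamma_coef j) * u) = w \<alpha> (\<lambda>j. q j + of_int (gamma_coef j) * u)" for \<alpha>
    by (rule w_cong) simp
  then show ?thesis
    using n_pos by (simp add: Y_e_def image_gen_def)
qed

lemma image_gen_cong:
  assumes "\<And>j. j \<in> {1..p} \<Longrightarrow> q j = q' j"
  shows "image_gen u q = image_gen u q'"
proof -
  have "w \<alpha> (\<lambda>j. q j + of_int (gamma_coef j) * u) = w \<alpha> (\<lambda>j. q' j + of_int (gamma_coef j) * u)" for \<alpha>
    by (rule w_cong) (simp add: assms)
  then show ?thesis by (simp add: image_gen_def)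
qed

lemma Y_rel_image:
  assumes \<mu>s: "\<And>j. j \<in> {1..p} \<Longrightarrow> \<mu>s j = of_int (mu_coef j) * \<eta>"
    and z: "of_nat n * (v - u) \<notin> period_lattice \<tau>"
    and s: "\<And>j. j \<in> {1..p} \<Longrightarrow> us j - vs j \<notin> period_lattice \<tau>"
  shows "\<exists>K. nc_subst (\<lambda>(u, q). image_gen (u / of_nat n) q)
      (Y_rel \<tau> p (of_nat n * \<eta>) \<mu>s (of_nat n * u) (of_nat n * v) us vs) =
      (\<Sum>\<alpha>\<in>{0..<int n}. \<Sum>\<beta>\<in>{0..<int n}. (K \<alpha> \<beta>) \<bullet>\<^sub>n\<^sub>c Z_rel \<tau> n k \<eta> (1 - \<alpha>) (1 - \<beta>) u v)"
proof -
  define x where "x = (\<lambda>j. if j = 0 then v - u else us j - vs j)"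
  define B where "B t = image_gen v (\<lambda>j. if j \<le> t then vs j else us j) *
          image_gen u (\<lambda>j. (if j \<le> t then us j else vs j) + of_int (mu_coef j) * \<eta>)" for t
  have m: "image_gen u' (\<lambda>j. q j + \<mu>s j) = image_gen u' (\<lambda>j. q j + of_int (mu_coef j) * \<eta>)" for u' q
    by (rule image_gen_cong) (simp add: \<mu>s)
  have diff: "of_nat n * v - of_nat n * u = of_nat n * (v - u)" by (simp add: right_diff_distrib)
  have e: "offset \<eta> x j = us j - vs j" if "j \<in> {1..p}" for j using that by (auto simp: offset_def x_def)
  have e0: "offset \<eta> x 0 = - (of_nat n * (v - u))" by (simp add: offset_def x_def)
  have B0: "image_gen v us * image_gen u (\<lambda>j. vs j + of_int (mu_coef j) * \<eta>) = B 0"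
    unfolding B_def by (intro arg_cong2[of _ _ _ _ "(*)"] image_gen_cong) auto
  have Bp: "image_gen v vs * image_gen u (\<lambda>j. us j + of_int (mu_coef j) * \<eta>) = B p"
    unfolding B_def by (intro arg_cong2[of _ _ _ _ "(*)"] image_gen_cong) auto
  have K0: "tht (of_nat n * \<eta>) * tht (of_nat n * (v - u) + us 1 - vs 1) / (tht (of_nat n * (v - u)) * tht (us 1 - vs 1))
      = Y_coef \<eta> x 0"
    using e[of 1] one_le_p p_pos unfolding Y_coef_def e0 by (simp add: add_diff_eq add.commute diff_add_eq)
  have Kt: "tht (of_nat n * \<eta>) * tht (vs t - us t + us (t + 1) - vs (t + 1)) / (tht (vs t - us t) * tht (us (t + 1) - vs (t + 1)))
      = Y_coef \<eta> x t" if "t \<in> {1..<p}" for t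
  proof -
    have "us (Suc t) - vs (Suc t) - (us t - vs t) = vs t - us t + us (t + 1) - vs (t + 1)" by simp
    moreover have "offset \<eta> x t = us t - vs t" "offset \<eta> x (Suc t) = us (Suc t) - vs (Suc t)" "t \<noteq> p"
      using that e[of t] e[of "Suc t"] by auto
    ultimately show ?thesis
      unfolding Y_coef_def by (simp only: if_False minus_diff_eq Suc_eq_plus1)
  qed
  have Kp: "tht (vs p - us p + of_nat n * \<eta>) / tht (vs p - us p) = Y_coef \<eta> x p"
    using p_pos by (simp add: Y_coef_def x_def)
  have split: "(\<Sum>t\<le>p. scalar (Y_coef \<eta> x t) * B t) = scalar (Y_coef \<eta> x 0) * B 0 +
      (\<Sum>t\<in>{1..<p}. scalar (Y_coef \<eta> x t) * B t) + scalar (Y_coef \<eta> x p) * B p"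
  proof -
    have "{..p} = insert 0 (insert p {1..<p})" using one_le_p by auto
    moreover have "0 \<notin> insert p {1..<p}" "p \<notin> {1..<p}" using one_le_p by auto
    ultimately show ?thesis by (simp add: add_ac)
  qed
  have mid: "(\<Sum>t\<in>{1..<p}. scalar (tht (of_nat n * \<eta>) * tht (vs t - us t + us (t + 1) - vs (t + 1)) / (tht (vs t - us t) * tht (us (t + 1) - vs (t + 1)))) * B t)
     = (\<Sum>t\<in>{1..<p}. scalar (Y_coef \<eta> x t) * B t)"
    by (intro sum.cong refl) (simp only: Kt)
  have "nc_subst (\<lambda>(u, q). image_gen (u / of_nat n) q)
      (Y_rel \<tau> p (of_nat n * \<eta>) \<mu>s (of_nat n * u) (of_nat n * v) us vs)
    = scalar (tht (of_nat n * (v - u) + of_nat n * \<eta>) / tht (of_nat n * (v - u))) *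
        (image_gen u us * image_gen v (\<lambda>j. vs j + of_int (mu_coef j) * \<eta>)) -
      (\<Sum>t\<le>p. scalar (Y_coef \<eta> x t) * B t)"
    unfolding Y_rel_def nc_subst_diff nc_subst_sum nc_scale_scalar nc_subst_mult nc_subst_scalar Y_e_image m diff
      B0 Bp K0 Kp B_def[symmetric] mid split
    by (simp only: diff_diff_eq add.assoc)
  then show ?thesis
    using Y_relation_image[where u = u and v = v and us = us and vs = vs and \<eta> = \<eta>, OF z s]
    unfolding B_def x_def by (simp only:)
qed

lemma Zx_carrier: "Zx \<alpha> u \<in> carrier (free_algebra (Z_gens n))"
  unfolding Zx_def Z_x_def by (rule free_algebra_var) (use n_pos in \<open>simp add: Z_gens_def\<close>)

lemma Z_x_carrier: "Z_x n \<alpha> u \<in> carrier (free_algebra (Z_gens n))"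
  unfolding Z_x_def by (rule free_algebra_var) (use n_pos in \<open>simp add: Z_gens_def\<close>)

lemma image_gen_carrier: "image_gen u q \<in> carrier (free_algebra (Z_gens n))"
  unfolding image_gen_def by (intro free_algebra_sum free_algebra_mult free_algebra_scalar Zx_carrier)

lemma Z_rels_carrier: "Z_rels \<tau> n k \<eta> \<subseteq> carrier (free_algebra (Z_gens n))"
  unfolding Z_rels_def Z_rel_def
  by (auto intro!: free_algebra_diff free_algebra_scale free_algebra_mult free_algebra_sum Z_x_carrier)

end

lemma Y_e_carrier: "Y_e p u us \<in> carrier (free_algebra (Y_gens p))"
  unfolding Y_e_def by (rule free_algebra_var) (simp add: Y_gens_def)

lemma Y_rels_carrier: "Y_rels \<tau> p \<mu> \<mu>s \<subseteq> carrier (free_algebra (Y_gens p))"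
  unfolding Y_rels_def Y_rel_def
  by (auto intro!: free_algebra_diff free_algebra_scale free_algebra_mult free_algebra_sum Y_e_carrier)

text \<open>Since the generators of \<open>Y\<close> are indexed by \<open>nu\<close>, the substitution divides their first parameter by \<open>n\<close>.\<close>

theorem proposition7:
  fixes \<tau> \<eta> \<phi> \<mu> :: complex and n k p :: nat and ns :: "int list"
    and \<mu>s :: "nat \<Rightarrow> complex" and \<gamma> :: "nat \<Rightarrow> int"
    and w :: "int \<Rightarrow> (nat \<Rightarrow> complex) \<Rightarrow> complex"
  assumes "Im \<tau> > 0"
    and "1 \<le> k" and "k < n" and "coprime n k"
    and "ns \<noteq> []" and "\<forall>m\<in>set ns. m \<ge> 2"
    and "real n / real (n - k) = minus_cf ns"
    and "p = length ns"
    and "theta_phase \<tau> n ns \<phi>"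
    and "theta_basis \<tau> n k ns \<phi> w"
    and "\<mu> = of_nat n * \<eta>"
    and "\<forall>j\<in>{1..p}. \<mu>s j = of_int (tridiag_det (take (j - 1) ns)) * \<eta>"
    and "\<forall>j\<in>{1..p}. \<gamma> j = - tridiag_det (drop j ns)"
  shows "\<exists>\<Psi> \<in> algebra_hom (Y_alg \<tau> p \<mu> \<mu>s) (Z_alg \<tau> n k \<eta>).
    \<forall>u us. \<Psi> (Y_gen \<tau> p \<mu> \<mu>s (of_nat n * u) us) =
      (\<Oplus>\<^bsub>Z_alg \<tau> n k \<eta>\<^esub>\<alpha>\<in>{0..<int n}.
        w \<alpha> (\<lambda>j. us j + of_int (\<gamma> j) * u) \<odot>\<^bsub>Z_alg \<tau> n k \<eta>\<^esub> Z_gen \<tau> n k \<eta> (1 - \<alpha>) u)"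
proof -
  interpret theta_basis_data \<tau> \<phi> n k ns w
    by unfold_locales (use assms tridiag_det_of_minus_cf[of ns k n] in auto)
  note p = \<open>p = length ns\<close>
  let ?\<sigma> = "\<lambda>(u, q). image_gen (u / of_nat n) q"
  have \<mu>s: "\<mu>s j = of_int (mu_coef j) * \<eta>" if "j \<in> {1..length ns}" for j
    using assms(12) that by (auto simp: p mu_coef_def)
  have \<gamma>: "\<gamma> j = gamma_coef j" if "j \<in> {1..length ns}" for j
    using assms(13) that by (auto simp: p gamma_coef_def)
  note ZR = Z_rels_carrier[of \<eta>]
  have rel: "nc_subst ?\<sigma> r \<in> rel_ideal (Z_gens n) (Z_rels \<tau> n k \<eta>)" if "r \<in> Y_rels \<tau> p \<mu> \<mu>s" for r
  proof -
    from that obtain u' v' us vs where r: "r = Y_rel \<tau> p \<mu> \<mu>s u' v' us vs" "v' - u' \<notin> period_lattice \<tau>"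
      "\<And>j. j \<in> {1..p} \<Longrightarrow> us j - vs j \<notin> period_lattice \<tau>"
      by (auto simp: Y_rels_def)
    define u v where "u = u' / of_nat n" and "v = v' / of_nat n"
    have uv: "u' = of_nat n * u" "v' = of_nat n * v" using n_pos by (simp_all add: u_def v_def)
    have z: "of_nat n * (v - u) \<notin> period_lattice \<tau>" using r(2) by (simp add: uv right_diff_distrib)
    obtain K where K: "nc_subst ?\<sigma> r =
        (\<Sum>\<alpha>\<in>{0..<int n}. \<Sum>\<beta>\<in>{0..<int n}. (K \<alpha> \<beta>) \<bullet>\<^sub>n\<^sub>c Z_rel \<tau> n k \<eta> (1 - \<alpha>) (1 - \<beta>) u v)"
      using Y_rel_image[of \<mu>s \<eta> v u us vs, OF \<mu>s z r(3)[unfolded p]]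
      unfolding r(1) uv p \<open>\<mu> = of_nat n * \<eta>\<close> by blast
    have "Z_rel \<tau> n k \<eta> (1 - \<alpha>) (1 - \<beta>) u v \<in> rel_ideal (Z_gens n) (Z_rels \<tau> n k \<eta>)" for \<alpha> \<beta>
      by (rule subsetD[OF rel_ideal(2)[OF ZR]]) (use z in \<open>unfold Z_rels_def, blast\<close>)
    then show ?thesis
      unfolding K by (intro rel_ideal_sum[OF ZR] rel_ideal_scale[OF ZR])
  qed
  have \<sigma>: "?\<sigma> g \<in> carrier (free_algebra (Z_gens n))" for g
    by (cases g) (simp add: image_gen_carrier)
  obtain \<Psi> where \<Psi>: "\<Psi> \<in> algebra_hom (Y_alg \<tau> p \<mu> \<mu>s) (Z_alg \<tau> n k \<eta>)"
    "\<And>q. q \<in> carrier (free_algebra (Y_gens p)) \<Longrightarrow>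
       \<Psi> (rel_class (Y_gens p) (Y_rels \<tau> p \<mu> \<mu>s) q) = rel_class (Z_gens n) (Z_rels \<tau> n k \<eta>) (nc_subst ?\<sigma> q)"
    using presented_algebra_hom[OF Y_rels_carrier ZR \<sigma> rel] unfolding Y_alg_def Z_alg_def by blast
  show ?thesis
  proof (intro bexI[OF _ \<Psi>(1)] allI)
    fix u us
    have "\<Psi> (Y_gen \<tau> p \<mu> \<mu>s (of_nat n * u) us) = rel_class (Z_gens n) (Z_rels \<tau> n k \<eta>) (image_gen u us)"
      unfolding Y_gen_def \<Psi>(2)[OF Y_e_carrier] by (simp only: p Y_e_image)
    also have "image_gen u us = (\<Sum>\<alpha>\<in>{0..<int n}. w \<alpha> (\<lambda>j. us j + of_int (\<gamma> j) * u) \<bullet>\<^sub>n\<^sub>c Z_x n (1 - \<alpha>) u)"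
    proof -
      have "w \<alpha> (\<lambda>j. us j + of_int (gamma_coef j) * u) = w \<alpha> (\<lambda>j. us j + of_int (\<gamma> j) * u)" for \<alpha>
        by (rule w_cong) (simp add: \<gamma>)
      then show ?thesis by (simp add: image_gen_def Zx_def nc_scale_scalar)
    qed
    also have "rel_class (Z_gens n) (Z_rels \<tau> n k \<eta>) \<dots> =
      (\<Oplus>\<^bsub>Z_alg \<tau> n k \<eta>\<^esub>\<alpha>\<in>{0..<int n}. rel_class (Z_gens n) (Z_rels \<tau> n k \<eta>)
         (w \<alpha> (\<lambda>j. us j + of_int (\<gamma> j) * u) \<bullet>\<^sub>n\<^sub>c Z_x n (1 - \<alpha>) u))"
      unfolding Z_alg_def
      by (rule rel_class_finsum[OF ZR, symmetric]) (auto intro: free_algebra_scale Z_x_carrier)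
    also have "\<dots> = (\<Oplus>\<^bsub>Z_alg \<tau> n k \<eta>\<^esub>\<alpha>\<in>{0..<int n}.
        w \<alpha> (\<lambda>j. us j + of_int (\<gamma> j) * u) \<odot>\<^bsub>Z_alg \<tau> n k \<eta>\<^esub> Z_gen \<tau> n k \<eta> (1 - \<alpha>) u)"
      unfolding Z_gen_def Z_alg_def rel_class_smult[OF ZR] ..
    finally show "\<Psi> (Y_gen \<tau> p \<mu> \<mu>s (of_nat n * u) us) =
      (\<Oplus>\<^bsub>Z_alg \<tau> n k \<eta>\<^esub>\<alpha>\<in>{0..<int n}.
        w \<alpha> (\<lambda>j. us j + of_int (\<gamma> j) * u) \<odot>\<^bsub>Z_alg \<tau> n k \<eta>\<^esub> Z_gen \<tau> n k \<eta> (1 - \<alpha>) u)" .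
  qed
qed

end
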